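(* Let $(\Omega,\Sigma,\mu)$ be a finite measure space, let $E$ be a separable Banach space, let $1\le p<\infty$ with conjugate exponent $q$ ($1/p+1/q=1$), and let $M:\Omega\rightrightarrows E$ be a closed-valued multifunction with $\mathrm{gph}\,M\in\Sigma\otimes\mathcal{B}(E)$. Define $\mathcal{M}=\{f\in L^p(\mu,E): f(\omega)\in M(\omega)\ \text{a.e. }\omega\in\Omega\}$. If $\bar{f}\in\mathcal{M}$ and $M(\omega)$ is regular at $\bar{f}(\omega)$ for a.e. $\omega\in\Omega$, then $$N^\circ(\bar{f};\mathcal{M})=\{g\in L^q_{w^*}(\mu,E^* ): g(\omega)\in N^\circ(\bar{f}(\omega);M(\omega))\ \text{a.e. }\omega\in\Omega\}.$$
   Context: $\mathcal{B}(E)$ is the Borel $\sigma$-algebra of the norm topology. $L^p(\mu,E)$ is the space of ($\mu$-equivalence classes of) Bochner integrable $E$-valued maps with $\int\|f\|^p\,d\mu<\infty$. $L^q_{w^*}(\mu,E^* )$ is the space of ($\mu$-equivalence classes of) maps $g:\Omega\to E^*$ that are weak$^*$-scalarly measurable (i.e. $\omega\mapsto\langle g(\omega),x\rangle$ is measurable for each $x\in E$) with $\|g(\cdot)\|\in L^q(\mu)$; for separable $E$ it is identified with the dual of $L^p(\mu,E)$ via $\langle g,f\rangle=\int\langle g(\omega),f(\omega)\rangle\,d\mu$. For a subset $C$ of a Banach space $X$ and $\bar{x}\in C$: $d_C(x)=\inf_{c\in C}\|c-x\|$; the Clarke directional derivative of a locally Lipschitz $\phi$ is $\phi^\circ(\bar{x};h)=\limsup_{x\to\bar{x},\theta\downarrow0}(\phi(x+\theta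 h)-\phi(x))/\theta$ and $\partial^\circ\phi(\bar{x})=\{x^*:\langle x^*,h\rangle\le\phi^\circ(\bar{x};h)\ \forall h\}$; the Clarke normal cone is $N^\circ(\bar{x};C)=$ weak$^*$ closure of $\bigcup_{\alpha>0}\alpha\,\partial^\circ d_C(\bar{x})$; the Clarke tangent cone is $T^\circ(\bar{x};C)=\{h:\langle x^*,h\rangle\le0\ \forall x^*\in N^\circ(\bar{x};C)\}$; the contingent cone is $K(\bar{x};C)=\{h:\liminf_{\theta\downarrow0}d_C(\bar{x}+\theta h)/\theta=0\}$; $C$ is regular at $\bar{x}$ if $T^\circ(\bar{x};C)=K(\bar{x};C)$. *)

theory Defs
  imports "HOL-Analysis.Analysis"
begin

definition dist_set :: "'e::real_normed_vector set \<Rightarrow> 'e \<Rightarrow> real" where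
  "dist_set C x = Inf {norm (c - x) | c. c \<in> C}"

definition clarke_dd :: "('e::real_normed_vector \<Rightarrow> real) \<Rightarrow> 'e \<Rightarrow> 'e \<Rightarrow> ereal" where
  "clarke_dd phi xb h = (INF d\<in>{d::real. d > 0}.
      SUP z\<in>{(x, t). norm (x - xb) < d \<and> 0 < t \<and> t < d}.
        ereal ((phi (fst z + snd z *\<^sub>R h) - phi (fst z)) / snd z))"

definition clarke_subdiff :: "('e::real_normed_vector \<Rightarrow> real) \<Rightarrow> 'e \<Rightarrow> ('e \<Rightarrow>\<^sub>L real) set" where
  "clarke_subdiff phi xb = {xs. \<forall>h. ereal (blinfun_apply xs h) \<le> clarke_dd phi xb h}"

definition weak_star_closure :: "('e::real_normed_vector \<Rightarrow>\<^sub>L real) set \<Rightarrow> ('e \<Rightarrow>\<^sub>L real) set" where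
  "weak_star_closure S = {y. \<forall>F. finite F \<longrightarrow> (\<forall>e>0. \<exists>s\<in>S. \<forall>x\<in>F.
       \<bar>blinfun_apply s x - blinfun_apply y x\<bar> < e)}"

definition clarke_normal :: "'e::real_normed_vector set \<Rightarrow> 'e \<Rightarrow> ('e \<Rightarrow>\<^sub>L real) set" where
  "clarke_normal C xb = weak_star_closure
     {a *\<^sub>R s | a s. a > 0 \<and> s \<in> clarke_subdiff (dist_set C) xb}"

definition clarke_tangent :: "'e::real_normed_vector set \<Rightarrow> 'e \<Rightarrow> 'e set" where
  "clarke_tangent C xb = {h. \<forall>xs\<in>clarke_normal C xb. blinfun_apply xs h \<le> 0}"

definition contingent_cone :: "'e::real_normed_vector set \<Rightarrow> 'e \<Rightarrow> 'e set" where
  "contingent_cone C xb = {h. Liminf (at_right (0::real))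
       (\<lambda>t. ereal (dist_set C (xb + t *\<^sub>R h) / t)) = 0}"

definition regular_at :: "'e::real_normed_vector set \<Rightarrow> 'e \<Rightarrow> bool" where
  "regular_at C xb \<longleftrightarrow> clarke_tangent C xb = contingent_cone C xb"

section \<open>The spaces L^p(mu,E) and L^q_w*(mu,E*) (on representatives)\<close>

definition Lp :: "'a measure \<Rightarrow> real \<Rightarrow> ('a \<Rightarrow> 'e::{banach,second_countable_topology}) set" where
  "Lp M p = {f. f \<in> borel_measurable M \<and> integrable M f \<and>
                 integrable M (\<lambda>w. norm (f w) powr p)}"

definition Lp_norm :: "'a measure \<Rightarrow> real \<Rightarrow> ('a \<Rightarrow> 'e::real_normed_vector) \<Rightarrow> real" where
  "Lp_norm M p f = (\<integral>w. norm (f w) powr p \<partial>M) powr (1 / p)"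

text \<open>Conjugate exponent: q = infinity if p = 1, otherwise q = p/(p-1).\<close>
definition Lq_wstar :: "'a measure \<Rightarrow> real \<Rightarrow> ('a \<Rightarrow> ('e::real_normed_vector \<Rightarrow>\<^sub>L real)) set" where
  "Lq_wstar M p = {g. (\<forall>x. (\<lambda>w. blinfun_apply (g w) x) \<in> borel_measurable M) \<and>
      (\<lambda>w. norm (g w)) \<in> borel_measurable M \<and>
      (if p = 1 then (\<exists>C. AE w in M. norm (g w) \<le> C)
       else integrable M (\<lambda>w. norm (g w) powr (p / (p - 1))))}"

definition pairing :: "'a measure \<Rightarrow> ('a \<Rightarrow> ('e::real_normed_vector \<Rightarrow>\<^sub>L real)) \<Rightarrow> ('a \<Rightarrow> 'e) \<Rightarrow> real" where
  "pairing M g f = (\<integral>w. blinfun_apply (g w) (f w) \<partial>M)"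

section \<open>Nonsmooth analysis in L^p(mu,E), dual identified with L^q_w*(mu,E*)\<close>

definition Lp_dist_set :: "'a measure \<Rightarrow> real \<Rightarrow> ('a \<Rightarrow> 'e::{banach,second_countable_topology}) set
     \<Rightarrow> ('a \<Rightarrow> 'e) \<Rightarrow> real" where
  "Lp_dist_set M p C f = Inf {Lp_norm M p (\<lambda>w. c w - f w) | c. c \<in> C}"

definition Lp_clarke_dd :: "'a measure \<Rightarrow> real \<Rightarrow> (('a \<Rightarrow> 'e::{banach,second_countable_topology}) \<Rightarrow> real)
     \<Rightarrow> ('a \<Rightarrow> 'e) \<Rightarrow> ('a \<Rightarrow> 'e) \<Rightarrow> ereal" where
  "Lp_clarke_dd M p phi fb h = (INF d\<in>{d::real. d > 0}.
      SUP z\<in>{(f, t). f \<in> Lp M p \<and> Lp_norm M p (\<lambda>w. f w - fb w) < d \<and> 0 < t \<and> t < d}.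
        ereal ((phi (\<lambda>w. fst z w + snd z *\<^sub>R h w) - phi (fst z)) / snd z))"

definition Lp_clarke_subdiff :: "'a measure \<Rightarrow> real \<Rightarrow> (('a \<Rightarrow> 'e::{banach,second_countable_topology}) \<Rightarrow> real)
     \<Rightarrow> ('a \<Rightarrow> 'e) \<Rightarrow> ('a \<Rightarrow> ('e \<Rightarrow>\<^sub>L real)) set" where
  "Lp_clarke_subdiff M p phi fb = {g \<in> Lq_wstar M p.
      \<forall>h\<in>Lp M p. ereal (pairing M g h) \<le> Lp_clarke_dd M p phi fb h}"

definition Lp_weak_star_closure :: "'a measure \<Rightarrow> real \<Rightarrow> ('a \<Rightarrow> ('e::{banach,second_countable_topology} \<Rightarrow>\<^sub>L real)) set
     \<Rightarrow> ('a \<Rightarrow> ('e \<Rightarrow>\<^sub>L real)) set" where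
  "Lp_weak_star_closure M p S = {y \<in> Lq_wstar M p. \<forall>F. F \<subseteq> Lp M p \<and> finite F \<longrightarrow>
      (\<forall>e>0. \<exists>s\<in>S. \<forall>f\<in>F. \<bar>pairing M s f - pairing M y f\<bar> < e)}"

definition Lp_clarke_normal :: "'a measure \<Rightarrow> real \<Rightarrow> ('a \<Rightarrow> 'e::{banach,second_countable_topology}) set
     \<Rightarrow> ('a \<Rightarrow> 'e) \<Rightarrow> ('a \<Rightarrow> ('e \<Rightarrow>\<^sub>L real)) set" where
  "Lp_clarke_normal M p C fb = Lp_weak_star_closure M p
     {(\<lambda>w. a *\<^sub>R s w) | a s. a > 0 \<and> s \<in> Lp_clarke_subdiff M p (Lp_dist_set M p C) fb}"

end

theory Submission
  imports Defs "HOL-Library.Function_Algebras"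
begin

text \<open>
  Both normal cones are polars of the sets where the Clarke directional derivative of the distance
  function is nonpositive (Hahn--Banach), so the two inclusions are statements about directions.

  Aumann selection produces near-optimal selections of \<open>Gam\<close>; with dominated convergence, a direction
  \<open>h\<close> that is pointwise Clarke tangent a.e. is Clarke tangent to the set of selections. Hence every
  normal \<open>g\<close> satisfies \<open>\<langle>g, h\<rangle> \<le> 0\<close> for all such \<open>h\<close>, and a measurable selection of violating
  tangent vectors shows that \<open>g\<close> is pointwise normal a.e.

  Conversely, let \<open>h\<close> be nonpositive on all Clarke subgradients. Infimal convolution of the Clarke
  derivative with an \<open>L\<^sup>1\<close> norm reduces the duality needed here to that of \<open>L\<^sup>1\<close>, whose functionals are
  represented by Radon--Nikodym derivatives, and yields \<open>c\<^sub>n\<close> in the set of selections and \<open>t\<^sub>n \<rightarrow> 0\<close>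
  with \<open>(c\<^sub>n - fb) / t\<^sub>n \<rightarrow> h\<close> in \<open>L\<^sup>1\<close>. So \<open>h\<close> is pointwise contingent, hence by regularity pointwise
  Clarke tangent, and a pointwise normal \<open>g\<close> has \<open>\<langle>g, h\<rangle> \<le> 0\<close>.
\<close>


section \<open>Hahn--Banach and separation\<close>

text \<open>Functions are representatives and not classes, so \<open>Lp_norm\<close> is only a
  seminorm; the calculus of Clarke derivatives is therefore set up for a seminorm on a subspace and
  serves both E and L^p. The polar argument needs functionals on L^p that are given by elements of
  \<open>Lq_wstar\<close>. Hahn-Banach applied to the Clarke derivative alone yields an L^p-bounded
  functional, which would call for the full dual of L^p. After infimal convolution with the L^1 norm
  the functional is L^1-bounded, so its representing map has bounded norm and lies in
  \<open>Lq_wstar\<close> for every p. The price is that h is approximated in L^1 only; this is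
  enough, since contingency is a pointwise statement and a subsequence converges a.e. The measure is
  not assumed complete and projections of measurable sets need not be measurable, so selections and
  measurability statements hold off a null set.\<close>

instantiation "fun" :: (type, real_vector) real_vector
begin
definition "r *\<^sub>R f = (\<lambda>x. r *\<^sub>R f x)"
instance
  by standard (simp_all add: scaleR_fun_def fun_eq_iff algebra_simps)
end

lemma scaleR_fun_apply [simp]: "(r *\<^sub>R f) x = r *\<^sub>R f x"
  by (simp add: scaleR_fun_def)

definition sublinear_on :: "'v::real_vector set \<Rightarrow> ('v \<Rightarrow> real) \<Rightarrow> bool" where
  "sublinear_on V q \<longleftrightarrow> (\<forall>x\<in>V. \<forall>y\<in>V. q (x + y) \<le> q x + q y) \<and>
     (\<forall>x\<in>V. \<forall>r>0. q (r *\<^sub>R x) = r * q x)"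

definition linear_functional_on :: "'v::real_vector set \<Rightarrow> ('v \<Rightarrow> real) \<Rightarrow> bool" where
  "linear_functional_on V L \<longleftrightarrow> (\<forall>x\<in>V. \<forall>y\<in>V. L (x + y) = L x + L y) \<and>
     (\<forall>x\<in>V. \<forall>r. L (r *\<^sub>R x) = r * L x)"

lemma sublinear_on_zero:
  assumes "subspace V" "sublinear_on V q"
  shows "q 0 = 0"
proof -
  have "q (2 *\<^sub>R 0) = 2 * q 0"
    using assms unfolding sublinear_on_def subspace_def by (meson zero_less_numeral)
  then show ?thesis by simp
qed

lemma sublinear_on_neg:
  assumes "subspace V" "sublinear_on V q" "x \<in> V"
  shows "- q (- x) \<le> q x"
proof -
  have "q (x + - x) \<le> q x + q (- x)"
    using assms unfolding sublinear_on_def by (meson subspace_neg)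
  then show ?thesis using sublinear_on_zero[OF assms(1,2)] by simp
qed

text \<open>For sublinear \<open>q\<close> this is the largest sublinear minorant of
  \<open>q\<close> whose value at \<open>- h\<close> is at most \<open>- q h\<close>. A linear
  functional \<open>L\<close> below it satisfies \<open>L h \<ge> q h\<close>, hence
  \<open>L h = q h\<close>.\<close>

definition ray_inf :: "('v::real_vector \<Rightarrow> real) \<Rightarrow> 'v \<Rightarrow> 'v \<Rightarrow> real" where
  "ray_inf q h x = (INF t\<in>{0..}. q (x + t *\<^sub>R h) - t * q h)"

lemma ray_inf:
  assumes V: "subspace V" and q: "sublinear_on V q" and h: "h \<in> V"
  shows ray_inf_lower: "\<And>x t. x \<in> V \<Longrightarrow> t \<ge> 0 \<Longrightarrow> ray_inf q h x \<le> q (x + t *\<^sub>R h) - t * q h"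
    and ray_inf_le: "\<And>x. x \<in> V \<Longrightarrow> ray_inf q h x \<le> q x"
    and ray_inf_sublinear: "sublinear_on V (ray_inf q h)"
proof -
  have mem: "x + t *\<^sub>R h \<in> V" if "x \<in> V" for x t
    using that h V by (simp add: subspace_add subspace_scale)
  have hom: "q (r *\<^sub>R x) = r * q x" if "x \<in> V" "r \<ge> 0" for x r
    using q that sublinear_on_zero[OF V q] unfolding sublinear_on_def by (cases "r = 0") auto
  have sub: "q (x + y) \<le> q x + q y" if "x \<in> V" "y \<in> V" for x y
    using q that unfolding sublinear_on_def by auto
  \<comment> \<open>This bound does not depend on \<open>t\<close>; it keeps the infimum over the
    ray finite.\<close>
  have low: "- q (- x) \<le> q (x + t *\<^sub>R h) - t * q h" if "x \<in> V" "t \<ge> 0" for x t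
  proof -
    have "q ((x + t *\<^sub>R h) + (- x)) \<le> q (x + t *\<^sub>R h) + q (- x)"
      using that V mem by (intro sub) (auto simp: subspace_neg)
    moreover have "(x + t *\<^sub>R h) + (- x) = t *\<^sub>R h" by simp
    ultimately show ?thesis using hom[OF h \<open>t \<ge> 0\<close>] by simp
  qed
  have bdd: "bdd_below ((\<lambda>t. q (x + t *\<^sub>R h) - t * q h) ` {0..})" if "x \<in> V" for x
    using low[OF that] by (intro bdd_belowI[of _ "- q (- x)"]) auto
  show lower: "\<And>x t. x \<in> V \<Longrightarrow> t \<ge> 0 \<Longrightarrow> ray_inf q h x \<le> q (x + t *\<^sub>R h) - t * q h"
    unfolding ray_inf_def by (intro cINF_lower bdd) auto
  show "\<And>x. x \<in> V \<Longrightarrow> ray_inf q h x \<le> q x"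
    using lower[where t=0] by simp
  have greatest: "c \<le> ray_inf q h x" if "\<And>t. t \<ge> 0 \<Longrightarrow> c \<le> q (x + t *\<^sub>R h) - t * q h" for c x
    unfolding ray_inf_def using that by (intro cINF_greatest) auto
  have le_hom: "ray_inf q h (r *\<^sub>R x) \<le> r * ray_inf q h x" if x: "x \<in> V" and r: "r > 0" for x r
  proof -
    have "ray_inf q h (r *\<^sub>R x) / r \<le> ray_inf q h x"
    proof (rule greatest)
      fix t :: real assume "t \<ge> 0"
      have "ray_inf q h (r *\<^sub>R x) \<le> q (r *\<^sub>R x + (r * t) *\<^sub>R h) - (r * t) * q h"
        using x r V \<open>t \<ge> 0\<close> by (intro lower) (auto simp: subspace_scale)
      also have "r *\<^sub>R x + (r * t) *\<^sub>R h = r *\<^sub>R (x + t *\<^sub>R h)"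
        by (simp add: scaleR_add_right)
      also have "q (r *\<^sub>R (x + t *\<^sub>R h)) = r * q (x + t *\<^sub>R h)"
        using mem[OF x] r by (intro hom) auto
      finally show "ray_inf q h (r *\<^sub>R x) / r \<le> q (x + t *\<^sub>R h) - t * q h"
        using r by (simp add: field_simps)
    qed
    then show ?thesis using r by (simp add: field_simps)
  qed
  show "sublinear_on V (ray_inf q h)"
    unfolding sublinear_on_def
  proof (intro conjI ballI allI impI)
    fix x y assume x: "x \<in> V" and y: "y \<in> V"
    have *: "ray_inf q h (x + y) \<le> (q (x + t *\<^sub>R h) - t * q h) + (q (y + s *\<^sub>R h) - s * q h)"
      if "t \<ge> 0" "s \<ge> 0" for t s
    proof -
      have "ray_inf q h (x + y) \<le> q ((x + y) + (t + s) *\<^sub>R h) - (t + s) * q h"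
        using x y V that by (intro lower) (auto simp: subspace_add)
      also have "(x + y) + (t + s) *\<^sub>R h = (x + t *\<^sub>R h) + (y + s *\<^sub>R h)"
        by (simp add: scaleR_add_left)
      also have "q \<dots> \<le> q (x + t *\<^sub>R h) + q (y + s *\<^sub>R h)"
        using mem x y by (intro sub) auto
      finally show ?thesis by (simp add: algebra_simps)
    qed
    have "ray_inf q h (x + y) - ray_inf q h y \<le> ray_inf q h x"
    proof (rule greatest)
      fix t :: real assume t: "t \<ge> 0"
      have "ray_inf q h (x + y) - (q (x + t *\<^sub>R h) - t * q h) \<le> ray_inf q h y"
      proof (rule greatest)
        fix s :: real assume s: "s \<ge> 0"
        show "ray_inf q h (x + y) - (q (x + t *\<^sub>R h) - t * q h) \<le> q (y + s *\<^sub>R h) - s * q h"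
          using *[OF t s] by linarith
      qed
      then show "ray_inf q h (x + y) - ray_inf q h y \<le> q (x + t *\<^sub>R h) - t * q h" by linarith
    qed
    then show "ray_inf q h (x + y) \<le> ray_inf q h x + ray_inf q h y" by linarith
  next
    fix x and r :: real assume x: "x \<in> V" and r: "r > 0"
    have "ray_inf q h ((1/r) *\<^sub>R (r *\<^sub>R x)) \<le> (1/r) * ray_inf q h (r *\<^sub>R x)"
      using x r V by (intro le_hom) (auto simp: subspace_scale)
    then have "r * ray_inf q h x \<le> ray_inf q h (r *\<^sub>R x)"
      using r by (simp add: field_simps)
    with le_hom[OF x r] show "ray_inf q h (r *\<^sub>R x) = r * ray_inf q h x" by linarith
  qed
qed

text \<open>Zorn's lemma for the reversed pointwise order. The infimum of a chain stays subadditive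
  because, of two members used for \<open>x\<close> and \<open>y\<close>, the smaller one serves
  both; it stays finite by the bound \<open>- q (- x)\<close>, valid for every sublinear
  minorant.\<close>

lemma minimal_sublinear_exists:
  assumes V: "subspace V" and q: "sublinear_on V q"
  obtains m where "sublinear_on V m" "\<And>x. x \<in> V \<Longrightarrow> m x \<le> q x"
    "\<forall>m'. sublinear_on V m' \<longrightarrow> (\<forall>x\<in>V. m' x \<le> m x) \<longrightarrow> (\<forall>x\<in>V. m' x = m x)"
proof -
  \<comment> \<open>Members are 0 outside \<open>V\<close>: chain infima are then defined
    everywhere, and the pointwise order on total functions only compares values on
    \<open>V\<close>.\<close>
  define A where "A = {m. sublinear_on V m \<and> (\<forall>x\<in>V. m x \<le> q x) \<and> (\<forall>x. x \<notin> V \<longrightarrow> m x = 0)}"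
  have "\<exists>m\<in>A. \<forall>a\<in>A. a \<le> m \<longrightarrow> a = m"
  proof (rule predicate_Zorn)
    show "partial_order_on A (relation_of (\<lambda>x y. y \<le> x) A)"
      by (auto simp: partial_order_on_def preorder_on_def refl_on_def relation_of_def trans_def
          antisym_def)
    fix C assume C: "C \<in> Chains (relation_of (\<lambda>x y. y \<le> x) A)"
    then have CA: "C \<subseteq> A" and ch: "\<And>a b. a \<in> C \<Longrightarrow> b \<in> C \<Longrightarrow> a \<le> b \<or> b \<le> a"
      unfolding Chains_def relation_of_def by auto
    show "\<exists>u\<in>A. \<forall>a\<in>C. u \<le> a"
    proof (cases "C = {}")
      case True
      have "(\<lambda>x. if x \<in> V then q x else 0) \<in> A"
        using q V unfolding A_def sublinear_on_def by (auto simp: subspace_add subspace_scale)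
      then show ?thesis using True by auto
    next
      case False
      define u where "u = (\<lambda>x. INF a\<in>C. a x)"
      have low: "- q (- x) \<le> a x" if "a \<in> C" "x \<in> V" for a x
      proof -
        have a: "sublinear_on V a" "a (- x) \<le> q (- x)"
          using that CA V unfolding A_def by (auto simp: subspace_neg)
        show ?thesis using sublinear_on_neg[OF V a(1) that(2)] a(2) by linarith
      qed
      have bdd: "bdd_below ((\<lambda>a. a x) ` C)" if "x \<in> V" for x
        using low that by (intro bdd_belowI[of _ "- q (- x)"]) auto
      have lower: "u x \<le> a x" if "a \<in> C" "x \<in> V" for a x
        unfolding u_def by (intro cINF_lower bdd that)
      have greatest: "c \<le> u x" if "\<And>a. a \<in> C \<Longrightarrow> c \<le> a x" for c x
        unfolding u_def by (intro cINF_greatest False that)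
      have out: "u x = 0" if "x \<notin> V" for x
      proof -
        have "a x = 0" if "a \<in> C" for a using CA that \<open>x \<notin> V\<close> unfolding A_def by auto
        then have "(\<lambda>a. a x) ` C = (\<lambda>_. 0) ` C" by (intro image_cong) auto
        then show ?thesis unfolding u_def using False by simp
      qed
      have "u \<in> A"
        unfolding A_def sublinear_on_def
      proof (intro CollectI conjI ballI allI impI)
        fix x y assume x: "x \<in> V" and y: "y \<in> V"
        have "u (x + y) - u y \<le> u x"
        proof (rule greatest)
          fix a assume a: "a \<in> C"
          have "u (x + y) - a x \<le> u y"
          proof (rule greatest)
            fix b assume b: "b \<in> C"
            obtain c where c: "c \<in> C" "c \<le> a" "c \<le> b" using ch a b by (metis order_refl)
            have "u (x + y) \<le> c (x + y)" using x y c V by (intro lower) (auto simp: subspace_add)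
            also have "\<dots> \<le> c x + c y" using c CA x y unfolding A_def sublinear_on_def by auto
            also have "\<dots> \<le> a x + b y" using c by (simp add: add_mono le_funD)
            finally show "u (x + y) - a x \<le> b y" by linarith
          qed
          then show "u (x + y) - u y \<le> a x" by linarith
        qed
        then show "u (x + y) \<le> u x + u y" by linarith
      next
        fix x and r :: real assume x: "x \<in> V" and r: "r > 0"
        have hom: "a (r *\<^sub>R x) = r * a x" if "a \<in> C" for a
          using that CA x r unfolding A_def sublinear_on_def by auto
        have "u (r *\<^sub>R x) / r \<le> u x"
        proof (rule greatest)
          fix a assume a: "a \<in> C"
          have "u (r *\<^sub>R x) \<le> a (r *\<^sub>R x)" using a x V by (intro lower) (auto simp: subspace_scale)
          then show "u (r *\<^sub>R x) / r \<le> a x" using hom[OF a] r by (simp add: field_simps)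
        qed
        moreover have "r * u x \<le> u (r *\<^sub>R x)"
        proof (rule greatest)
          fix a assume a: "a \<in> C"
          show "r * u x \<le> a (r *\<^sub>R x)" using hom[OF a] lower[OF a x] r by simp
        qed
        ultimately show "u (r *\<^sub>R x) = r * u x" using r by (simp add: field_simps)
      next
        fix x assume x: "x \<in> V"
        obtain a where "a \<in> C" using False by auto
        then have "u x \<le> a x" "a x \<le> q x" using lower x CA unfolding A_def by auto
        then show "u x \<le> q x" by linarith
      qed (use out in auto)
      moreover have "u \<le> a" if a: "a \<in> C" for a
      proof (rule le_funI)
        fix x
        have "a x = 0" if "x \<notin> V" using a CA that unfolding A_def by auto
        then show "u x \<le> a x" using lower[OF a] out by (cases "x \<in> V") auto
      qed
      ultimately show ?thesis by auto
    qed
  qed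
  then obtain m where m: "m \<in> A" "\<And>a. a \<in> A \<Longrightarrow> a \<le> m \<Longrightarrow> a = m" by auto
  show ?thesis
  proof
    show "sublinear_on V m" "\<And>x. x \<in> V \<Longrightarrow> m x \<le> q x" using m(1) unfolding A_def by auto
    show "\<forall>m'. sublinear_on V m' \<longrightarrow> (\<forall>x\<in>V. m' x \<le> m x) \<longrightarrow> (\<forall>x\<in>V. m' x = m x)"
    proof (intro allI impI ballI)
      fix m' x assume m': "sublinear_on V m'" "\<forall>x\<in>V. m' x \<le> m x" and x: "x \<in> V"
      define m'' where "m'' = (\<lambda>x. if x \<in> V then m' x else 0)"
      have in_V: "m'' x = m' x" if "x \<in> V" for x using that by (simp add: m''_def)
      have le: "m'' \<le> m"
      proof (rule le_funI)
        fix x show "m'' x \<le> m x" using m'(2) m(1) by (cases "x \<in> V") (simp_all add: m''_def A_def)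
      qed
      have "sublinear_on V m''"
        using m'(1) V unfolding sublinear_on_def by (simp add: in_V subspace_add subspace_scale)
      moreover have "m'' x \<le> q x" if "x \<in> V" for x
        using m(1) le_funD[OF le, of x] that unfolding A_def by force
      ultimately have "m'' \<in> A" unfolding A_def m''_def by simp
      then have "m'' = m" using m(2) le by blast
      then show "m' x = m x" using in_V[OF x] by simp
    qed
  qed
qed

text \<open>A minimal sublinear functional is linear: minimality forces
  \<open>ray_inf L y = L\<close> on \<open>V\<close> for every \<open>y\<close>, and the choice
  \<open>t = 1\<close> reads \<open>L x \<le> L (x + y) - L y\<close>, the missing superadditivity.
  Starting from a minimal element below \<open>ray_inf q h\<close> instead of \<open>q\<close> gives
  the value \<open>q h\<close> at \<open>h\<close>.\<close>

theorem Hahn_Banach_sublinear: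
  assumes V: "subspace V" and q: "sublinear_on V q" and h: "h \<in> V"
  obtains L where "linear_functional_on V L" "\<And>x. x \<in> V \<Longrightarrow> L x \<le> q x" "L h = q h"
proof -
  obtain L where L: "sublinear_on V L" "\<And>x. x \<in> V \<Longrightarrow> L x \<le> ray_inf q h x"
    and min: "\<forall>m'. sublinear_on V m' \<longrightarrow> (\<forall>x\<in>V. m' x \<le> L x) \<longrightarrow> (\<forall>x\<in>V. m' x = L x)"
    using minimal_sublinear_exists[OF V ray_inf_sublinear[OF V q h]] by blast
  have eq: "ray_inf L y x = L x" if "x \<in> V" "y \<in> V" for x y
    using min ray_inf_sublinear[OF V L(1) \<open>y \<in> V\<close>] ray_inf_le[OF V L(1) \<open>y \<in> V\<close>] \<open>x \<in> V\<close> by blast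
  have add: "L (x + y) = L x + L y" if "x \<in> V" "y \<in> V" for x y
  proof (rule antisym)
    show "L (x + y) \<le> L x + L y" using L(1) that unfolding sublinear_on_def by auto
    have "L x \<le> L (x + 1 *\<^sub>R y) - 1 * L y"
      using ray_inf_lower[OF V L(1) \<open>y \<in> V\<close> \<open>x \<in> V\<close>, of 1] eq[OF that] by simp
    then show "L x + L y \<le> L (x + y)" by simp
  qed
  have L0: "L 0 = 0" by (rule sublinear_on_zero[OF V L(1)])
  have neg: "L (- x) = - L x" if "x \<in> V" for x
    using add[of x "- x"] that V L0 by (simp add: subspace_neg)
  have hom: "L (r *\<^sub>R x) = r * L x" if x: "x \<in> V" for x r
  proof -
    consider "r > 0" | "r = 0" | "r < 0" by linarith
    then show ?thesis
    proof cases
      case 1 then show ?thesis using L(1) x unfolding sublinear_on_def by auto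
    next
      case 2 then show ?thesis using L0 by simp
    next
      case 3
      then have "L ((- r) *\<^sub>R x) = (- r) * L x"
        using L(1) x unfolding sublinear_on_def by (simp del: scaleR_minus_left)
      then show ?thesis using neg[of "r *\<^sub>R x"] x V by (simp add: subspace_scale)
    qed
  qed
  have "L (- h) \<le> ray_inf q h (- h)" using L(2) h V by (simp add: subspace_neg)
  also have "\<dots> \<le> q (- h + 1 *\<^sub>R h) - 1 * q h"
    using h V by (intro ray_inf_lower[OF V q h]) (auto simp: subspace_neg)
  finally have "q h \<le> L h" using neg[OF h] sublinear_on_zero[OF V q] by simp
  moreover have le: "L x \<le> q x" if "x \<in> V" for x
    using L(2)[OF that] ray_inf_le[OF V q h that] by linarith
  ultimately have "L h = q h" using h by (simp add: antisym)
  then show ?thesis using that[of L] add hom le unfolding linear_functional_on_def by blast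
qed

text \<open>A weak-star neighbourhood only sees finitely many points, so the separation is
  finite-dimensional. The l^1 distance \<open>\<psi>\<close> to the convex cone \<open>S\<close>,
  measured on the coordinates in \<open>F\<close>, is sublinear; Hahn-Banach at \<open>y\<close>
  gives \<open>L \<le> \<psi>\<close> with \<open>L y = \<psi> y \<ge> e\<close>. As
  \<open>\<psi>\<close> vanishes on \<open>S\<close>, \<open>L\<close> is nonpositive there.\<close>

lemma separation_on_finite:
  fixes S :: "('v \<Rightarrow> real) set"
  assumes add: "\<And>s t. s \<in> S \<Longrightarrow> t \<in> S \<Longrightarrow> s + t \<in> S"
    and scale: "\<And>r s. r > 0 \<Longrightarrow> s \<in> S \<Longrightarrow> r *\<^sub>R s \<in> S"
    and zero: "0 \<in> S" and F: "finite F" and e: "e > 0"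
    and far: "\<And>s. s \<in> S \<Longrightarrow> \<exists>f\<in>F. e \<le> \<bar>s f - y f\<bar>"
  obtains c where "\<And>s. s \<in> S \<Longrightarrow> (\<Sum>f\<in>F. c f * s f) \<le> 0" "(\<Sum>f\<in>F. c f * y f) > 0"
proof -
  define \<psi> where "\<psi> z = (INF s\<in>S. \<Sum>f\<in>F. \<bar>z f - s f\<bar>)" for z :: "'v \<Rightarrow> real"
  have ne: "S \<noteq> {}" using zero by auto
  have bdd: "bdd_below ((\<lambda>s. \<Sum>f\<in>F. \<bar>z f - s f\<bar>) ` S)" for z
    by (intro bdd_belowI[of _ 0]) (auto intro: sum_nonneg)
  have lower: "\<psi> z \<le> (\<Sum>f\<in>F. \<bar>z f - s f\<bar>)" if "s \<in> S" for z s
    unfolding \<psi>_def by (intro cINF_lower bdd that)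
  have greatest: "c \<le> \<psi> z" if "\<And>s. s \<in> S \<Longrightarrow> c \<le> (\<Sum>f\<in>F. \<bar>z f - s f\<bar>)" for c z
    unfolding \<psi>_def by (intro cINF_greatest ne that)
  have le_hom: "\<psi> (r *\<^sub>R z) \<le> r * \<psi> z" if r: "r > 0" for r z
  proof -
    have "\<psi> (r *\<^sub>R z) / r \<le> \<psi> z"
    proof (rule greatest)
      fix s assume s: "s \<in> S"
      have "\<psi> (r *\<^sub>R z) \<le> (\<Sum>f\<in>F. \<bar>(r *\<^sub>R z) f - (r *\<^sub>R s) f\<bar>)"
        by (intro lower scale r s)
      also have "\<dots> = r * (\<Sum>f\<in>F. \<bar>z f - s f\<bar>)"
        using r by (simp add: sum_distrib_left right_diff_distrib[symmetric] abs_mult)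
      finally show "\<psi> (r *\<^sub>R z) / r \<le> (\<Sum>f\<in>F. \<bar>z f - s f\<bar>)" using r by (simp add: field_simps)
    qed
    then show ?thesis using r by (simp add: field_simps)
  qed
  have sub: "sublinear_on UNIV \<psi>"
    unfolding sublinear_on_def
  proof (intro conjI ballI allI impI)
    fix z z' :: "'v \<Rightarrow> real"
    have *: "\<psi> (z + z') \<le> (\<Sum>f\<in>F. \<bar>z f - s f\<bar>) + (\<Sum>f\<in>F. \<bar>z' f - t f\<bar>)" if "s \<in> S" "t \<in> S" for s t
    proof -
      have "\<psi> (z + z') \<le> (\<Sum>f\<in>F. \<bar>(z + z') f - (s + t) f\<bar>)" by (intro lower add that)
      also have "\<dots> \<le> (\<Sum>f\<in>F. \<bar>z f - s f\<bar> + \<bar>z' f - t f\<bar>)" by (intro sum_mono) simp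
      finally show ?thesis by (simp add: sum.distrib)
    qed
    have "\<psi> (z + z') - \<psi> z' \<le> \<psi> z"
    proof (rule greatest)
      fix s assume s: "s \<in> S"
      have "\<psi> (z + z') - (\<Sum>f\<in>F. \<bar>z f - s f\<bar>) \<le> \<psi> z'"
        using *[OF s] by (intro greatest) (simp add: algebra_simps)
      then show "\<psi> (z + z') - \<psi> z' \<le> (\<Sum>f\<in>F. \<bar>z f - s f\<bar>)" by linarith
    qed
    then show "\<psi> (z + z') \<le> \<psi> z + \<psi> z'" by linarith
  next
    fix z :: "'v \<Rightarrow> real" and r :: real assume r: "r > 0"
    have "\<psi> ((1/r) *\<^sub>R (r *\<^sub>R z)) \<le> (1/r) * \<psi> (r *\<^sub>R z)" using r by (intro le_hom) auto
    then have "r * \<psi> z \<le> \<psi> (r *\<^sub>R z)" using r by (simp add: field_simps)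
    with le_hom[OF r] show "\<psi> (r *\<^sub>R z) = r * \<psi> z" by (simp add: antisym)
  qed
  obtain L where L: "linear_functional_on UNIV L" "\<And>z. L z \<le> \<psi> z" "L y = \<psi> y"
    using Hahn_Banach_sublinear[OF subspace_UNIV sub UNIV_I[of y]] by auto
  have Ladd: "L (u + v) = L u + L v" and Lsc: "L (r *\<^sub>R u) = r * L u" for u v r
    using L(1) unfolding linear_functional_on_def by auto
  have lin: "linear L" by (rule linearI) (simp_all add: Ladd Lsc)
  define c where "c f = L (\<lambda>x. if x = f then 1 else 0)" for f
  have rep: "L z = (\<Sum>f\<in>F. c f * z f)" for z
  proof -
    define z' where "z' = (\<Sum>f\<in>F. z f *\<^sub>R (\<lambda>x. if x = f then (1::real) else 0))"
    have app: "(\<Sum>f\<in>A. g f) x = (\<Sum>f\<in>A. g f x)" for A and g :: "'v \<Rightarrow> 'v \<Rightarrow> real" and x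
      by (induction A rule: infinite_finite_induct) auto
    have z'F: "z' x = z x" if "x \<in> F" for x
      unfolding z'_def app using that F by (simp add: if_distrib[of "(*) _"] cong: if_cong)
    \<comment> \<open>Since \<open>0 \<in> S\<close>, \<open>\<psi>\<close> and with it
      \<open>L\<close> is nonpositive on whatever vanishes on \<open>F\<close>. Applied to
      \<open>z - z'\<close> and its negative, this shows that \<open>L\<close> depends only on the
      coordinates in \<open>F\<close>, so it is a combination of evaluations.\<close>
    have small: "L w \<le> 0" if "\<And>x. x \<in> F \<Longrightarrow> w x = 0" for w
    proof -
      have "\<psi> w \<le> (\<Sum>f\<in>F. \<bar>w f - 0 f\<bar>)" by (rule lower[OF zero])
      also have "\<dots> = 0" using that by simp
      finally show ?thesis using L(2)[of w] by linarith
    qed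
    have "L (z - z') \<le> 0" "L (z' - z) \<le> 0" using z'F by (auto intro: small)
    then have "L z = L z'" by (simp add: linear_diff[OF lin])
    also have "\<dots> = (\<Sum>f\<in>F. c f * z f)"
      unfolding z'_def c_def by (simp add: linear_sum[OF lin] Lsc mult.commute)
    finally show ?thesis .
  qed
  show ?thesis
  proof
    fix s assume "s \<in> S"
    have "\<psi> s \<le> (\<Sum>f\<in>F. \<bar>s f - s f\<bar>)" by (rule lower) fact
    then show "(\<Sum>f\<in>F. c f * s f) \<le> 0" using L(2)[of s] rep[of s] by simp
  next
    have "e \<le> \<psi> y"
    proof (rule greatest)
      fix s assume "s \<in> S"
      then obtain f where f: "f \<in> F" "e \<le> \<bar>s f - y f\<bar>" using far by auto
      have "\<bar>y f - s f\<bar> \<le> (\<Sum>f\<in>F. \<bar>y f - s f\<bar>)"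
        using F f by (intro member_le_sum) auto
      then show "e \<le> (\<Sum>f\<in>F. \<bar>y f - s f\<bar>)" using f(2) by linarith
    qed
    then show "(\<Sum>f\<in>F. c f * y f) > 0" using e L(3) rep[of y] by simp
  qed
qed

section \<open>Clarke derivatives of distance functions for a seminorm\<close>

text \<open>Only a seminorm on a subspace is required: \<open>Lp_norm\<close> vanishes on functions
  that are zero a.e. and is controlled only on \<open>Lp\<close>. The instance with
  \<open>UNIV\<close> and \<open>norm\<close> is the pointwise theory in E.\<close>

locale clarke_distance =
  fixes V :: "'v::real_vector set" and N :: "'v \<Rightarrow> real" and C :: "'v set" and xb :: 'v
  assumes V: "subspace V"
    and N_add: "\<And>x y. x \<in> V \<Longrightarrow> y \<in> V \<Longrightarrow> N (x + y) \<le> N x + N y"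
    and N_scale: "\<And>r x. x \<in> V \<Longrightarrow> N (r *\<^sub>R x) = \<bar>r\<bar> * N x"
    and CV: "C \<subseteq> V" and xb: "xb \<in> C"
begin

definition dC :: "'v \<Rightarrow> real" where
  "dC x = Inf {N (c - x) | c. c \<in> C}"

definition dd :: "'v \<Rightarrow> ereal" where
  "dd h = (INF d\<in>{d::real. d > 0}.
      SUP z\<in>{(x, t). x \<in> V \<and> N (x - xb) < d \<and> 0 < t \<and> t < d}.
        ereal ((dC (fst z + snd z *\<^sub>R h) - dC (fst z)) / snd z))"

lemmas V_simps = subspace_add[OF V] subspace_scale[OF V] subspace_diff[OF V] subspace_neg[OF V]
  subspace_0[OF V]

lemma xbV: "xb \<in> V" using xb CV by auto

lemma N_0: "N 0 = 0"
  using N_scale[OF V_simps(5), of 0] by simp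

lemma N_minus: "x \<in> V \<Longrightarrow> N (- x) = N x"
  using N_scale[of x "-1"] by simp

lemma N_nonneg: "x \<in> V \<Longrightarrow> 0 \<le> N x"
  using N_add[of x "- x"] N_minus[of x] V_simps N_0 by simp

lemma N_commute: "x \<in> V \<Longrightarrow> y \<in> V \<Longrightarrow> N (x - y) = N (y - x)"
  using N_minus[of "x - y"] V_simps by simp

lemma N_triangle: "x \<in> V \<Longrightarrow> y \<in> V \<Longrightarrow> z \<in> V \<Longrightarrow> N (x - z) \<le> N (x - y) + N (y - z)"
  using N_add[of "x - y" "y - z"] V_simps by simp

lemma dC_bdd: "x \<in> V \<Longrightarrow> bdd_below {N (c - x) | c. c \<in> C}"
  using N_nonneg CV V_simps by (intro bdd_belowI[of _ 0]) auto

lemma dC_le: "x \<in> V \<Longrightarrow> c \<in> C \<Longrightarrow> dC x \<le> N (c - x)"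
  unfolding dC_def by (intro cInf_lower dC_bdd) auto

lemma dC_greatest: "(\<And>c. c \<in> C \<Longrightarrow> r \<le> N (c - x)) \<Longrightarrow> r \<le> dC x"
  unfolding dC_def using xb by (intro cInf_greatest) auto

lemma dC_less: "dC x < r \<Longrightarrow> \<exists>c\<in>C. N (c - x) < r"
  using dC_greatest[of r x] by (meson not_less)

lemma dC_nonneg: "x \<in> V \<Longrightarrow> 0 \<le> dC x"
  using N_nonneg CV V_simps by (intro dC_greatest) auto

lemma dC_lipschitz:
  assumes "x \<in> V" "y \<in> V"
  shows "dC x \<le> dC y + N (x - y)"
proof -
  have "dC x - N (x - y) \<le> dC y"
  proof (rule dC_greatest)
    fix c assume c: "c \<in> C"
    have "dC x \<le> N (c - x)" by (rule dC_le) fact+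
    also have "\<dots> \<le> N (c - y) + N (y - x)" using c CV assms by (intro N_triangle) auto
    finally show "dC x - N (x - y) \<le> N (c - y)" using N_commute assms by simp
  qed
  then show ?thesis by simp
qed

lemma dC_xb: "dC xb = 0"
  using dC_le[OF xbV xb] dC_nonneg[OF xbV] N_0 by simp

definition step_le :: "'v \<Rightarrow> real \<Rightarrow> real \<Rightarrow> bool" where
  "step_le h r d \<longleftrightarrow> (\<forall>x\<in>V. \<forall>t. N (x - xb) < d \<longrightarrow> 0 < t \<longrightarrow> t < d \<longrightarrow>
     dC (x + t *\<^sub>R h) - dC x \<le> r * t)"

lemma step_leD: "step_le h r d \<Longrightarrow> x \<in> V \<Longrightarrow> N (x - xb) < d \<Longrightarrow> 0 < t \<Longrightarrow> t < d \<Longrightarrow>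
    dC (x + t *\<^sub>R h) - dC x \<le> r * t"
  unfolding step_le_def by blast

lemma step_leI: "(\<And>x t. x \<in> V \<Longrightarrow> N (x - xb) < d \<Longrightarrow> 0 < t \<Longrightarrow> t < d \<Longrightarrow>
    dC (x + t *\<^sub>R h) - dC x \<le> r * t) \<Longrightarrow> step_le h r d"
  unfolding step_le_def by blast

lemma dd_le_iff:
  assumes h: "h \<in> V"
  shows "dd h \<le> ereal r \<longleftrightarrow> (\<forall>e>0. \<exists>d>0. step_le h (r + e) d)" (is "?L \<longleftrightarrow> ?R")
proof
  assume L: ?L
  show ?R
  proof (intro allI impI)
    fix e :: real assume e: "e > 0"
    have "dd h < ereal (r + e)" using L e by (metis ereal_less(2) ereal_less_eq(3) less_add_same_cancel1 linorder_not_less order_trans)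
    then obtain d where d: "d > 0"
      "(SUP z\<in>{(x, t). x \<in> V \<and> N (x - xb) < d \<and> 0 < t \<and> t < d}.
        ereal ((dC (fst z + snd z *\<^sub>R h) - dC (fst z)) / snd z)) < ereal (r + e)"
      unfolding dd_def INF_less_iff by auto
    have "dC (x + t *\<^sub>R h) - dC x \<le> (r + e) * t"
      if "x \<in> V" "N (x - xb) < d" "0 < t" "t < d" for x t
    proof -
      have "ereal ((dC (x + t *\<^sub>R h) - dC x) / t) \<le> (SUP z\<in>{(x, t). x \<in> V \<and> N (x - xb) < d \<and> 0 < t \<and> t < d}.
        ereal ((dC (fst z + snd z *\<^sub>R h) - dC (fst z)) / snd z))"
        using that by (intro SUP_upper2[of "(x, t)"]) auto
      from order.strict_trans1[OF this d(2)] have "(dC (x + t *\<^sub>R h) - dC x) / t \<le> r + e"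
        by simp
      then show ?thesis using \<open>0 < t\<close> by (simp add: field_simps)
    qed
    then show "\<exists>d>0. step_le h (r + e) d" using d(1) step_leI by blast
  qed
next
  assume R: ?R
  show ?L
  proof (rule ereal_le_epsilon2)
    fix e :: real assume "0 < e"
    then obtain d where d: "d > 0" "step_le h (r + e) d" using R by blast
    have "dd h \<le> (SUP z\<in>{(x, t). x \<in> V \<and> N (x - xb) < d \<and> 0 < t \<and> t < d}.
        ereal ((dC (fst z + snd z *\<^sub>R h) - dC (fst z)) / snd z))"
      unfolding dd_def using d(1) by (intro INF_lower) auto
    also have "\<dots> \<le> ereal (r + e)"
      using step_leD[OF d(2)] by (intro SUP_least) (auto simp: divide_le_eq)
    finally show "dd h \<le> ereal r + ereal e" by simp
  qed
qed

lemma dd_leD: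
  assumes "h \<in> V" "dd h \<le> ereal r" "e > 0"
  obtains d where "d > 0" "step_le h (r + e) d"
  using assms dd_le_iff[of h r] by meson

lemma dd_le_N:
  assumes h: "h \<in> V"
  shows "dd h \<le> ereal (N h)"
  unfolding dd_le_iff[OF h]
proof (intro allI impI exI[of _ 1] conjI step_leI)
  fix e :: real and x and t :: real assume e: "e > 0" and x: "x \<in> V" and t: "0 < t"
  have "dC (x + t *\<^sub>R h) \<le> dC x + N (x + t *\<^sub>R h - x)"
    using x h by (intro dC_lipschitz) (auto simp: V_simps)
  also have "N (x + t *\<^sub>R h - x) = N h * t" using N_scale[OF h] t by simp
  also have "\<dots> \<le> (N h + e) * t" using e t by (simp add: algebra_simps)
  finally show "dC (x + t *\<^sub>R h) - dC x \<le> (N h + e) * t" by simp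
qed simp

text \<open>At the base point \<open>xb\<close> the distance is 0 and cannot decrease, so the
  difference quotients there are nonnegative for every small step.\<close>

lemma dd_nonneg:
  assumes h: "h \<in> V"
  shows "0 \<le> dd h"
proof (rule ccontr)
  assume "\<not> 0 \<le> dd h"
  then obtain r where r: "dd h < ereal r" "r < 0"
    using ereal_dense2[of "dd h" 0] by (auto simp: not_le)
  obtain d where d: "d > 0" "step_le h (r + (- r / 2)) d"
    using dd_leD[OF h less_imp_le[OF r(1)], of "- r / 2"] r(2) by (metis divide_pos_pos neg_0_less_iff_less zero_less_numeral)
  have "dC (xb + (d/2) *\<^sub>R h) - dC xb \<le> (r + (- r / 2)) * (d / 2)"
    using d(1) N_0 xbV by (intro step_leD[OF d(2)]) auto
  moreover have "0 \<le> dC (xb + (d/2) *\<^sub>R h)" using xbV h by (intro dC_nonneg) (auto simp: V_simps)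
  moreover have "(r + (- r / 2)) * (d / 2) < 0" using d(1) r(2) by (simp add: mult_neg_pos)
  ultimately show False using dC_xb by linarith
qed

text \<open>On \<open>V\<close>, \<open>dd\<close> takes values between 0 and \<open>N h\<close>, so
  passing to reals loses nothing and Hahn-Banach becomes applicable.\<close>

definition qd :: "'v \<Rightarrow> real" where "qd h = real_of_ereal (dd h)"

lemma dd_eq: "h \<in> V \<Longrightarrow> dd h = ereal (qd h)"
  using dd_le_N[of h] dd_nonneg[of h] unfolding qd_def by (cases "dd h") auto

lemma qd_nonneg: "h \<in> V \<Longrightarrow> 0 \<le> qd h" and qd_le_N: "h \<in> V \<Longrightarrow> qd h \<le> N h"
  using dd_le_N[of h] dd_nonneg[of h] by (auto simp: dd_eq)

lemma qdD:
  assumes "h \<in> V" "qd h \<le> r" "e > 0"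
  obtains d where "d > 0" "step_le h (r + e) d"
  using dd_leD[of h r e] dd_eq assms by auto

lemma qdI:
  assumes h: "h \<in> V" and *: "\<And>e. e > 0 \<Longrightarrow> \<exists>d>0. step_le h (r + e) d"
  shows "qd h \<le> r"
  using dd_le_iff[OF h, of r] * dd_eq[OF h] by auto

lemma qd_sublinear: "sublinear_on V qd"
  unfolding sublinear_on_def
proof (intro conjI ballI allI impI)
  fix h k assume h: "h \<in> V" and k: "k \<in> V"
  show "qd (h + k) \<le> qd h + qd k"
  proof (rule qdI)
    fix e :: real assume e: "e > 0"
    obtain d1 where d1: "d1 > 0" "step_le h (qd h + e/2) d1"
      using qdD[OF h order_refl, of "e/2"] e by auto
    obtain d2 where d2: "d2 > 0" "step_le k (qd k + e/2) d2"
      using qdD[OF k order_refl, of "e/2"] e by auto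
    \<comment> \<open>The step along \<open>h + k\<close> is taken first along \<open>k\<close>,
      then along \<open>h\<close>. The intermediate base point has moved by at most
      \<open>t * N k\<close>, and \<open>d * (1 + N k) \<le> d1\<close> keeps it in the ball where
      the estimate for \<open>h\<close> is valid.\<close>
    define d where "d = min (d1 / (1 + N k)) d2"
    have Nk: "N k \<ge> 0" using N_nonneg k by auto
    have d0: "d > 0" using d1(1) d2(1) Nk by (simp add: d_def)
    have "d \<le> d1 / (1 + N k)" by (simp add: d_def)
    then have dd1: "d + d * N k \<le> d1" using Nk by (simp add: field_simps)
    have "dC (x + t *\<^sub>R (h + k)) - dC x \<le> (qd h + qd k + e) * t"
      if x: "x \<in> V" and xd: "N (x - xb) < d" and t: "0 < t" "t < d" for x t
    proof -
      have "N ((x - xb) + t *\<^sub>R k) \<le> N (x - xb) + N (t *\<^sub>R k)"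
        using x k xbV by (intro N_add) (auto simp: V_simps)
      also have "N (t *\<^sub>R k) = t * N k" using N_scale[OF k] t by simp
      also have "t * N k \<le> d * N k" using t Nk by (simp add: mult_right_mono)
      finally have "N (x + t *\<^sub>R k - xb) < d1" using dd1 xd by (simp add: algebra_simps)
      moreover have "t < d1" using t dd1 Nk d0 by (smt (verit) mult_nonneg_nonneg)
      ultimately have "dC ((x + t *\<^sub>R k) + t *\<^sub>R h) - dC (x + t *\<^sub>R k) \<le> (qd h + e/2) * t"
        using x k t by (intro step_leD[OF d1(2)]) (auto simp: V_simps)
      moreover have "dC (x + t *\<^sub>R k) - dC x \<le> (qd k + e/2) * t"
        using x xd t by (intro step_leD[OF d2(2)]) (auto simp: d_def)
      moreover have "x + t *\<^sub>R (h + k) = (x + t *\<^sub>R k) + t *\<^sub>R h" by (simp add: algebra_simps)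
      ultimately show ?thesis by (simp add: algebra_simps)
    qed
    then show "\<exists>d>0. step_le (h + k) (qd h + qd k + e) d" using d0 step_leI by blast
  qed (use h k in \<open>simp add: V_simps\<close>)
next
  fix h and r :: real assume h: "h \<in> V" and r: "r > 0"
  have le: "qd (r *\<^sub>R h) \<le> r * qd h" if h: "h \<in> V" and r: "r > 0" for h r
  proof (rule qdI)
    fix e :: real assume e: "e > 0"
    obtain d1 where d1: "d1 > 0" "step_le h (qd h + e/r) d1"
      using qdD[OF h order_refl, of "e/r"] e r by auto
    have "dC (x + t *\<^sub>R r *\<^sub>R h) - dC x \<le> (r * qd h + e) * t"
      if "x \<in> V" "N (x - xb) < min d1 (d1 / r)" "0 < t" "t < min d1 (d1 / r)" for x t
    proof -
      have "t * r < d1" using that r by (simp add: field_simps)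
      then have "dC (x + (t * r) *\<^sub>R h) - dC x \<le> (qd h + e/r) * (t * r)"
        using that r by (intro step_leD[OF d1(2)]) auto
      also have "(qd h + e/r) * (t * r) = (r * qd h + e) * t" using r by (simp add: field_simps)
      finally show ?thesis by (simp add: mult.commute)
    qed
    moreover have "min d1 (d1 / r) > 0" using d1 r by simp
    ultimately show "\<exists>d>0. step_le (r *\<^sub>R h) (r * qd h + e) d" using step_leI by blast
  qed (use h in \<open>simp add: V_simps\<close>)
  have "qd ((1/r) *\<^sub>R (r *\<^sub>R h)) \<le> (1/r) * qd (r *\<^sub>R h)" using h r by (intro le) (auto simp: V_simps)
  then have "r * qd h \<le> qd (r *\<^sub>R h)" using r by (simp add: field_simps)
  with le[OF h r] show "qd (r *\<^sub>R h) = r * qd h" by simp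
qed

end

section \<open>Measurable selection\<close>

text \<open>A Suslin scheme is a family of sets indexed by finite sequences. It is encoded by whole
  sequences of which stage \<open>n\<close> reads only the first \<open>n\<close> entries; stage 0
  is therefore constant.\<close>

definition finitary :: "(nat \<Rightarrow> (nat \<Rightarrow> 'i) \<Rightarrow> 'b) \<Rightarrow> bool" where
  "finitary S \<longleftrightarrow> (\<forall>n \<rho> \<sigma>. (\<forall>i<n. \<rho> i = \<sigma> i) \<longrightarrow> S n \<rho> = S n \<sigma>)"

lemma finitaryD: "finitary S \<Longrightarrow> (\<And>i. i < n \<Longrightarrow> \<rho> i = \<sigma> i) \<Longrightarrow> S n \<rho> = S n \<sigma>"
  unfolding finitary_def by blast

text \<open>Bounding the coordinates of the branches one after the other loses arbitrarily little outer
  measure. The branches below a fixed bound are finitely branching, so by Koenig's lemma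
  the existence of an infinite one is a countable, hence measurable, condition, and the
  lexicographically least one depends measurably on the point.\<close>

definition box_branches :: "'a measure \<Rightarrow> (nat \<Rightarrow> (nat \<Rightarrow> nat) \<Rightarrow> 'a set) \<Rightarrow> (nat \<Rightarrow> nat) \<Rightarrow> nat list \<Rightarrow> 'a set" where
  "box_branches M S \<tau> l = {w\<in>space M. \<forall>m. \<exists>\<rho>. (\<forall>i. \<rho> i \<le> \<tau> i) \<and>
     (\<forall>i<length l. \<rho> i = l ! i) \<and> (\<forall>j\<le>m. w \<in> S j \<rho>)}"

text \<open>The stages up to \<open>m\<close> and the prefix \<open>l\<close> read finitely many
  entries, so a sequence may be replaced by a finite list padded with 0, which respects every bound
  \<open>\<tau> i\<close>. The existential then ranges over a countable set.\<close>

lemma finite_box_branches_sets: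
  fixes S :: "nat \<Rightarrow> (nat \<Rightarrow> nat) \<Rightarrow> 'a set"
  assumes S: "finitary S" "\<And>n \<rho>. S n \<rho> \<in> sets M"
  shows "{w\<in>space M. \<exists>\<rho>. (\<forall>i. \<rho> i \<le> \<tau> i) \<and>
     (\<forall>i<length l. \<rho> i = l ! i) \<and> (\<forall>j\<le>m. w \<in> S j \<rho>)} \<in> sets M" (is "{w\<in>space M. \<exists>\<rho>. ?Q w \<rho>} \<in> _")
proof -
  define sq where "sq l' = (\<lambda>i. if i < length l' then l' ! i else 0)" for l' :: "nat list"
  have "(\<exists>\<rho>. ?Q w \<rho>) \<longleftrightarrow> (\<exists>l'. ?Q w (sq l'))" for w
  proof
    assume "\<exists>\<rho>. ?Q w \<rho>"
    then obtain \<rho> where \<rho>: "?Q w \<rho>" by blast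
    define k where "k = max m (length l)"
    have k: "m \<le> k" "length l \<le> k" by (simp_all add: k_def)
    have sq: "sq (map \<rho> [0..<k]) i = (if i < k then \<rho> i else 0)" for i by (simp add: sq_def)
    have "S j (sq (map \<rho> [0..<k])) = S j \<rho>" if "j \<le> m" for j
      using that by (intro finitaryD[OF S(1)]) (use k in \<open>simp add: sq\<close>)
    then have "?Q w (sq (map \<rho> [0..<k]))" using \<rho> k by (simp add: sq)
    then show "\<exists>l'. ?Q w (sq l')" by blast
  qed blast
  then have "{w\<in>space M. \<exists>\<rho>. ?Q w \<rho>} = {w\<in>space M. \<exists>l'. ?Q w (sq l')}" by simp
  also have "\<dots> \<in> sets M" using S(2) by measurable
  finally show ?thesis .
qed

lemma box_branches_sets:
  assumes S: "finitary S" "\<And>n \<rho>. S n \<rho> \<in> sets M"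
  shows "box_branches M S \<tau> l \<in> sets M"
proof -
  have "box_branches M S \<tau> l = (\<Inter>m. {w\<in>space M. \<exists>\<rho>. (\<forall>i. \<rho> i \<le> \<tau> i) \<and>
     (\<forall>i<length l. \<rho> i = l ! i) \<and> (\<forall>j\<le>m. w \<in> S j \<rho>)})"
    unfolding box_branches_def by auto
  then show ?thesis using finite_box_branches_sets[OF S] by auto
qed

text \<open>Koenig's argument: if each extension \<open>k\<close> failed at some stage
  \<open>m k\<close>, then the maximum of these stages over the finitely many
  \<open>k \<le> \<tau> (length l)\<close> would admit no sequence below the bounds that extends
  \<open>l\<close>.\<close>

lemma box_branches_extend:
  assumes w: "w \<in> box_branches M S \<tau> l"
  shows "\<exists>k. w \<in> box_branches M S \<tau> (l @ [k])"
proof (rule ccontr)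
  let ?Q = "\<lambda>l m \<rho>. (\<forall>i. \<rho> i \<le> \<tau> i) \<and> (\<forall>i<length l. \<rho> i = l ! i) \<and> (\<forall>j\<le>m. w \<in> S j \<rho>)"
  assume "\<not> ?thesis"
  have "\<exists>m. \<forall>\<rho>. \<not> ?Q (l @ [k]) m \<rho>" for k
  proof (rule ccontr)
    assume "\<not> ?thesis"
    then have "\<forall>m. \<exists>\<rho>. ?Q (l @ [k]) m \<rho>" by simp
    then have "w \<in> box_branches M S \<tau> (l @ [k])"
      using w unfolding box_branches_def by simp
    with \<open>\<nexists>k. w \<in> box_branches M S \<tau> (l @ [k])\<close> show False by simp
  qed
  then obtain m where m: "\<And>k \<rho>. \<not> ?Q (l @ [k]) (m k) \<rho>" by metis
  define m' where "m' = Max (m ` {..\<tau> (length l)})"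
  obtain \<rho> where \<rho>: "?Q l m' \<rho>" using w unfolding box_branches_def by blast
  have "m (\<rho> (length l)) \<le> m'" unfolding m'_def using \<rho> by (intro Max_ge) auto
  then have "?Q (l @ [\<rho> (length l)]) (m (\<rho> (length l))) \<rho>"
    using \<rho> by (auto simp: nth_append less_Suc_eq)
  then show False using m by blast
qed

fun least_branch :: "'a measure \<Rightarrow> (nat \<Rightarrow> (nat \<Rightarrow> nat) \<Rightarrow> 'a set) \<Rightarrow> (nat \<Rightarrow> nat) \<Rightarrow> nat \<Rightarrow> 'a \<Rightarrow> nat list" where
  "least_branch M S \<tau> 0 w = []"
| "least_branch M S \<tau> (Suc n) w =
    (let l = least_branch M S \<tau> n w in l @ [LEAST k. w \<in> box_branches M S \<tau> (l @ [k])])"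

lemma box_selection:
  assumes S: "finitary S" "\<And>n \<rho>. S n \<rho> \<in> sets M"
  obtains r where "\<And>i. (\<lambda>w. r w i) \<in> measurable M (count_space UNIV)"
    "\<And>w n. w \<in> box_branches M S \<tau> [] \<Longrightarrow> w \<in> S n (r w)"
proof
  let ?f = "least_branch M S \<tau>" and ?W = "box_branches M S \<tau>"
  \<comment> \<open>Entry \<open>i\<close> is fixed at stage \<open>Suc i\<close> and never changed
    afterwards.\<close>
  define r where "r w i = ?f (Suc i) w ! i" for w i
  have meas: "?f n \<in> measurable M (count_space UNIV)" for n
  proof (induction n)
    case (Suc n)
    have *: "(\<lambda>w. l @ [LEAST k. w \<in> ?W (l @ [k])]) \<in> measurable M (count_space UNIV)" for l
    proof -
      have "(\<lambda>w. LEAST k. w \<in> ?W (l @ [k])) \<in> measurable M (count_space UNIV)"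
        using box_branches_sets[OF S, of \<tau>] by measurable
      then show ?thesis by (rule measurable_compose) simp
    qed
    show ?case
      unfolding least_branch.simps Let_def by (rule measurable_compose_countable[OF * Suc])
  qed simp
  show "(\<lambda>w. r w i) \<in> measurable M (count_space UNIV)" for i
    unfolding r_def by (rule measurable_compose[OF meas]) simp
  fix w n assume w: "w \<in> ?W []"
  have len: "length (?f n w) = n" for n by (induction n) (simp_all add: Let_def)
  have in_W: "w \<in> ?W (?f n w)" for n
  proof (induction n)
    case (Suc n)
    show ?case unfolding least_branch.simps Let_def by (rule LeastI_ex) (rule box_branches_extend[OF Suc])
  qed (use w in simp)
  have nth: "?f n w ! i = r w i" if "i < n" for i n
    using that
  proof (induction n)
    case (Suc n)
    then show ?case using len[of n] by (cases "i = n") (auto simp: r_def Let_def nth_append)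
  qed simp
  obtain \<rho> where \<rho>: "\<forall>i<n. \<rho> i = ?f n w ! i" "w \<in> S n \<rho>"
    using in_W[of n] len[of n] unfolding box_branches_def by simp (meson order_refl)
  have "S n \<rho> = S n (r w)" using \<rho>(1) nth by (intro finitaryD[OF S(1)]) auto
  then show "w \<in> S n (r w)" using \<rho>(2) by simp
qed

text \<open>The set of points with an infinite branch need not be measurable, but outer measure is
  continuous along increasing sequences of arbitrary sets, so each coordinate can be bounded without
  losing the strict inequality. Continuity from above does need measurability; it is applied to the
  finite-stage sets \<open>T m\<close>, which contain \<open>D (f m) m\<close>.\<close>

lemma (in finite_measure) box_branches_approx:
  fixes S :: "nat \<Rightarrow> (nat \<Rightarrow> nat) \<Rightarrow> 'a set"
  assumes S: "finitary S" "\<And>n \<rho>. S n \<rho> \<in> sets M"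
    and a: "a < outer_measure_of M {w\<in>space M. \<exists>\<rho>. \<forall>n. w \<in> S n \<rho>}"
  obtains \<tau> where "a \<le> emeasure M (box_branches M S \<tau> [])"
proof -
  define D where "D \<tau> n = {w\<in>space M. \<exists>\<rho>. (\<forall>i<n. \<rho> i \<le> \<tau> i) \<and> (\<forall>n. w \<in> S n \<rho>)}" for \<tau> :: "nat \<Rightarrow> nat" and n
  have step: "\<exists>k. a < outer_measure_of M (D (\<tau>(n := k)) (Suc n))" if "a < outer_measure_of M (D \<tau> n)" for \<tau> n
  proof -
    have "D \<tau> n = (\<Union>k. D (\<tau>(n := k)) (Suc n))"
      unfolding D_def by (auto simp: less_Suc_eq split: if_splits)
    moreover have "incseq (\<lambda>k. D (\<tau>(n := k)) (Suc n))"
      unfolding D_def incseq_def by (auto simp: less_Suc_eq split: if_splits) (metis le_trans nat_neq_iff)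
    moreover have "D (\<tau>(n := k)) (Suc n) \<subseteq> space M" for k by (auto simp: D_def)
    ultimately have "outer_measure_of M (D \<tau> n) = (SUP k. outer_measure_of M (D (\<tau>(n := k)) (Suc n)))"
      using SUP_outer_measure_of_incseq[of "\<lambda>k. D (\<tau>(n := k)) (Suc n)" M] by metis
    then show ?thesis using that by (simp add: less_SUP_iff)
  qed
  have "\<exists>f. \<forall>n. a < outer_measure_of M (D (f n) n) \<and> (\<exists>k. f (Suc n) = (f n)(n := k))"
  proof (rule dependent_nat_choice)
    show "\<exists>\<tau>. a < outer_measure_of M (D \<tau> 0)" using a by (simp add: D_def)
    show "\<exists>y. a < outer_measure_of M (D y (Suc n)) \<and> (\<exists>k. y = x(n := k))"
      if "a < outer_measure_of M (D x n)" for x n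
      using step[OF that] by blast
  qed
  then obtain f where f: "\<And>n. a < outer_measure_of M (D (f n) n)"
    and fs: "\<And>n. \<exists>k. f (Suc n) = (f n)(n := k)" by auto
  \<comment> \<open>\<open>f (Suc n)\<close> differs from \<open>f n\<close> at most in coordinate
    \<open>n\<close>, so this coordinate is final from stage \<open>Suc n\<close> on.\<close>
  define \<tau> where "\<tau> n = f (Suc n) n" for n
  have f_eq: "f n i = \<tau> i" if "i < n" for i n
    using that
  proof (induction n)
    case (Suc n)
    then show ?case using fs[of n] by (cases "i = n") (auto simp: \<tau>_def)
  qed simp
  define T where "T m = {w\<in>space M. \<exists>\<rho>. (\<forall>i. \<rho> i \<le> \<tau> i) \<and>
     (\<forall>i<length ([]::nat list). \<rho> i = [] ! i) \<and> (\<forall>j\<le>m. w \<in> S j \<rho>)}" for m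
  have T: "T m \<in> sets M" for m unfolding T_def by (rule finite_box_branches_sets[OF S])
  have "a \<le> emeasure M (T m)" for m
  proof -
    have "D (f m) m \<subseteq> T m"
    proof
      fix w assume "w \<in> D (f m) m"
      then obtain \<rho> where \<rho>: "w \<in> space M" "\<forall>i<m. \<rho> i \<le> \<tau> i" "\<forall>n. w \<in> S n \<rho>"
        unfolding D_def using f_eq by auto
      have "S j (\<lambda>i. if i < m then \<rho> i else 0) = S j \<rho>" if "j \<le> m" for j
        using that by (intro finitaryD[OF S(1)]) auto
      then show "w \<in> T m"
        unfolding T_def using \<rho> by (auto intro!: exI[of _ "\<lambda>i. if i < m then \<rho> i else 0"])
    qed
    then have "outer_measure_of M (D (f m) m) \<le> emeasure M (T m)"
      using T by (metis outer_measure_of_eq outer_measure_of_mono)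
    then show ?thesis using f[of m] by simp
  qed
  moreover have "(INF m. emeasure M (T m)) = emeasure M (\<Inter>m. T m)"
  proof (rule INF_emeasure_decseq)
    show "decseq T" unfolding decseq_def T_def by (auto intro: le_trans)
  qed (use T in auto)
  moreover have "(\<Inter>m. T m) = box_branches M S \<tau> []"
    unfolding T_def box_branches_def by auto
  ultimately have "a \<le> emeasure M (box_branches M S \<tau> [])" by (metis INF_greatest)
  then show ?thesis by (rule that)
qed

text \<open>\<open>U\<close> is a measurable hull of the set \<open>D\<close> of points with an
  infinite branch. Boxes inside \<open>D\<close> exhaust the measure of \<open>U\<close> up to
  \<open>1 / Suc k\<close>, so \<open>U\<close> minus their union is null. The least index of a box
  containing the point then picks one of countably many measurable branches.\<close>

lemma (in finite_measure) branch_selection: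
  fixes S :: "nat \<Rightarrow> (nat \<Rightarrow> nat) \<Rightarrow> 'a set"
  assumes S: "finitary S" "\<And>n \<rho>. S n \<rho> \<in> sets M"
  obtains r N where "N \<in> null_sets M" "\<And>i. (\<lambda>w. r w i) \<in> measurable M (count_space UNIV)"
    "\<And>w \<rho> n. w \<in> space M - N \<Longrightarrow> (\<And>n. w \<in> S n \<rho>) \<Longrightarrow> w \<in> S n (r w)"
proof -
  define D where "D = {w\<in>space M. \<exists>\<rho>. \<forall>n. w \<in> S n \<rho>}"
  obtain U where U: "U \<in> sets M" "D \<subseteq> U" "outer_measure_of M D = emeasure M U"
    using outer_measure_of_attain[of D M] by (auto simp: D_def)
  have "\<exists>\<tau>. emeasure M U - 1 / of_nat (Suc k) \<le> emeasure M (box_branches M S \<tau> [])" for k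
  proof (cases "emeasure M U = 0")
    case False
    then have "emeasure M U - 1 / of_nat (Suc k) < emeasure M U"
      using emeasure_finite[of U]
      by (intro ennreal_between)
        (simp_all add: ennreal_zero_less_divide zero_less_iff_neq_zero less_top[symmetric])
    then show ?thesis
      using box_branches_approx[OF S, of "emeasure M U - 1 / of_nat (Suc k)"] U(3) unfolding D_def by metis
  qed simp
  then obtain \<tau> where \<tau>: "\<And>k. emeasure M U - 1 / of_nat (Suc k) \<le> emeasure M (box_branches M S (\<tau> k) [])"
    by metis
  let ?B = "\<lambda>k. box_branches M S (\<tau> k) []"
  have B: "?B k \<in> sets M" for k by (rule box_branches_sets[OF S])
  have "\<exists>r. (\<forall>i. (\<lambda>w. r w i) \<in> measurable M (count_space UNIV)) \<and>
    (\<forall>w n. w \<in> ?B k \<longrightarrow> w \<in> S n (r w))" for k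
    by (rule box_selection[OF S, of "\<tau> k"]) blast
  then obtain r where r: "\<And>k i. (\<lambda>w. r k w i) \<in> measurable M (count_space UNIV)"
    "\<And>k w n. w \<in> ?B k \<Longrightarrow> w \<in> S n (r k w)" by metis
  have BD: "?B k \<subseteq> D" for k
    using r(2)[of _ k] unfolding D_def by (auto simp: box_branches_def)
  have "emeasure M U \<le> emeasure M (\<Union>k. ?B k)"
  proof (rule ennreal_le_epsilon)
    fix e :: real assume e: "0 < e"
    then obtain k where k: "1 / real (Suc k) < e" using nat_approx_posE by blast
    have "emeasure M U \<le> emeasure M (?B k) + 1 / of_nat (Suc k)"
      using \<tau>[of k] by (simp add: ennreal_minus_le_iff add.commute)
    also have "emeasure M (?B k) \<le> emeasure M (\<Union>k. ?B k)"
      using B by (intro emeasure_mono) auto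
    also have "1 / of_nat (Suc k) = ennreal (1 / real (Suc k))"
      by (metis divide_ennreal ennreal_1 ennreal_of_nat_eq_real_of_nat of_nat_0_less_iff zero_less_Suc zero_le_one)
    also have "\<dots> \<le> ennreal e" using k by (intro ennreal_leI) auto
    finally show "emeasure M U \<le> emeasure M (\<Union>k. ?B k) + ennreal e" by (simp add: add_mono)
  qed
  moreover have "emeasure M (U - (\<Union>k. ?B k)) = emeasure M U - emeasure M (\<Union>k. ?B k)"
    using U B BD by (intro emeasure_Diff) auto
  ultimately have N: "U - (\<Union>k. ?B k) \<in> null_sets M"
    using U(1) B by (intro null_setsI) (auto simp: diff_eq_0_iff_ennreal less_top[symmetric])
  show ?thesis
  proof (rule that[OF N])
    define K where "K w = (LEAST k. w \<in> ?B k)" for w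
    have K: "K \<in> measurable M (count_space UNIV)"
      unfolding K_def using B by measurable
    show "(\<lambda>w. r (K w) w i) \<in> measurable M (count_space UNIV)" for i
      by (rule measurable_compose_countable[OF r(1) K])
    fix w \<rho> n assume w: "w \<in> space M - (U - (\<Union>k. ?B k))" and "\<And>n. w \<in> S n \<rho>"
    then have "w \<in> D" unfolding D_def by auto
    then have "w \<in> (\<Union>k. ?B k)" using w U(2) by auto
    then have "w \<in> ?B (K w)" unfolding K_def by (auto intro: LeastI)
    then show "w \<in> S n (r (K w) w)" by (rule r(2))
  qed
qed

text \<open>\<open>A\<close> is the projection of a scheme on sequences of pairs: the first
  components are the coordinates of \<open>x\<close>, the second ones those of a witness
  \<open>\<sigma>\<close>. Keeping \<open>x\<close> and \<open>\<sigma>\<close> together lets a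
  single branch selection choose both.\<close>

definition suslin_via :: "'a measure \<Rightarrow> (nat \<Rightarrow> (nat \<Rightarrow> nat \<times> nat) \<Rightarrow> 'a set) \<Rightarrow> ('a \<times> (nat \<Rightarrow> nat)) set \<Rightarrow> bool" where
  "suslin_via M S A \<longleftrightarrow> finitary S \<and> (\<forall>n \<rho>. S n \<rho> \<in> sets M) \<and>
     (\<forall>w x. (w, x) \<in> A \<longleftrightarrow> w \<in> space M \<and> (\<exists>\<sigma>. \<forall>n. w \<in> S n (\<lambda>i. (x i, \<sigma> i))))"

definition suslin :: "'a measure \<Rightarrow> ('a \<times> (nat \<Rightarrow> nat)) set \<Rightarrow> bool" where
  "suslin M A \<longleftrightarrow> (\<exists>S. suslin_via M S A)"

lemma suslinI:
  fixes S :: "nat \<Rightarrow> (nat \<Rightarrow> nat \<times> nat) \<Rightarrow> 'a set"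
  assumes "finitary S" "\<And>n \<rho>. S n \<rho> \<in> sets M"
    "\<And>w x. (w, x) \<in> A \<longleftrightarrow> w \<in> space M \<and> (\<exists>\<sigma>. \<forall>n. w \<in> S n (\<lambda>i. (x i, \<sigma> i)))"
  shows "suslin M A"
  unfolding suslin_def suslin_via_def by (rule exI[of _ S]) (intro conjI allI assms)

lemma suslin_viaD:
  assumes "suslin_via M S A"
  shows "finitary S" "S n \<rho> \<in> sets M"
    "(w, x) \<in> A \<longleftrightarrow> w \<in> space M \<and> (\<exists>\<sigma>. \<forall>n. w \<in> S n (\<lambda>i. (x i, \<sigma> i)))"
  using assms unfolding suslin_via_def by blast+

text \<open>The witness starts with the index \<open>j\<close> of a set containing the point; the
  witness for \<open>A j\<close> follows, shifted by one place. Hence stage \<open>Suc m\<close>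
  tests stage \<open>m\<close> of scheme \<open>j\<close>, and stage 0 tests only membership in
  \<open>space M\<close>.\<close>

lemma suslin_UN:
  assumes "\<And>j::nat. suslin M (A j)"
  shows "suslin M (\<Union>j. A j)"
proof -
  obtain S where "\<And>j. suslin_via M (S j) (A j)"
    using assms unfolding suslin_def by metis
  note S = suslin_viaD[OF this]
  define S' where "S' n \<rho> = (case n of 0 \<Rightarrow> space M
    | Suc m \<Rightarrow> S (snd (\<rho> 0)) m (\<lambda>i. (fst (\<rho> i), snd (\<rho> (Suc i)))))" for n and \<rho> :: "nat \<Rightarrow> nat \<times> nat"
  show ?thesis
  proof (rule suslinI[of S'])
    show "finitary S'"
      unfolding finitary_def
    proof (intro allI impI)
      fix n and \<rho> \<sigma> :: "nat \<Rightarrow> nat \<times> nat" assume *: "\<forall>i<n. \<rho> i = \<sigma> i"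
      show "S' n \<rho> = S' n \<sigma>"
      proof (cases n)
        case (Suc m)
        then show ?thesis
          using * by (auto simp: S'_def intro!: finitaryD[OF S(1)])
      qed (simp add: S'_def)
    qed
    show "S' n \<rho> \<in> sets M" for n \<rho> using S(2) by (auto simp: S'_def split: nat.split)
    fix w x
    have "(\<exists>j \<sigma>. \<forall>n. w \<in> S j n (\<lambda>i. (x i, \<sigma> i))) \<longleftrightarrow> (\<exists>\<sigma>. \<forall>n. w \<in> S' n (\<lambda>i. (x i, \<sigma> i)))"
      if "w \<in> space M"
    proof
      assume "\<exists>j \<sigma>. \<forall>n. w \<in> S j n (\<lambda>i. (x i, \<sigma> i))"
      then obtain j \<sigma> where "\<forall>n. w \<in> S j n (\<lambda>i. (x i, \<sigma> i))" by blast
      then have "\<forall>n. w \<in> S' n (\<lambda>i. (x i, case_nat j \<sigma> i))"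
        using that by (simp add: S'_def split: nat.split)
      then show "\<exists>\<sigma>. \<forall>n. w \<in> S' n (\<lambda>i. (x i, \<sigma> i))" by blast
    next
      assume "\<exists>\<sigma>. \<forall>n. w \<in> S' n (\<lambda>i. (x i, \<sigma> i))"
      then obtain \<sigma> where \<sigma>: "\<And>n. w \<in> S' n (\<lambda>i. (x i, \<sigma> i))" by blast
      have "w \<in> S (\<sigma> 0) n (\<lambda>i. (x i, \<sigma> (Suc i)))" for n
        using \<sigma>[of "Suc n"] by (simp add: S'_def)
      then show "\<exists>j \<sigma>. \<forall>n. w \<in> S j n (\<lambda>i. (x i, \<sigma> i))"
        by (intro exI[of _ "\<sigma> 0"] exI[of _ "\<lambda>i. \<sigma> (Suc i)"]) simp
    qed
    then show "(w, x) \<in> (\<Union>j. A j) \<longleftrightarrow> w \<in> space M \<and> (\<exists>\<sigma>. \<forall>n. w \<in> S' n (\<lambda>i. (x i, \<sigma> i)))"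
      using S(3) by auto
  qed
qed

text \<open>One sequence codes the witnesses of all \<open>A j\<close>, entry
  \<open>prod_encode (j, i)\<close> being entry \<open>i\<close> of the witness for
  \<open>A j\<close>. Stage \<open>prod_encode (j, m)\<close> tests stage \<open>m\<close> of scheme
  \<open>j\<close>; the entries it reads come earlier because \<open>prod_encode\<close> increases
  in its second argument.\<close>

lemma suslin_INT:
  assumes "\<And>j::nat. suslin M (A j)"
  shows "suslin M (\<Inter>j. A j)"
proof -
  obtain S where "\<And>j. suslin_via M (S j) (A j)"
    using assms unfolding suslin_def by metis
  note S = suslin_viaD[OF this]
  define S' where "S' n \<rho> = (case prod_decode n of (j, m) \<Rightarrow>
    S j m (\<lambda>i. (fst (\<rho> i), snd (\<rho> (prod_encode (j, i))))))" for n and \<rho> :: "nat \<Rightarrow> nat \<times> nat"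
  have mono: "prod_encode (j, i) < prod_encode (j, m)" if "i < m" for i j m
  proof -
    have step: "prod_encode (j, n) < prod_encode (j, Suc n)" for n
      by (simp add: prod_encode_def)
    show ?thesis by (rule lift_Suc_mono_less[of "\<lambda>i. prod_encode (j, i)", OF step that])
  qed
  show ?thesis
  proof (rule suslinI[of S'])
    show "finitary S'"
      unfolding finitary_def
    proof (intro allI impI)
      fix n and \<rho> \<sigma> :: "nat \<Rightarrow> nat \<times> nat" assume *: "\<forall>i<n. \<rho> i = \<sigma> i"
      obtain j m where n: "n = prod_encode (j, m)" by (metis prod_decode_inverse surj_pair)
      have "i < n" if "i < m" for i
        using that le_prod_encode_2[of m j] n by simp
      then show "S' n \<rho> = S' n \<sigma>"
        using * mono n by (auto simp: S'_def intro!: finitaryD[OF S(1)])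
    qed
    show "S' n \<rho> \<in> sets M" for n \<rho> using S(2) by (auto simp: S'_def split: prod.split)
    fix w x
    have "(\<forall>j. \<exists>\<sigma>. \<forall>n. w \<in> S j n (\<lambda>i. (x i, \<sigma> i))) \<longleftrightarrow> (\<exists>\<sigma>. \<forall>n. w \<in> S' n (\<lambda>i. (x i, \<sigma> i)))"
    proof
      assume "\<forall>j. \<exists>\<sigma>. \<forall>n. w \<in> S j n (\<lambda>i. (x i, \<sigma> i))"
      then obtain \<sigma> where \<sigma>: "\<And>j n. w \<in> S j n (\<lambda>i. (x i, \<sigma> j i))" by metis
      have "w \<in> S' n (\<lambda>i. (x i, case prod_decode i of (j, i) \<Rightarrow> \<sigma> j i))" for n
        using \<sigma> by (simp add: S'_def split: prod.split)
      then show "\<exists>\<sigma>. \<forall>n. w \<in> S' n (\<lambda>i. (x i, \<sigma> i))"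
        by (intro exI[of _ "\<lambda>i. case prod_decode i of (j, i) \<Rightarrow> \<sigma> j i"]) simp
    next
      assume "\<exists>\<sigma>. \<forall>n. w \<in> S' n (\<lambda>i. (x i, \<sigma> i))"
      then obtain \<sigma> where \<sigma>: "\<And>n. w \<in> S' n (\<lambda>i. (x i, \<sigma> i))" by blast
      have "w \<in> S j m (\<lambda>i. (x i, \<sigma> (prod_encode (j, i))))" for j m
        using \<sigma>[of "prod_encode (j, m)"] by (simp add: S'_def)
      show "\<forall>j. \<exists>\<sigma>. \<forall>n. w \<in> S j n (\<lambda>i. (x i, \<sigma> i))"
      proof
        fix j show "\<exists>\<sigma>. \<forall>n. w \<in> S j n (\<lambda>i. (x i, \<sigma> i))"
          using \<open>\<And>j m. w \<in> S j m (\<lambda>i. (x i, \<sigma> (prod_encode (j, i))))\<close>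
          by (intro exI[of _ "\<lambda>i. \<sigma> (prod_encode (j, i))"]) simp
      qed
    qed
    then show "(w, x) \<in> (\<Inter>j. A j) \<longleftrightarrow> w \<in> space M \<and> (\<exists>\<sigma>. \<forall>n. w \<in> S' n (\<lambda>i. (x i, \<sigma> i)))"
      using S(3) by auto
  qed
qed

text \<open>\<open>B = C\<close> gives the sets depending on \<open>w\<close> only,
  \<open>B = space M\<close> with \<open>C = {}\<close> the cylinders, and the conditional form is
  closed under complement. Stages \<open>n \<le> i\<close> cannot yet see \<open>x i\<close> and
  impose no condition beyond \<open>space M\<close>.\<close>

lemma suslin_basic:
  assumes "B \<in> sets M" "C \<in> sets M"
  shows "suslin M {(w, x). w \<in> (if P (x i) then B else C)}"
proof (rule suslinI)
  let ?S = "\<lambda>n \<rho>. if n \<le> i then space M else if P (fst (\<rho> i)) then B else C"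
  show "finitary ?S" unfolding finitary_def by auto
  show "?S n \<rho> \<in> sets M" for n \<rho> using assms by auto
  fix w and x :: "nat \<Rightarrow> nat"
  have "(\<forall>n. w \<in> ?S n (\<lambda>i. (x i, \<sigma> i))) \<longleftrightarrow> w \<in> (if P (x i) then B else C)"
    if "w \<in> space M" for \<sigma> :: "nat \<Rightarrow> nat"
  proof
    assume "\<forall>n. w \<in> ?S n (\<lambda>i. (x i, \<sigma> i))"
    then have "w \<in> ?S (Suc i) (\<lambda>i. (x i, \<sigma> i))" by blast
    then show "w \<in> (if P (x i) then B else C)" by simp
  qed (use that in auto)
  then show "(w, x) \<in> {(w, x). w \<in> (if P (x i) then B else C)} \<longleftrightarrow> w \<in> space M \<and> (\<exists>\<sigma>. \<forall>n. w \<in> ?S n (\<lambda>i. (x i, \<sigma> i :: nat)))"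
    using sets.sets_into_space[OF assms(1)] sets.sets_into_space[OF assms(2)] by auto
qed

text \<open>The sets that are Suslin together with their complement form a \<open>\<sigma>\<close>-algebra.\<close>

lemma measurable_imp_suslin:
  assumes A: "A \<in> sets (M \<Otimes>\<^sub>M (\<Pi>\<^sub>M i\<in>(UNIV::nat set). count_space (UNIV::nat set)))"
  shows "suslin M A"
proof -
  let ?P = "\<Pi>\<^sub>M i\<in>(UNIV::nat set). count_space (UNIV::nat set)"
  define \<Omega> where "\<Omega> = space M \<times> (UNIV :: (nat \<Rightarrow> nat) set)"
  define \<A> where "\<A> = {A. A \<subseteq> \<Omega> \<and> suslin M A \<and> suslin M (\<Omega> - A)}"
  have basic: "{(w, x). w \<in> (if P (x i) then B else C)} \<in> \<A>"
    if "B \<in> sets M" "C \<in> sets M" for P i B C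
  proof -
    have "{(w, x). w \<in> (if P (x i) then B else C)} \<subseteq> \<Omega>"
      using that[THEN sets.sets_into_space] unfolding \<Omega>_def by (auto split: if_splits)
    moreover have "\<Omega> - {(w, x). w \<in> (if P (x i) then B else C)} = {(w, x). w \<in> (if P (x i) then space M - B else space M - C)}"
      unfolding \<Omega>_def by auto
    ultimately show ?thesis
      using suslin_basic[of B M C P i] suslin_basic[of "space M - B" M "space M - C" P i] that
      unfolding \<A>_def by simp
  qed
  interpret \<A>: sigma_algebra \<Omega> \<A>
    unfolding sigma_algebra_iff2
  proof (intro conjI ballI allI impI)
    show "\<A> \<subseteq> Pow \<Omega>" by (auto simp: \<A>_def)
    show "{} \<in> \<A>" using basic[of "{}" "{}"] by simp
    fix A assume "A \<in> \<A>"
    then show "\<Omega> - A \<in> \<A>" unfolding \<A>_def by (auto simp: double_diff)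
  next
    fix A :: "nat \<Rightarrow> _" assume A: "range A \<subseteq> \<A>"
    then have "suslin M (\<Union>j. A j)" by (intro suslin_UN) (auto simp: \<A>_def)
    moreover have "suslin M (\<Inter>j. \<Omega> - A j)" using A by (intro suslin_INT) (auto simp: \<A>_def)
    moreover have "(\<Inter>j. \<Omega> - A j) = \<Omega> - (\<Union>j. A j)" by auto
    ultimately show "(\<Union>j. A j) \<in> \<A>" using A by (auto simp: \<A>_def)
  qed
  \<comment> \<open>With respect to this \<sigma>-algebra both projections are measurable, so the
    identity into the product space is measurable too, and every measurable set of the product
    belongs to it.\<close>
  define X where "X = sigma \<Omega> \<A>"
  have X: "space X = \<Omega>" "sets X = \<A>"
    unfolding X_def using \<A>.space_closed by (simp_all add: \<A>.sigma_sets_eq)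
  have "fst \<in> measurable X M"
  proof (rule measurableI)
    fix B assume B: "B \<in> sets M"
    have "fst -` B \<inter> space X = {(w, x). w \<in> (if True then B else B)}"
      using sets.sets_into_space[OF B] unfolding X \<Omega>_def by auto
    then show "fst -` B \<inter> space X \<in> sets X" using basic[OF B B, of "\<lambda>_. True"] X by simp
  qed (auto simp: X \<Omega>_def)
  moreover have "snd \<in> measurable X ?P"
  proof (rule measurable_PiM_single')
    show "(\<lambda>p. snd p i) \<in> measurable X (count_space UNIV)" for i
    proof (rule measurableI)
      fix B :: "nat set"
      have "(\<lambda>p. snd p i) -` B \<inter> space X = {(w, x). w \<in> (if x i \<in> B then space M else {})}"
        unfolding X \<Omega>_def by auto
      then show "(\<lambda>p. snd p i) -` B \<inter> space X \<in> sets X"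
        using basic[of "space M" "{}" "\<lambda>k. k \<in> B"] X by simp
    qed simp
  qed (simp add: space_PiM)
  ultimately have "(\<lambda>p. (fst p, snd p)) \<in> measurable X (M \<Otimes>\<^sub>M ?P)" by (rule measurable_Pair)
  then have id: "(\<lambda>p. p) \<in> measurable X (M \<Otimes>\<^sub>M ?P)" by simp
  have "A \<subseteq> \<Omega>" using sets.sets_into_space[OF A] by (simp add: space_pair_measure space_PiM \<Omega>_def)
  then have "A \<in> sets X" using measurable_sets[OF id A] X by (simp add: Int_absorb2)
  then show ?thesis unfolding X \<A>_def by simp
qed

text \<open>The space \<open>'e\<close> is a Borel image of the Baire space under \<open>\<sigma> \<mapsto> lim (d \<circ> \<sigma>)\<close> for a dense sequence \<open>d\<close>.\<close>

theorem (in finite_measure) Aumann_selection: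
  fixes A :: "('a \<times> 'e::{banach,second_countable_topology}) set"
  assumes A: "A \<in> sets (M \<Otimes>\<^sub>M borel)"
  obtains s N where "s \<in> borel_measurable M" "N \<in> null_sets M"
    "\<And>w x. w \<in> space M - N \<Longrightarrow> (w, x) \<in> A \<Longrightarrow> (w, s w) \<in> A"
proof -
  let ?P = "\<Pi>\<^sub>M i\<in>(UNIV::nat set). count_space (UNIV::nat set)"
  obtain D :: "'e set" where D: "countable D" "\<And>X. open X \<Longrightarrow> X \<noteq> {} \<Longrightarrow> \<exists>d\<in>D. d \<in> X"
    using countable_dense_exists by blast
  define d where "d = from_nat_into D"
  have Dne: "D \<noteq> {}" using D(2)[of UNIV] by auto
  \<comment> \<open>\<open>lim\<close> has a fixed default value where the sequence diverges, so
    \<open>\<pi>\<close> is a total Borel function.\<close>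
  define \<pi> where "\<pi> \<sigma> = lim (\<lambda>n. d (\<sigma> n))" for \<sigma>
  have surj: "\<exists>\<sigma>. \<pi> \<sigma> = x" for x
  proof -
    have "\<exists>k. dist (d k) x < 1 / real (Suc n)" for n
    proof -
      obtain y where "y \<in> D" "y \<in> ball x (1 / real (Suc n))"
        using D(2)[of "ball x (1 / real (Suc n))"] by auto
      then show ?thesis
        using from_nat_into_surj[OF D(1)] unfolding d_def by (metis dist_commute mem_ball)
    qed
    then obtain \<sigma> where \<sigma>: "\<And>n. dist (d (\<sigma> n)) x < 1 / real (Suc n)" by metis
    have "(\<lambda>n. d (\<sigma> n)) \<longlonglongrightarrow> x"
      by (rule metric_tendsto_imp_tendsto[OF LIMSEQ_inverse_real_of_nat])
        (use \<sigma> in \<open>auto simp: inverse_eq_divide intro!: always_eventually less_imp_le\<close>)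
    then show ?thesis unfolding \<pi>_def using limI by blast
  qed
  have lim: "(\<lambda>w. lim (\<lambda>n. d (h w n))) \<in> borel_measurable X"
    if "\<And>n. (\<lambda>w. h w n) \<in> measurable X (count_space UNIV)" for h and X :: "'x measure"
    by (intro borel_measurable_lim_metric measurable_compose[OF that]) simp
  have \<pi>: "\<pi> \<in> borel_measurable ?P"
    unfolding \<pi>_def by (intro lim measurable_component_singleton) simp
  define A' where "A' = (\<lambda>p. (fst p, \<pi> (snd p))) -` A \<inter> space (M \<Otimes>\<^sub>M ?P)"
  have "(\<lambda>p. (fst p, \<pi> (snd p))) \<in> measurable (M \<Otimes>\<^sub>M ?P) (M \<Otimes>\<^sub>M borel)"
    by (intro measurable_Pair measurable_fst measurable_compose[OF measurable_snd \<pi>])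
  then have "A' \<in> sets (M \<Otimes>\<^sub>M ?P)"
    unfolding A'_def using A by (rule measurable_sets)
  then have "suslin M A'" by (rule measurable_imp_suslin)
  then obtain S where "suslin_via M S A'" unfolding suslin_def by blast
  note S = suslin_viaD[OF this]
  \<comment> \<open>Pairs are coded as natural numbers because \<open>branch_selection\<close> deals
    with sequences of naturals; the selected branch is decoded into the point and its
    witness.\<close>
  define S' where "S' n \<rho> = S n (\<lambda>i. prod_decode (\<rho> i))" for n \<rho>
  have "finitary S'" unfolding S'_def finitary_def by (auto intro!: finitaryD[OF S(1)])
  then obtain r N where rN: "N \<in> null_sets M" "\<And>i. (\<lambda>w. r w i) \<in> measurable M (count_space UNIV)"
    "\<And>w \<rho> n. w \<in> space M - N \<Longrightarrow> (\<And>n. w \<in> S' n \<rho>) \<Longrightarrow> w \<in> S' n (r w)"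
    using branch_selection[of S'] S(2) unfolding S'_def by metis
  define t where "t w i = fst (prod_decode (r w i))" for w i
  show ?thesis
  proof
    have t: "(\<lambda>w. t w i) \<in> measurable M (count_space UNIV)" for i
      unfolding t_def by (rule measurable_compose[OF rN(2)]) simp
    show "(\<lambda>w. \<pi> (t w)) \<in> borel_measurable M"
      unfolding \<pi>_def by (intro lim t)
    show "N \<in> null_sets M" by fact
    fix w x assume w: "w \<in> space M - N" and wx: "(w, x) \<in> A"
    obtain y where y: "\<pi> y = x" using surj by auto
    then have "(w, y) \<in> A'" using w wx by (auto simp: A'_def space_pair_measure space_PiM)
    then obtain \<sigma> where "\<And>n. w \<in> S n (\<lambda>i. (y i, \<sigma> i))" using S(3) by auto
    then have "w \<in> S' n (\<lambda>i. prod_encode (y i, \<sigma> i))" for n by (simp add: S'_def)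
    then have "w \<in> S' n (r w)" for n using rN(3)[OF w] by blast
    then have "w \<in> S n (\<lambda>i. (t w i, snd (prod_decode (r w i))))" for n by (simp add: S'_def t_def)
    then have "(w, t w) \<in> A'"
      unfolding S(3) using w by (auto intro!: exI[of _ "\<lambda>i. snd (prod_decode (r w i))"])
    then show "(w, \<pi> (t w)) \<in> A" by (simp add: A'_def)
  qed
qed

section \<open>Lebesgue--Bochner spaces\<close>

text \<open>If one argument is 0, the inequality reduces to \<open>r powr p \<le> r\<close> for
  \<open>r\<close> in [0, 1]; otherwise it is convexity of the power on positive reals.\<close>

lemma convex_powr:
  assumes p: "1 \<le> p" and s: "0 \<le> s" "0 \<le> t" "s + t = 1" and x: "0 \<le> x" "0 \<le> (y::real)"
  shows "(s * x + t * y) powr p \<le> s * x powr p + t * y powr p"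
proof -
  have pow_le: "r powr p \<le> r" if "0 \<le> r" "r \<le> 1" for r
    using powr_mono'[of 1 p r] p that by simp
  have one: "(r * z) powr p \<le> r * z powr p" if "0 \<le> r" "r \<le> 1" "0 \<le> z" for r z
    using pow_le[OF that(1,2)] that by (simp add: powr_mult mult_right_mono)
  show ?thesis
  proof (cases "x = 0 \<or> y = 0")
    case True
    then show ?thesis using one[of t y] one[of s x] s x p by auto
  next
    case False
    then show ?thesis
      using convex_onD[OF powr_convex[OF p], of t x y] s x by (simp add: eq_diff_eq[symmetric])
  qed
qed

section \<open>Norms, Minkowski's inequality and integrability of the pairing on
  representatives\<close>

locale Lp_space = finite_measure M for M :: "'a measure" +
  fixes p :: real
  assumes p: "1 \<le> p"
begin

lemma powr_ge: "0 \<le> a \<Longrightarrow> a \<le> 1 + a powr p"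
proof (cases "a \<le> 1")
  case False
  then have "a powr 1 \<le> a powr p" using p by (intro powr_mono) auto
  then show ?thesis using False by simp
qed (simp add: add_increasing2)

lemma LpI:
  fixes f :: "'a \<Rightarrow> 'e::{banach,second_countable_topology}"
  assumes f: "f \<in> borel_measurable M" and i: "integrable M (\<lambda>w. norm (f w) powr p)"
  shows "f \<in> Lp M p"
proof -
  have "integrable M (\<lambda>w. 1 + norm (f w) powr p)" using i by simp
  then have "integrable M f"
    by (rule Bochner_Integration.integrable_bound) (use f powr_ge in \<open>auto intro!: AE_I2 simp: add_nonneg_nonneg\<close>)
  then show ?thesis using assms unfolding Lp_def by simp
qed

lemma LpD:
  assumes "f \<in> Lp M p"
  shows "f \<in> borel_measurable M" "integrable M f" "integrable M (\<lambda>w. norm (f w) powr p)"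
  using assms unfolding Lp_def by auto

lemma Lp_bound:
  assumes u: "u \<in> Lp M p" and f: "f \<in> borel_measurable M" and le: "AE w in M. norm (f w) \<le> norm (u w)"
  shows "f \<in> Lp M p" "Lp_norm M p f \<le> Lp_norm M p u"
proof -
  have ae: "AE w in M. norm (f w) powr p \<le> norm (u w) powr p"
    using le by eventually_elim (use p in \<open>intro powr_mono2, auto\<close>)
  have i: "integrable M (\<lambda>w. norm (f w) powr p)"
    by (rule Bochner_Integration.integrable_bound[OF LpD(3)[OF u]]) (use f ae in auto)
  show "f \<in> Lp M p" by (rule LpI[OF f i])
  have "(\<integral>w. norm (f w) powr p \<partial>M) \<le> (\<integral>w. norm (u w) powr p \<partial>M)"
    by (intro integral_mono_AE i LpD(3)[OF u] ae)
  then show "Lp_norm M p f \<le> Lp_norm M p u"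
    unfolding Lp_norm_def using p by (intro powr_mono2) auto
qed

lemma Lp_const: "(\<lambda>_. x) \<in> Lp M p"
  by (intro LpI) auto

lemma Lp_norm_fun: "f \<in> Lp M p \<Longrightarrow> (\<lambda>w. norm (f w)) \<in> Lp M p"
  using LpD by (intro LpI) auto

lemma Lp_norm_nonneg: "0 \<le> Lp_norm M p f"
  by (simp add: Lp_norm_def)

lemma Lp_norm_powr: "Lp_norm M p f powr p = (\<integral>w. norm (f w) powr p \<partial>M)"
  using p by (simp add: Lp_norm_def powr_powr)

lemma Lp_norm_cong: "(\<And>w. norm (f w) = norm (g w)) \<Longrightarrow> Lp_norm M p f = Lp_norm M p g"
  by (simp add: Lp_norm_def)

lemma Lp_scale:
  assumes "f \<in> Lp M p"
  shows "r *\<^sub>R f \<in> Lp M p" "Lp_norm M p (r *\<^sub>R f) = \<bar>r\<bar> * Lp_norm M p f"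
proof -
  show "r *\<^sub>R f \<in> Lp M p"
  proof (rule LpI)
    show "r *\<^sub>R f \<in> borel_measurable M"
      using LpD(1)[OF assms] unfolding scaleR_fun_def by measurable
  qed (use LpD[OF assms] in \<open>simp add: powr_mult\<close>)
  show "Lp_norm M p (r *\<^sub>R f) = \<bar>r\<bar> * Lp_norm M p f"
    using p by (simp add: Lp_norm_def powr_mult powr_powr)
qed

lemma Lp_norm_eq_0:
  assumes f: "f \<in> Lp M p" and "Lp_norm M p f = 0"
  shows "AE w in M. f w = 0"
proof -
  have "(\<integral>w. norm (f w) powr p \<partial>M) = 0" using assms(2) by (simp add: Lp_norm_def)
  then have "AE w in M. norm (f w) powr p = 0"
    by (subst (asm) integral_nonneg_eq_0_iff_AE[OF LpD(3)[OF f]]) auto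
  then show ?thesis by simp
qed

text \<open>\<open>norm (f w) + norm (g w)\<close> is \<open>A + B\<close> times the convex
  combination, with weights \<open>A / (A + B)\<close> and \<open>B / (A + B)\<close>, of the
  normalised functions. Convexity bounds the p-th power pointwise by \<open>h\<close>, whose
  integral is exactly \<open>(A + B) powr p\<close>.\<close>

lemma Minkowski_aux:
  assumes f: "f \<in> Lp M p" and g: "g \<in> Lp M p"
    and a: "Lp_norm M p f > 0" and b: "Lp_norm M p g > 0"
  shows "f + g \<in> Lp M p" "Lp_norm M p (f + g) \<le> Lp_norm M p f + Lp_norm M p g"
proof -
  define A B where "A = Lp_norm M p f" and "B = Lp_norm M p g"
  have AB: "A > 0" "B > 0" using a b by (auto simp: A_def B_def)
  define h where "h w = (A + B) powr p * (A / (A + B) * (norm (f w) / A) powr p + B / (A + B) * (norm (g w) / B) powr p)" for w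
  have le: "norm ((f + g) w) powr p \<le> h w" for w
  proof -
    have "norm ((f + g) w) powr p \<le> (norm (f w) + norm (g w)) powr p"
      using p by (intro powr_mono2) (auto simp: norm_triangle_ineq)
    also have "norm (f w) + norm (g w) = (A + B) * (A / (A + B) * (norm (f w) / A) + B / (A + B) * (norm (g w) / B))"
    proof -
      have "A + B \<noteq> 0" using AB by simp
      then show ?thesis using AB by (simp add: distrib_left)
    qed
    also have "\<dots> powr p = (A + B) powr p * (A / (A + B) * (norm (f w) / A) + B / (A + B) * (norm (g w) / B)) powr p"
      using AB by (intro powr_mult)
    also have "\<dots> \<le> h w"
      unfolding h_def using AB by (intro mult_left_mono convex_powr p) (auto simp: add_divide_distrib[symmetric])
    finally show ?thesis .
  qed
  have hi: "integrable M h"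
    unfolding h_def using LpD(3)[OF f] LpD(3)[OF g] AB by (simp add: powr_divide)
  have fg: "f + g \<in> borel_measurable M"
    using LpD(1)[OF f] LpD(1)[OF g] unfolding plus_fun_def by measurable
  have i: "integrable M (\<lambda>w. norm ((f + g) w) powr p)"
  proof (rule Bochner_Integration.integrable_bound[OF hi])
    show "(\<lambda>w. norm ((f + g) w) powr p) \<in> borel_measurable M"
      using measurable_compose[OF fg, of "\<lambda>x. norm x powr p" borel] by simp
    show "AE w in M. norm (norm ((f + g) w) powr p) \<le> norm (h w)"
      using order_trans[OF le abs_ge_self] by simp
  qed
  show "f + g \<in> Lp M p" by (rule LpI[OF fg i])
  have "(\<integral>w. norm ((f + g) w) powr p \<partial>M) \<le> (\<integral>w. h w \<partial>M)"
    by (intro integral_mono i hi le)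
  also have "(\<integral>w. h w \<partial>M) = (A + B) powr p * (A / (A + B) * (A powr p / A powr p) + B / (A + B) * (B powr p / B powr p))"
    unfolding h_def using LpD(3)[OF f] LpD(3)[OF g] AB
    by (simp add: powr_divide Lp_norm_powr[symmetric] A_def[symmetric] B_def[symmetric])
  also have "\<dots> = (A + B) powr p" using AB by (simp add: add_divide_distrib[symmetric])
  finally have "(\<integral>w. norm ((f + g) w) powr p \<partial>M) powr (1 / p) \<le> ((A + B) powr p) powr (1 / p)"
    using p by (intro powr_mono2) auto
  then show "Lp_norm M p (f + g) \<le> Lp_norm M p f + Lp_norm M p g"
    using p AB by (simp add: Lp_norm_def[of M p "f + g"] powr_powr A_def B_def)
qed

lemma Minkowski:
  assumes f: "f \<in> Lp M p" and g: "g \<in> Lp M p"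
  shows "f + g \<in> Lp M p" "Lp_norm M p (f + g) \<le> Lp_norm M p f + Lp_norm M p g"
proof -
  have fg: "f + g \<in> borel_measurable M"
    using LpD(1)[OF f] LpD(1)[OF g] unfolding plus_fun_def by measurable
  consider "Lp_norm M p f = 0" | "Lp_norm M p g = 0" | "Lp_norm M p f > 0" "Lp_norm M p g > 0"
    using Lp_norm_nonneg[of f] Lp_norm_nonneg[of g] by linarith
  then have "f + g \<in> Lp M p \<and> Lp_norm M p (f + g) \<le> Lp_norm M p f + Lp_norm M p g"
  proof cases
    case 1
    have "AE w in M. norm ((f + g) w) \<le> norm (g w)"
      using Lp_norm_eq_0[OF f 1] by eventually_elim simp
    from Lp_bound[OF g fg this] show ?thesis using 1 by (simp add: plus_fun_def)
  next
    case 2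
    have "AE w in M. norm ((f + g) w) \<le> norm (f w)"
      using Lp_norm_eq_0[OF g 2] by eventually_elim simp
    from Lp_bound[OF f fg this] show ?thesis using 2 by (simp add: plus_fun_def)
  next
    case 3
    then show ?thesis using Minkowski_aux[OF f g] by simp
  qed
  then show "f + g \<in> Lp M p" "Lp_norm M p (f + g) \<le> Lp_norm M p f + Lp_norm M p g" by auto
qed

lemma Lp_subspace: "subspace (Lp M p)"
  unfolding subspace_def using Minkowski(1) Lp_scale(1) Lp_const[of 0] by (auto simp: zero_fun_def)

text \<open>Integrate \<open>a \<le> 1 + a powr p\<close> for
  \<open>a = norm (f w) / Lp_norm M p f\<close>: the right-hand side has integral equal to the
  measure of the space plus 1, which is the constant.\<close>

lemma L1_le_Lp:
  fixes f :: "'a \<Rightarrow> 'e::{banach,second_countable_topology}"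
  assumes f: "f \<in> Lp M p"
  shows "(\<integral>w. norm (f w) \<partial>M) \<le> (measure M (space M) + 1) * Lp_norm M p f"
proof (cases "Lp_norm M p f = 0")
  case True
  have "(\<integral>w. norm (f w) \<partial>M) = (\<integral>w. 0 \<partial>M)"
    using Lp_norm_eq_0[OF f True] LpD(1)[OF f] by (intro integral_cong_AE) auto
  then show ?thesis using True by simp
next
  case False
  define A where "A = Lp_norm M p f"
  have A: "A > 0" using False Lp_norm_nonneg[of f] by (simp add: A_def less_le)
  have "(\<integral>w. norm (f w) / A \<partial>M) \<le> (\<integral>w. 1 + (norm (f w) / A) powr p \<partial>M)"
    using LpD[OF f] A by (intro integral_mono powr_ge) (auto simp: powr_divide)
  also have "\<dots> = measure M (space M) + A powr p / A powr p"
    using LpD(3)[OF f] A by (simp add: powr_divide Lp_norm_powr[symmetric] A_def[symmetric])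
  also have "\<dots> = measure M (space M) + 1" using A by simp
  finally show ?thesis using A by (simp add: A_def[symmetric] field_simps)
qed

lemma Lp_norm_dominated_tendsto_0:
  fixes b :: "nat \<Rightarrow> 'a \<Rightarrow> 'e::{banach,second_countable_topology}"
  assumes b: "\<And>n. b n \<in> borel_measurable M" and G: "G \<in> Lp M p"
    and le: "\<And>n. AE w in M. norm (b n w) \<le> norm (G w)"
    and lim: "AE w in M. (\<lambda>n. b n w) \<longlonglongrightarrow> 0"
  shows "(\<lambda>n. Lp_norm M p (b n)) \<longlonglongrightarrow> 0"
proof -
  have "(\<lambda>n. \<integral>w. norm (b n w) powr p \<partial>M) \<longlonglongrightarrow> (\<integral>w. 0 \<partial>M)"
  proof (rule integral_dominated_convergence)
    show "integrable M (\<lambda>w. norm (G w) powr p)" by (rule LpD(3)[OF G])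
    show "AE w in M. norm (norm (b n w) powr p) \<le> norm (G w) powr p" for n
      using le[of n] by eventually_elim (use p in \<open>auto intro!: powr_mono2\<close>)
    show "AE w in M. (\<lambda>n. norm (b n w) powr p) \<longlonglongrightarrow> 0"
      using lim
    proof eventually_elim
      case (elim w)
      then have "(\<lambda>n. norm (b n w) powr p) \<longlonglongrightarrow> 0 powr p"
        using p tendsto_norm_zero[OF elim] by (intro tendsto_powr2 tendsto_const) auto
      then show ?case by simp
    qed
  qed (use b in auto)
  then have "(\<lambda>n. (\<integral>w. norm (b n w) powr p \<partial>M) powr (1 / p)) \<longlonglongrightarrow> 0 powr (1 / p)"
    using p by (intro tendsto_powr2 tendsto_const) auto
  then show ?thesis by (simp add: Lp_norm_def)
qed

lemma pairing_integrable:
  fixes g :: "'a \<Rightarrow> 'e::{banach,second_countable_topology} \<Rightarrow>\<^sub>L real"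
  assumes g: "g \<in> Lq_wstar M p" and f: "f \<in> Lp M p"
    and m: "(\<lambda>w. blinfun_apply (g w) (f w)) \<in> borel_measurable M"
  shows "integrable M (\<lambda>w. blinfun_apply (g w) (f w))"
proof (cases "p = 1")
  case True
  then obtain C where C: "AE w in M. norm (g w) \<le> C" using g unfolding Lq_wstar_def by auto
  have "integrable M (\<lambda>w. C * norm (f w))" using LpD(2)[OF f] by simp
  then show ?thesis
  proof (rule Bochner_Integration.integrable_bound[OF _ m])
    show "AE w in M. norm (blinfun_apply (g w) (f w)) \<le> norm (C * norm (f w))"
      using C
    proof eventually_elim
      case (elim w)
      have "norm (blinfun_apply (g w) (f w)) \<le> norm (g w) * norm (f w)" by (rule norm_blinfun)
      also have "\<dots> \<le> C * norm (f w)" using elim by (intro mult_right_mono) auto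
      finally show ?case by simp
    qed
  qed
next
  case False
  define q where "q = p / (p - 1)"
  have q: "q > 0" "1 / q + 1 / p = 1" using p False by (auto simp: q_def field_simps)
  have gq: "integrable M (\<lambda>w. norm (g w) powr q)" using g False unfolding Lq_wstar_def q_def by auto
  have "integrable M (\<lambda>w. norm (g w) powr q / q + norm (f w) powr p / p)"
    using gq LpD(3)[OF f] by simp
  then show ?thesis
  proof (rule Bochner_Integration.integrable_bound[OF _ m], intro AE_I2)
    fix w
    have "norm (blinfun_apply (g w) (f w)) \<le> norm (g w) * norm (f w)" by (rule norm_blinfun)
    also have "\<dots> \<le> norm (g w) powr q / q + norm (f w) powr p / p"
    proof (rule Youngs_inequality)
      show "q > 1" using p False by (simp add: q_def field_simps)
    qed (use p q False in auto)
    finally show "norm (blinfun_apply (g w) (f w)) \<le> norm (norm (g w) powr q / q + norm (f w) powr p / p)"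
      by simp
  qed
qed

end

text \<open>Approximation of the second argument from a countable dense set makes Caratheodory functions
  jointly measurable.\<close>

lemma Caratheodory_measurable:
  fixes F :: "'a \<Rightarrow> 'e::{metric_space,second_countable_topology} \<Rightarrow> real"
  assumes D: "countable D" "\<And>X. open X \<Longrightarrow> X \<noteq> {} \<Longrightarrow> \<exists>d\<in>D. d \<in> X"
    and meas: "\<And>x. x \<in> D \<Longrightarrow> (\<lambda>w. F w x) \<in> borel_measurable M"
    and cont: "\<And>w. w \<in> space M \<Longrightarrow> continuous_on UNIV (F w)"
  shows "(\<lambda>z. F (fst z) (snd z)) \<in> borel_measurable (M \<Otimes>\<^sub>M borel)"
proof -
  define d where "d = from_nat_into D"
  have Dne: "D \<noteq> {}" using D(2)[of UNIV] by auto
  have dD: "d k \<in> D" for k unfolding d_def by (rule from_nat_into[OF Dne])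
  define K where "K n x = (LEAST k. dist (d k) x < 1 / real (Suc n))" for n x
  have K: "dist (d (K n x)) x < 1 / real (Suc n)" for n x
  proof -
    obtain y where "y \<in> D" "y \<in> ball x (1 / real (Suc n))"
      using D(2)[of "ball x (1 / real (Suc n))"] by auto
    then have "\<exists>k. dist (d k) x < 1 / real (Suc n)"
      using from_nat_into_surj[OF D(1)] unfolding d_def by (metis dist_commute mem_ball)
    then show ?thesis unfolding K_def by (rule LeastI_ex)
  qed
  show ?thesis
  proof (rule borel_measurable_LIMSEQ_metric)
    fix n
    have "(\<lambda>x. K n x) \<in> measurable borel (count_space UNIV)"
      unfolding K_def by measurable
    from measurable_compose[OF measurable_snd this]
    have Kn: "(\<lambda>z. K n (snd z)) \<in> measurable (M \<Otimes>\<^sub>M borel) (count_space UNIV)" .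
    show "(\<lambda>z. F (fst z) (d (K n (snd z)))) \<in> borel_measurable (M \<Otimes>\<^sub>M borel)"
      by (rule measurable_compose_countable[OF measurable_compose[OF measurable_fst meas[OF dD]] Kn])
  next
    fix z assume "z \<in> space (M \<Otimes>\<^sub>M (borel :: 'e measure))"
    then have c: "isCont (F (fst z)) (snd z)"
      using cont by (simp add: space_pair_measure mem_Times_iff continuous_on_eq_continuous_at)
    have "(\<lambda>n. d (K n (snd z))) \<longlonglongrightarrow> snd z"
      by (rule metric_tendsto_imp_tendsto[OF LIMSEQ_inverse_real_of_nat])
        (use K in \<open>auto simp: inverse_eq_divide intro!: always_eventually less_imp_le\<close>)
    then show "(\<lambda>n. F (fst z) (d (K n (snd z)))) \<longlonglongrightarrow> F (fst z) (snd z)"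
      by (rule isCont_tendsto_compose[OF c])
  qed
qed

lemma blinfun_joint_measurable:
  fixes g :: "'a \<Rightarrow> 'e::{real_normed_vector,second_countable_topology} \<Rightarrow>\<^sub>L real"
  assumes "\<And>x. (\<lambda>w. blinfun_apply (g w) x) \<in> borel_measurable M"
  shows "(\<lambda>z. blinfun_apply (g (fst z)) (snd z)) \<in> borel_measurable (M \<Otimes>\<^sub>M borel)"
proof -
  obtain D :: "'e set" where D: "countable D" "\<And>X. open X \<Longrightarrow> X \<noteq> {} \<Longrightarrow> \<exists>d\<in>D. d \<in> X"
    using countable_dense_exists by blast
  show ?thesis
    by (rule Caratheodory_measurable[OF D assms]) (auto intro: continuous_intros)
qed

lemma blinfun_apply_measurable:
  fixes g :: "'a \<Rightarrow> 'e::{real_normed_vector,second_countable_topology} \<Rightarrow>\<^sub>L real"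
  assumes "\<And>x. (\<lambda>w. blinfun_apply (g w) x) \<in> borel_measurable M" "f \<in> borel_measurable M"
  shows "(\<lambda>w. blinfun_apply (g w) (f w)) \<in> borel_measurable M"
  using measurable_compose[OF measurable_Pair[OF measurable_ident assms(2)] blinfun_joint_measurable[OF assms(1)]]
  by simp

section \<open>The dual of L1\<close>

lemma sets_Collect_Ball_countable:
  assumes "countable D" "\<And>x. x \<in> D \<Longrightarrow> {w\<in>space M. P x w} \<in> sets M"
  shows "{w\<in>space M. \<forall>x\<in>D. P x w} \<in> sets M"
proof -
  have "{w\<in>space M. \<forall>x\<in>D. P x w} = space M - (\<Union>x\<in>D. space M - {w\<in>space M. P x w})" by auto
  also have "\<dots> \<in> sets M" using assms by (intro sets.Diff sets.top sets.countable_UN'') auto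
  finally show ?thesis .
qed

lemma (in finite_measure) AE_nonpos_of_set_integrals:
  fixes f :: "'a \<Rightarrow> real"
  assumes f: "integrable M f" and le: "\<And>A. A \<in> sets M \<Longrightarrow> (\<integral>w. indicator A w * f w \<partial>M) \<le> 0"
  shows "AE w in M. f w \<le> 0"
proof -
  define A where "A = {w\<in>space M. 0 < f w}"
  have A: "A \<in> sets M" unfolding A_def using f by measurable
  have i: "integrable M (\<lambda>w. indicator A w * f w)"
    using integrable_mult_indicator[OF A f] by simp
  have nn: "AE w in M. 0 \<le> indicator A w * f w"
    by (intro AE_I2) (auto simp: A_def indicator_def)
  have "(\<integral>w. indicator A w * f w \<partial>M) = 0"
    using le[OF A] integral_nonneg_AE[OF nn] by simp
  then have "AE w in M. indicator A w * f w = 0"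
    using integral_nonneg_eq_0_iff_AE[OF i nn] by simp
  then show ?thesis
    using AE_space by eventually_elim (auto simp: A_def indicator_def split: if_splits)
qed

text \<open>Adding \<open>C\<close> times the measure makes \<open>\<nu>\<close> nonnegative.
  Domination by the measure then gives absolute continuity, and continuity at the empty set, which
  turns finite into countable additivity. The Radon-Nikodym density of the sum, minus
  \<open>C\<close>, is the density of \<open>\<nu>\<close>.\<close>

lemma (in finite_measure) bounded_additive_density:
  fixes \<nu> :: "'a set \<Rightarrow> real"
  assumes add: "\<And>A B. A \<in> sets M \<Longrightarrow> B \<in> sets M \<Longrightarrow> A \<inter> B = {} \<Longrightarrow> \<nu> (A \<union> B) = \<nu> A + \<nu> B"
    and bound: "\<And>A. A \<in> sets M \<Longrightarrow> \<bar>\<nu> A\<bar> \<le> C * measure M A"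
  obtains \<phi> where "integrable M \<phi>" "\<And>A. A \<in> sets M \<Longrightarrow> \<nu> A = (\<integral>w. indicator A w * \<phi> w \<partial>M)"
proof -
  define \<nu>' where "\<nu>' A = ennreal (\<nu> A + C * measure M A)" for A
  have nn: "0 \<le> \<nu> A + C * measure M A" and ub: "\<nu> A + C * measure M A \<le> 2 * C * measure M A"
    if "A \<in> sets M" for A
    using bound[OF that] by linarith+
  have empty: "\<nu> {} = 0" using bound[of "{}"] by simp
  have pos: "positive (sets M) \<nu>'" by (simp add: positive_def \<nu>'_def empty)
  have "countably_additive (sets M) \<nu>'"
  proof (rule sets.empty_continuous_imp_countably_additive[OF pos])
    show "additive (sets M) \<nu>'"
      unfolding additive_def \<nu>'_def
      using nn by (auto simp: add finite_measure_Union ennreal_plus[symmetric] distrib_left algebra_simps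
          simp del: ennreal_plus)
    show "\<forall>A\<in>sets M. \<nu>' A \<noteq> \<infinity>" by (simp add: \<nu>'_def)
    fix A :: "nat \<Rightarrow> 'a set" assume A: "range A \<subseteq> sets M" "decseq A" "(\<Inter>i. A i) = {}"
    have lim: "(\<lambda>i. 2 * C * measure M (A i)) \<longlonglongrightarrow> 2 * C * 0"
      using finite_Lim_measure_decseq[OF A(1,2)] A(3) by (intro tendsto_intros) simp
    have "(\<lambda>i. \<nu> (A i) + C * measure M (A i)) \<longlonglongrightarrow> 0"
    proof (rule tendsto_sandwich[OF _ _ tendsto_const])
      show "(\<lambda>i. 2 * C * measure M (A i)) \<longlonglongrightarrow> 0" using lim by simp
    qed (use nn ub A(1) in \<open>auto intro!: always_eventually\<close>)
    then show "(\<lambda>i. \<nu>' (A i)) \<longlonglongrightarrow> 0"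
      unfolding \<nu>'_def by (metis ennreal_0 tendsto_ennrealI)
  qed
  then have ms: "measure_space (space M) (sets M) \<nu>'"
    using pos sets.sigma_algebra_axioms by (simp add: measure_space_def)
  define K where "K = measure_of (space M) (sets M) \<nu>'"
  have K: "space K = space M" "sets K = sets M" by (simp_all add: K_def)
  have eK: "emeasure K A = \<nu>' A" if "A \<in> sets M" for A
    unfolding K_def using ms that by (simp add: measure_space_def emeasure_measure_of_sigma)
  have "finite_measure K"
    by (rule finite_measureI) (simp add: K eK \<nu>'_def)
  moreover have "absolutely_continuous M K"
    unfolding absolutely_continuous_def
  proof
    fix A assume "A \<in> null_sets M"
    then have A: "A \<in> sets M" "measure M A = 0" by (auto simp: null_sets_def measure_def)
    then show "A \<in> null_sets K" using bound[OF A(1)] by (auto simp: null_sets_def K eK \<nu>'_def)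
  qed
  ultimately obtain f where f: "f \<in> borel_measurable M" "density M f = K"
    using Radon_Nikodym_finite_measure[of K] K(2) by blast
  have fA: "(\<integral>\<^sup>+w. f w * indicator A w \<partial>M) = \<nu>' A" if "A \<in> sets M" for A
    using emeasure_density[OF f(1) that] f(2) eK[OF that] by simp
  have fin: "AE w in M. f w \<noteq> \<infinity>"
  proof (rule nn_integral_PInf_AE[OF f(1)])
    have "(\<integral>\<^sup>+w. f w \<partial>M) = (\<integral>\<^sup>+w. f w * indicator (space M) w \<partial>M)"
      by (intro nn_integral_cong) simp
    then show "(\<integral>\<^sup>+w. f w \<partial>M) \<noteq> \<infinity>" using fA[of "space M"] by (simp add: \<nu>'_def)
  qed
  define \<phi> where "\<phi> w = enn2real (f w)" for w
  have \<phi>A: "has_bochner_integral M (\<lambda>w. indicator A w * \<phi> w) (\<nu> A + C * measure M A)" if A: "A \<in> sets M" for A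
  proof (rule has_bochner_integral_nn_integral)
    show "(\<lambda>w. indicator A w * \<phi> w) \<in> borel_measurable M" unfolding \<phi>_def using f(1) A by measurable
    have "(\<integral>\<^sup>+w. ennreal (indicator A w * \<phi> w) \<partial>M) = (\<integral>\<^sup>+w. f w * indicator A w \<partial>M)"
      by (rule nn_integral_cong_AE)
        (use fin in eventually_elim, auto simp: \<phi>_def indicator_def less_top[symmetric])
    then show "(\<integral>\<^sup>+w. ennreal (indicator A w * \<phi> w) \<partial>M) = ennreal (\<nu> A + C * measure M A)"
      using fA[OF A] by (simp add: \<nu>'_def)
  qed (use nn[OF A] in \<open>auto simp: \<phi>_def intro!: AE_I2\<close>)
  have \<phi>i: "integrable M \<phi>"
    using \<phi>A[of "space M"] by (simp add: has_bochner_integral_iff cong: Bochner_Integration.integrable_cong)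
  show ?thesis
  proof (rule that[of "\<lambda>w. \<phi> w - C"])
    show "integrable M (\<lambda>w. \<phi> w - C)" using \<phi>i by simp
    fix A assume A: "A \<in> sets M"
    have "integrable M (indicator A :: 'a \<Rightarrow> real)"
      using A by (intro integrable_real_indicator) (auto simp: less_top[symmetric])
    then have i: "integrable M (\<lambda>w. indicator A w * C)" by simp
    have "(\<integral>w. indicator A w * (\<phi> w - C) \<partial>M) = (\<integral>w. indicator A w * \<phi> w - indicator A w * C \<partial>M)"
      by (simp add: right_diff_distrib)
    also have "\<dots> = (\<nu> A + C * measure M A) - measure M A * C"
      using \<phi>A[OF A] A i by (subst Bochner_Integration.integral_diff) (auto simp: has_bochner_integral_iff)
    finally show "\<nu> A = (\<integral>w. indicator A w * (\<phi> w - C) \<partial>M)" by simp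
  qed
qed

text \<open>Densities chosen vector by vector are linear in the vector only a.e., with a null set
  depending on the vectors involved. A countable set closed under addition and rational scaling
  leaves countably many relations, hence one null set. Rational combinations are coded by lists,
  which makes countability immediate.\<close>

lemma countable_dense_rat_subspace:
  obtains D :: "'e::{real_normed_vector,second_countable_topology} set"
  where "countable D" "closure D = UNIV" "\<And>x y. x \<in> D \<Longrightarrow> y \<in> D \<Longrightarrow> x + y \<in> D"
    "\<And>x q. x \<in> D \<Longrightarrow> q \<in> \<rat> \<Longrightarrow> q *\<^sub>R x \<in> D" "0 \<in> D"
proof -
  obtain D0 :: "'e set" where D0: "countable D0" "\<And>X. open X \<Longrightarrow> X \<noteq> {} \<Longrightarrow> \<exists>d\<in>D0. d \<in> X"
    using countable_dense_exists by blast
  define comb where "comb l = (\<Sum>(q, i)\<leftarrow>l. of_rat q *\<^sub>R from_nat_into D0 i)" for l :: "(rat \<times> nat) list"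
  show ?thesis
  proof
    show "countable (range comb)" by simp
    have "D0 \<subseteq> range comb"
    proof
      fix x assume "x \<in> D0"
      then obtain i where "from_nat_into D0 i = x" using from_nat_into_surj[OF D0(1)] by blast
      then have "comb [(1, i)] = x" by (simp add: comb_def)
      then show "x \<in> range comb" by blast
    qed
    moreover have "closure D0 = UNIV"
    proof (rule ccontr)
      assume "closure D0 \<noteq> UNIV"
      then have "\<exists>d\<in>D0. d \<in> - closure D0" by (intro D0(2)) auto
      then show False using closure_subset by auto
    qed
    ultimately show "closure (range comb) = UNIV" using closure_mono by blast
    show "x + y \<in> range comb" if xy: "x \<in> range comb" "y \<in> range comb" for x y
    proof -
      obtain l l' where "x = comb l" "y = comb l'" using xy by auto
      then have "x + y = comb (l @ l')" by (simp add: comb_def)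
      then show ?thesis by blast
    qed
    show "q *\<^sub>R x \<in> range comb" if x: "x \<in> range comb" and q: "q \<in> \<rat>" for x q
    proof -
      obtain l where l: "x = comb l" using x by auto
      obtain r where r: "q = of_rat r" using q by (auto elim: Rats_cases)
      have "q *\<^sub>R comb l = comb (map (\<lambda>(s, i). (r * s, i)) l)"
        by (induction l) (auto simp: comb_def r of_rat_mult scaleR_add_right)
      then show ?thesis using l by blast
    qed
    have "comb [] = 0" by (simp add: comb_def)
    then show "0 \<in> range comb" by (metis rangeI)
  qed
qed

text \<open>The dual of a separable space need not be separable, so measurability of the evaluations
  does not give measurability of \<open>g\<close> as a map into the dual. The norm alone is
  determined by the evaluations on a countable dense set, because the bound at \<open>x\<close> is a
  closed condition on \<open>x\<close>.\<close>

lemma blinfun_norm_measurable: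
  fixes g :: "'a \<Rightarrow> 'e::{real_normed_vector,second_countable_topology} \<Rightarrow>\<^sub>L real"
  assumes gm: "\<And>x. (\<lambda>w. blinfun_apply (g w) x) \<in> borel_measurable M"
  shows "(\<lambda>w. norm (g w)) \<in> borel_measurable M"
proof -
  obtain D :: "'e set" where D: "countable D" "closure D = UNIV"
    by (rule countable_dense_rat_subspace) blast
  \<comment> \<open>The condition \<open>0 \<le> a\<close> matters when the space is trivial: the
    bounds on \<open>D\<close> then hold for negative \<open>a\<close> as well.\<close>
  have norm_le: "norm (g w) \<le> a \<longleftrightarrow> 0 \<le> a \<and> (\<forall>x\<in>D. \<bar>blinfun_apply (g w) x\<bar> \<le> a * norm x)" for w a
  proof
    assume a: "norm (g w) \<le> a"
    then have "\<bar>blinfun_apply (g w) x\<bar> \<le> a * norm x" for x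
      using norm_blinfun[of "g w" x] mult_right_mono[OF a norm_ge_zero[of x]] by simp
    moreover have "0 \<le> a" using a norm_ge_zero[of "g w"] by linarith
    ultimately show "0 \<le> a \<and> (\<forall>x\<in>D. \<bar>blinfun_apply (g w) x\<bar> \<le> a * norm x)" by blast
  next
    assume a: "0 \<le> a \<and> (\<forall>x\<in>D. \<bar>blinfun_apply (g w) x\<bar> \<le> a * norm x)"
    have "closed {x. \<bar>blinfun_apply (g w) x\<bar> \<le> a * norm x}"
      by (intro closed_Collect_le continuous_intros)
    then have "closure D \<subseteq> {x. \<bar>blinfun_apply (g w) x\<bar> \<le> a * norm x}"
      using a by (intro closure_minimal) auto
    then show "norm (g w) \<le> a" using a D(2) by (intro norm_blinfun_bound) auto
  qed
  show "(\<lambda>w. norm (g w)) \<in> borel_measurable M"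
  proof (rule borel_measurableI_le)
    fix a
    have "{w \<in> space M. norm (g w) \<le> a} = {w\<in>space M. 0 \<le> a \<and> (\<forall>x\<in>D. \<bar>blinfun_apply (g w) x\<bar> \<le> a * norm x)}"
      by (simp add: norm_le)
    also have "\<dots> \<in> sets M"
    proof -
      have "{w\<in>space M. \<bar>blinfun_apply (g w) x\<bar> \<le> a * norm x} \<in> sets M" for x
        using gm[of x] by measurable
      then have "{w\<in>space M. \<forall>x\<in>D. \<bar>blinfun_apply (g w) x\<bar> \<le> a * norm x} \<in> sets M"
        by (intro sets_Collect_Ball_countable D(1))
      then show ?thesis by (cases "0 \<le> a") auto
    qed
    finally show "{w \<in> space M. norm (g w) \<le> a} \<in> sets M" .
  qed
qed

text \<open>A Lipschitz function extends from a dense set; additivity and homogeneity are closed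
  conditions that hold on the dense sets \<open>D \<times> D\<close> and
  \<open>\<rat> \<times> D\<close>, hence everywhere.\<close>

lemma rat_linear_extension:
  fixes f :: "'e::real_normed_vector \<Rightarrow> real"
  assumes D: "closure D = UNIV" "\<And>x y. x \<in> D \<Longrightarrow> y \<in> D \<Longrightarrow> x + y \<in> D"
      "\<And>x q. x \<in> D \<Longrightarrow> q \<in> \<rat> \<Longrightarrow> q *\<^sub>R x \<in> D"
    and add: "\<And>x y. x \<in> D \<Longrightarrow> y \<in> D \<Longrightarrow> f (x + y) = f x + f y"
    and scale: "\<And>x q. x \<in> D \<Longrightarrow> q \<in> \<rat> \<Longrightarrow> f (q *\<^sub>R x) = q * f x"
    and bound: "\<And>x. x \<in> D \<Longrightarrow> \<bar>f x\<bar> \<le> c * norm x" and c: "0 \<le> c"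
  obtains B :: "'e \<Rightarrow>\<^sub>L real" where "\<And>x. x \<in> D \<Longrightarrow> blinfun_apply B x = f x" "norm B \<le> c"
proof -
  have "c-lipschitz_on D f"
  proof (rule lipschitz_onI[OF _ c])
    fix x y assume x: "x \<in> D" and y: "y \<in> D"
    have my: "(-1) *\<^sub>R y \<in> D" using D(3)[OF y, of "-1"] by simp
    have "f (x + (-1) *\<^sub>R y) = f x - f y" using add[OF x my] scale[OF y, of "-1"] by simp
    then have "f x - f y = f (x - y)" by simp
    moreover have "x - y \<in> D" using D(2)[OF x my] by simp
    ultimately show "dist (f x) (f y) \<le> c * dist x y"
      using bound[of "x - y"] by (simp add: dist_real_def dist_norm)
  qed
  then obtain G where G: "c-lipschitz_on UNIV G" "\<And>x. x \<in> D \<Longrightarrow> G x = f x"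
    using lipschitz_extend_closure[of c D f] D(1) by auto
  have cont: "continuous_on UNIV G" using lipschitz_on_continuous_on[OF G(1)] .
  have contc: "continuous_on S (\<lambda>z. G (h z))" if "continuous_on S h" for S :: "'z::topological_space set" and h
    using continuous_on_compose2[OF cont that] by simp
  have add': "G (x + y) = G x + G y" for x y
  proof -
    have "closed {z :: 'e \<times> 'e. G (fst z + snd z) = G (fst z) + G (snd z)}"
      by (intro closed_Collect_eq contc continuous_intros)
    moreover have "D \<times> D \<subseteq> {z. G (fst z + snd z) = G (fst z) + G (snd z)}"
      using D(2) add G(2) by auto
    ultimately have "closure (D \<times> D) \<subseteq> {z. G (fst z + snd z) = G (fst z) + G (snd z)}"
      by (rule closure_minimal[rotated])
    from subsetD[OF this, of "(x, y)"] show ?thesis by (simp add: closure_Times D(1))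
  qed
  have scale': "G (r *\<^sub>R x) = r * G x" for r x
  proof -
    have "closed {z :: real \<times> 'e. G (fst z *\<^sub>R snd z) = fst z * G (snd z)}"
      by (intro closed_Collect_eq contc continuous_intros)
    moreover have "\<rat> \<times> D \<subseteq> {z. G (fst z *\<^sub>R snd z) = fst z * G (snd z)}"
      using D(3) scale G(2) by auto
    ultimately have "closure (\<rat> \<times> D) \<subseteq> {z. G (fst z *\<^sub>R snd z) = fst z * G (snd z)}"
      by (rule closure_minimal[rotated])
    from subsetD[OF this, of "(r, x)"] show ?thesis by (simp add: closure_Times D(1) Rats_closure_real)
  qed
  have G0: "G 0 = 0" using scale'[of 0 0] by simp
  have le: "\<bar>G x\<bar> \<le> norm x * c" for x
    using lipschitz_onD[OF G(1), of x 0] G0 by (simp add: dist_real_def mult.commute)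
  have bl: "bounded_linear G"
    by (rule bounded_linear_intro[of G c]) (use add' scale' le in auto)
  show ?thesis
  proof (rule that[of "Blinfun G"])
    show "blinfun_apply (Blinfun G) x = f x" if "x \<in> D" for x
      using G(2)[OF that] bounded_linear_Blinfun_apply[OF bl] by simp
    show "norm (Blinfun G) \<le> c"
      using le bounded_linear_Blinfun_apply[OF bl] by (intro norm_blinfun_bound c) (simp add: mult.commute)
  qed
qed

text \<open>For fixed \<open>x\<close>, \<open>L\<close> on the functions
  \<open>indicator A w *\<^sub>R x\<close> is a set function dominated by the measure and so has a
  density \<open>\<phi> x\<close>. Outside one null set, \<open>\<phi>\<close> is rationally linear
  and bounded in \<open>x\<close> on a countable dense subspace, which defines \<open>g w\<close> in
  the dual; on the null set \<open>g\<close> is 0. Both sides are L^1-continuous and agree on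
  indicators with values in that subspace.\<close>

theorem (in finite_measure) L1_dual_representation:
  fixes L :: "('a \<Rightarrow> 'e::{banach,second_countable_topology}) \<Rightarrow> real"
  assumes lin: "linear_functional_on {f. integrable M f} L"
    and bound: "\<And>f. integrable M f \<Longrightarrow> \<bar>L f\<bar> \<le> c * (\<integral>w. norm (f w) \<partial>M)" and c: "0 \<le> c"
  obtains g where "\<And>x. (\<lambda>w. blinfun_apply (g w) x) \<in> borel_measurable M"
    "(\<lambda>w. norm (g w)) \<in> borel_measurable M" "\<And>w. norm (g w) \<le> c"
    "\<And>f. integrable M f \<Longrightarrow> L f = pairing M g f"
proof -
  have L_add: "L (\<lambda>w. f w + h w) = L f + L h" if "integrable M f" "integrable M h" for f h
    using lin that unfolding linear_functional_on_def plus_fun_def by auto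
  have L_scale: "L (\<lambda>w. r *\<^sub>R f w) = r * L f" if "integrable M f" for f r
    using lin that unfolding linear_functional_on_def scaleR_fun_def by auto
  have L_diff: "L (\<lambda>w. f w - h w) = L f - L h" if "integrable M f" "integrable M h" for f h
    using L_add[of f "\<lambda>w. (-1) *\<^sub>R h w"] L_scale[of h "-1"] that by simp
  have ind: "integrable M (\<lambda>w. indicator A w *\<^sub>R x)" if "A \<in> sets M" for A and x :: 'e
    using that by (intro integrable_scaleR_left integrable_real_indicator) (auto simp: less_top[symmetric])
  have ind_int: "(\<integral>w. norm (indicator A w *\<^sub>R x) \<partial>M) = norm x * measure M A" if "A \<in> sets M" for A and x :: 'e
    using that by simp
  have "\<exists>\<phi>. integrable M \<phi> \<and> (\<forall>A\<in>sets M. L (\<lambda>w. indicator A w *\<^sub>R x) = (\<integral>w. indicator A w * \<phi> w \<partial>M))" for x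
  proof (rule bounded_additive_density[of "\<lambda>A. L (\<lambda>w. indicator A w *\<^sub>R x)" "c * norm x"])
    fix A B assume AB: "A \<in> sets M" "B \<in> sets M" "A \<inter> B = {}"
    then have "(\<lambda>w. indicator (A \<union> B) w *\<^sub>R x) = (\<lambda>w. indicator A w *\<^sub>R x + indicator B w *\<^sub>R x)"
      by (auto simp: fun_eq_iff split: split_indicator)
    then show "L (\<lambda>w. indicator (A \<union> B) w *\<^sub>R x) = L (\<lambda>w. indicator A w *\<^sub>R x) + L (\<lambda>w. indicator B w *\<^sub>R x)"
      using L_add[OF ind ind] AB by simp
  next
    fix A assume A: "A \<in> sets M"
    show "\<bar>L (\<lambda>w. indicator A w *\<^sub>R x)\<bar> \<le> c * norm x * measure M A"
      using bound[OF ind[OF A, of x]] unfolding ind_int[OF A] by (simp only: mult.assoc)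
  qed blast
  then obtain \<phi> where \<phi>i: "\<And>x. integrable M (\<phi> x)"
    and \<phi>: "\<And>x A. A \<in> sets M \<Longrightarrow> L (\<lambda>w. indicator A w *\<^sub>R x) = (\<integral>w. indicator A w * \<phi> x w \<partial>M)"
    by metis
  have \<phi>Ai: "integrable M (\<lambda>w. indicator A w * \<phi> x w)" if "A \<in> sets M" for A x
    using integrable_mult_indicator[OF that \<phi>i[of x]] by simp
  have ae_add: "AE w in M. \<phi> (x + y) w = \<phi> x w + \<phi> y w" for x y
  proof -
    have eq: "(\<integral>w. indicator A w * (\<phi> (x + y) w - (\<phi> x w + \<phi> y w)) \<partial>M) = 0" if A: "A \<in> sets M" for A
    proof -
      have "(\<integral>w. indicator A w * (\<phi> (x + y) w - (\<phi> x w + \<phi> y w)) \<partial>M)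
         = (\<integral>w. indicator A w * \<phi> (x + y) w - (indicator A w * \<phi> x w + indicator A w * \<phi> y w) \<partial>M)"
        by (simp add: algebra_simps)
      also have "\<dots> = L (\<lambda>w. indicator A w *\<^sub>R (x + y)) - (L (\<lambda>w. indicator A w *\<^sub>R x) + L (\<lambda>w. indicator A w *\<^sub>R y))"
        using \<phi>Ai[OF A] by (simp add: \<phi>[OF A])
      also have "\<dots> = 0" using L_add[OF ind[OF A] ind[OF A], of x y] by (simp add: scaleR_add_right)
      finally show ?thesis .
    qed
    have i: "integrable M (\<lambda>w. \<phi> (x + y) w - (\<phi> x w + \<phi> y w))" using \<phi>i by simp
    have "AE w in M. \<phi> (x + y) w - (\<phi> x w + \<phi> y w) \<le> 0"
      using eq by (intro AE_nonpos_of_set_integrals[OF i]) simp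
    moreover have "AE w in M. - (\<phi> (x + y) w - (\<phi> x w + \<phi> y w)) \<le> 0"
    proof (rule AE_nonpos_of_set_integrals)
      fix A assume "A \<in> sets M"
      then show "(\<integral>w. indicator A w * - (\<phi> (x + y) w - (\<phi> x w + \<phi> y w)) \<partial>M) \<le> 0"
        using eq[of A] by (simp only: mult_minus_right Bochner_Integration.integral_minus)
    qed (use i in \<open>simp only: Bochner_Integration.integrable_minus\<close>)
    ultimately show ?thesis by eventually_elim simp
  qed
  have ae_scale: "AE w in M. \<phi> (q *\<^sub>R x) w = q * \<phi> x w" for x q
  proof -
    have eq: "(\<integral>w. indicator A w * (\<phi> (q *\<^sub>R x) w - q * \<phi> x w) \<partial>M) = 0" if A: "A \<in> sets M" for A
    proof -
      have "(\<integral>w. indicator A w * (\<phi> (q *\<^sub>R x) w - q * \<phi> x w) \<partial>M)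
         = (\<integral>w. indicator A w * \<phi> (q *\<^sub>R x) w - q * (indicator A w * \<phi> x w) \<partial>M)"
        by (simp add: algebra_simps)
      also have "\<dots> = L (\<lambda>w. indicator A w *\<^sub>R (q *\<^sub>R x)) - q * L (\<lambda>w. indicator A w *\<^sub>R x)"
        using \<phi>Ai[OF A] unfolding \<phi>[OF A] by simp
      also have "\<dots> = 0" using L_scale[OF ind[OF A], of q x] by (simp add: mult.commute)
      finally show ?thesis .
    qed
    have i: "integrable M (\<lambda>w. \<phi> (q *\<^sub>R x) w - q * \<phi> x w)" using \<phi>i by simp
    have "AE w in M. \<phi> (q *\<^sub>R x) w - q * \<phi> x w \<le> 0"
      using eq by (intro AE_nonpos_of_set_integrals[OF i]) simp
    moreover have "AE w in M. - (\<phi> (q *\<^sub>R x) w - q * \<phi> x w) \<le> 0"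
    proof (rule AE_nonpos_of_set_integrals)
      fix A assume "A \<in> sets M"
      then show "(\<integral>w. indicator A w * - (\<phi> (q *\<^sub>R x) w - q * \<phi> x w) \<partial>M) \<le> 0"
        using eq[of A] by (simp only: mult_minus_right Bochner_Integration.integral_minus)
    qed (use i in \<open>simp only: Bochner_Integration.integrable_minus\<close>)
    ultimately show ?thesis by eventually_elim simp
  qed
  have ae_bound: "AE w in M. \<bar>\<phi> x w\<bar> \<le> c * norm x" for x
  proof -
    have le: "AE w in M. \<phi> x w - c * norm x \<le> 0" for x
    proof (rule AE_nonpos_of_set_integrals)
      fix A assume A: "A \<in> sets M"
      have "(\<integral>w. indicator A w * (\<phi> x w - c * norm x) \<partial>M)
         = (\<integral>w. indicator A w * \<phi> x w - c * norm (indicator A w *\<^sub>R x) \<partial>M)"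
        by (simp add: algebra_simps)
      also have "\<dots> = L (\<lambda>w. indicator A w *\<^sub>R x) - c * (\<integral>w. norm (indicator A w *\<^sub>R x) \<partial>M)"
        using \<phi>Ai[OF A] integrable_norm[OF ind[OF A]]
        by (subst Bochner_Integration.integral_diff) (simp_all only: \<phi>[OF A] integral_mult_right_zero integrable_mult_right)
      also have "\<dots> \<le> 0" using bound[OF ind[OF A], of x] by simp
      finally show "(\<integral>w. indicator A w * (\<phi> x w - c * norm x) \<partial>M) \<le> 0" .
    qed (use \<phi>i in simp)
    show ?thesis
      using le[of x] le[of "- x"] ae_scale[of "-1" x] by eventually_elim simp
  qed
  obtain D :: "'e set" where D: "countable D" "closure D = UNIV" "\<And>x y. x \<in> D \<Longrightarrow> y \<in> D \<Longrightarrow> x + y \<in> D"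
    "\<And>x q. x \<in> D \<Longrightarrow> q \<in> \<rat> \<Longrightarrow> q *\<^sub>R x \<in> D" "0 \<in> D"
    by (rule countable_dense_rat_subspace) blast
  define good where "good w \<longleftrightarrow> (\<forall>x\<in>D. (\<forall>y\<in>D. \<phi> (x + y) w = \<phi> x w + \<phi> y w) \<and>
    (\<forall>q\<in>\<rat>. \<phi> (q *\<^sub>R x) w = q * \<phi> x w) \<and> \<bar>\<phi> x w\<bar> \<le> c * norm x)" for w
  have "AE w in M. good w"
    unfolding good_def
    by (intro AE_ball_countable[OF D(1), THEN iffD2] AE_ball_countable[OF countable_rat, THEN iffD2]
        ballI AE_conjI ae_add ae_scale ae_bound)
  then obtain N where N: "N \<in> null_sets M" "\<And>w. w \<in> space M - N \<Longrightarrow> good w"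
    by (auto elim!: AE_E3)
  have "\<exists>B. (w \<in> space M - N \<longrightarrow> (\<forall>x\<in>D. blinfun_apply B x = \<phi> x w)) \<and>
    (w \<notin> space M - N \<longrightarrow> B = 0) \<and> norm B \<le> c" for w
  proof (cases "w \<in> space M - N")
    case True
    then have g: "good w" by (rule N(2))
    obtain B where "\<And>x. x \<in> D \<Longrightarrow> blinfun_apply B x = \<phi> x w" "norm B \<le> c"
      by (rule rat_linear_extension[OF D(2,3,4), of "\<lambda>x. \<phi> x w" c])
        (use g c in \<open>auto simp: good_def\<close>)
    then show ?thesis using True by blast
  next
    case False
    then show ?thesis using c by (intro exI[of _ 0]) auto
  qed
  then obtain g where g: "\<And>w x. w \<in> space M - N \<Longrightarrow> x \<in> D \<Longrightarrow> blinfun_apply (g w) x = \<phi> x w"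
    "\<And>w. w \<notin> space M - N \<Longrightarrow> g w = 0" and gc: "\<And>w. norm (g w) \<le> c"
    by metis
  have gD: "(\<lambda>w. blinfun_apply (g w) x) \<in> borel_measurable M" if "x \<in> D" for x
  proof -
    have "(\<lambda>w. indicator (space M - N) w * \<phi> x w) \<in> borel_measurable M"
      by (intro borel_measurable_times borel_measurable_indicator sets.Diff sets.top
          null_setsD2[OF N(1)] borel_measurable_integrable[OF \<phi>i])
    moreover have "(\<lambda>w. indicator (space M - N) w * \<phi> x w) = (\<lambda>w. blinfun_apply (g w) x)"
      using g that by (auto simp: fun_eq_iff indicator_def)
    ultimately show ?thesis by simp
  qed
  have gm: "(\<lambda>w. blinfun_apply (g w) x) \<in> borel_measurable M" for x
  proof -
    obtain u where u: "\<And>n. u n \<in> D" "u \<longlonglongrightarrow> x"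
      using D(2) closure_sequential[of x D] by auto
    show ?thesis
      by (rule borel_measurable_LIMSEQ_real[of M "\<lambda>n w. blinfun_apply (g w) (u n)"])
        (use u gD in \<open>auto intro: tendsto_intros\<close>)
  qed
  have gn: "(\<lambda>w. norm (g w)) \<in> borel_measurable M" by (rule blinfun_norm_measurable[OF gm])
  define P where "P f = pairing M g f" for f
  have gint: "integrable M (\<lambda>w. blinfun_apply (g w) (f w))"
    and gbound: "\<bar>P f\<bar> \<le> c * (\<integral>w. norm (f w) \<partial>M)" if f: "integrable M f" for f
  proof -
    have le: "norm (blinfun_apply (g w) (f w)) \<le> c * norm (f w)" for w
      using norm_blinfun[of "g w" "f w"] mult_right_mono[OF gc[of w] norm_ge_zero[of "f w"]] by simp
    have cf: "integrable M (\<lambda>w. c * norm (f w))" using f by simp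
    show i: "integrable M (\<lambda>w. blinfun_apply (g w) (f w))"
    proof (rule Bochner_Integration.integrable_bound[OF cf])
      show "(\<lambda>w. blinfun_apply (g w) (f w)) \<in> borel_measurable M"
        by (rule blinfun_apply_measurable[OF gm borel_measurable_integrable[OF f]])
      show "AE w in M. norm (blinfun_apply (g w) (f w)) \<le> norm (c * norm (f w))"
        using order_trans[OF le abs_ge_self] by simp
    qed
    have "\<bar>P f\<bar> \<le> (\<integral>w. norm (blinfun_apply (g w) (f w)) \<partial>M)"
      unfolding P_def pairing_def using integral_norm_bound[of M "\<lambda>w. blinfun_apply (g w) (f w)"] by simp
    also have "\<dots> \<le> (\<integral>w. c * norm (f w) \<partial>M)"
      using i by (intro integral_mono integrable_norm cf le)
    finally show "\<bar>P f\<bar> \<le> c * (\<integral>w. norm (f w) \<partial>M)" by simp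
  qed
  \<comment> \<open>Both \<open>L\<close> and \<open>P\<close> are bounded by \<open>c\<close> times
    the L^1 norm, so their difference is Lipschitz with constant \<open>2 * c\<close> and equality
    passes to L^1 limits.\<close>
  have gap: "\<bar>L f - P f\<bar> \<le> \<bar>L h - P h\<bar> + 2 * c * (\<integral>w. norm (f w - h w) \<partial>M)"
    if f: "integrable M f" and h: "integrable M h" for f h
  proof -
    have i: "integrable M (\<lambda>w. f w - h w)" using f h by simp
    have "P (\<lambda>w. f w - h w) = P f - P h"
      unfolding P_def pairing_def using gint f h by (simp add: blinfun.diff_right)
    then show ?thesis using L_diff[OF f h] bound[OF i] gbound[OF i] by linarith
  qed
  have "L f = P f" if "integrable M f" for f
    using that
  proof (induction rule: integrable_induct)
    case (base A x)
    have baseD: "L (\<lambda>w. indicator A w *\<^sub>R y) = P (\<lambda>w. indicator A w *\<^sub>R y)" if y: "y \<in> D" for y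
    proof -
      have "(\<integral>w. indicator A w * \<phi> y w \<partial>M) = (\<integral>w. blinfun_apply (g w) (indicator A w *\<^sub>R y) \<partial>M)"
      proof (rule integral_cong_AE)
        show "AE w in M. indicator A w * \<phi> y w = blinfun_apply (g w) (indicator A w *\<^sub>R y)"
          using AE_not_in[OF N(1)] AE_space
          by eventually_elim (use g(1)[OF _ y] in \<open>simp add: blinfun.scaleR_right\<close>)
      qed (use \<phi>Ai[OF base(1), of y] gint[OF ind[OF base(1), of y]] in auto)
      then show ?thesis unfolding \<phi>[OF base(1)] P_def pairing_def .
    qed
    have "\<bar>L (\<lambda>w. indicator A w *\<^sub>R x) - P (\<lambda>w. indicator A w *\<^sub>R x)\<bar> \<le> 0"
    proof -
      obtain u where u: "\<And>n. u n \<in> D" "u \<longlonglongrightarrow> x"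
        using D(2) closure_sequential[of x D] by auto
      have "\<bar>L (\<lambda>w. indicator A w *\<^sub>R x) - P (\<lambda>w. indicator A w *\<^sub>R x)\<bar> \<le> 2 * c * (norm (x - u n) * measure M A)" for n
        using gap[OF ind[OF base(1), of x] ind[OF base(1), of "u n"]]
        unfolding baseD[OF u(1)] scaleR_diff_right[symmetric] ind_int[OF base(1)] by simp
      moreover have "(\<lambda>n. 2 * c * (norm (x - u n) * measure M A)) \<longlonglongrightarrow> 2 * c * (norm (x - x) * measure M A)"
        by (intro tendsto_intros u(2))
      ultimately show ?thesis by (intro LIMSEQ_le_const[of _ 0]) auto
    qed
    then show ?case by simp
  next
    case (add f h)
    then show ?case
      using L_add[of f h] gint unfolding P_def pairing_def by (simp add: blinfun.add_right)
  next
    case (lim f s)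
    note sint = \<open>\<And>i. integrable M (s i)\<close> and IH = \<open>\<And>i. L (s i) = P (s i)\<close>
      and slim = \<open>\<And>w. w \<in> space M \<Longrightarrow> (\<lambda>i. s i w) \<longlonglongrightarrow> f w\<close> and fint = \<open>integrable M f\<close>
      and sle = \<open>\<And>i w. w \<in> space M \<Longrightarrow> norm (s i w) \<le> 2 * norm (f w)\<close>
    have "(\<lambda>i. \<integral>w. norm (f w - s i w) \<partial>M) \<longlonglongrightarrow> (\<integral>w. 0 \<partial>M)"
    proof (rule integral_dominated_convergence)
      show "integrable M (\<lambda>w. 3 * norm (f w))" using fint by simp
      show "AE w in M. (\<lambda>i. norm (f w - s i w)) \<longlonglongrightarrow> 0"
        using slim by (intro AE_I2) (auto intro!: tendsto_eq_intros)
      show "AE w in M. norm (norm (f w - s i w)) \<le> 3 * norm (f w)" for i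
      proof (rule AE_I2)
        fix w assume "w \<in> space M"
        then show "norm (norm (f w - s i w)) \<le> 3 * norm (f w)"
          using sle[of w i] norm_triangle_ineq4[of "f w" "s i w"] by simp
      qed
    qed (use fint sint in auto)
    then have "(\<lambda>i. 2 * c * (\<integral>w. norm (f w - s i w) \<partial>M)) \<longlonglongrightarrow> 2 * c * 0"
      by (intro tendsto_intros) simp
    moreover have "\<bar>L f - P f\<bar> \<le> 2 * c * (\<integral>w. norm (f w - s i w) \<partial>M)" for i
      using gap[OF fint sint[of i]] IH[of i] by simp
    ultimately have "\<bar>L f - P f\<bar> \<le> 0" by (intro LIMSEQ_le_const[of _ 0]) auto
    then show ?case by simp
  qed
  then show ?thesis using that[of g] gm gn gc unfolding P_def by blast
qed

section \<open>Polars of the normal cones\<close>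

context clarke_distance
begin

lemma functional_le_N:
  assumes L: "linear_functional_on V L" "\<And>x. x \<in> V \<Longrightarrow> L x \<le> qd x" and x: "x \<in> V"
  shows "\<bar>L x\<bar> \<le> N x"
proof -
  have "L (- x) = - L x" using L(1) x unfolding linear_functional_on_def by (metis mult_minus1 scaleR_minus1_left)
  moreover have "L (- x) \<le> N x"
    using L(2)[of "- x"] qd_le_N[of "- x"] N_minus[OF x] x V_simps by auto
  moreover have "L x \<le> N x" using L(2)[OF x] qd_le_N[OF x] by linarith
  ultimately show ?thesis by linarith
qed

text \<open>Serves to add elements of the cone generated by the subdifferential:
  \<open>a *\<^sub>R s + b *\<^sub>R t\<close> is \<open>a + b\<close> times the convex combination
  with these weights.\<close>

lemma combination_le_qd:
  assumes "h \<in> V" "a > 0" "b > 0" "u \<le> qd h" "v \<le> qd h"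
  shows "(a / (a + b)) * u + (b / (a + b)) * v \<le> qd h"
proof -
  have "(a / (a + b)) * u + (b / (a + b)) * v \<le> (a / (a + b)) * qd h + (b / (a + b)) * qd h"
    using assms by (intro add_mono mult_left_mono) auto
  also have "\<dots> = qd h" using assms by (simp add: distrib_right[symmetric] add_divide_distrib[symmetric])
  finally show ?thesis .
qed

end

lemma clarke_distance_norm:
  assumes "xb \<in> C"
  shows "clarke_distance UNIV norm C xb"
  by standard (use assms in \<open>auto simp: norm_triangle_ineq\<close>)

lemma dC_norm: "xb \<in> C \<Longrightarrow> clarke_distance.dC norm C = dist_set C"
  unfolding clarke_distance.dC_def[OF clarke_distance_norm] dist_set_def fun_eq_iff by simp

lemma dd_norm: "xb \<in> C \<Longrightarrow> clarke_distance.dd UNIV norm C xb = clarke_dd (dist_set C) xb"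
  unfolding clarke_distance.dd_def[OF clarke_distance_norm] clarke_dd_def dC_norm fun_eq_iff by simp

text \<open>The bipolar theorem for the cone \<open>K\<close> generated by the subdifferential. If
  \<open>y\<close> were outside the weak-star closure, some \<open>h\<close> would make
  \<open>y\<close> positive and every element of \<open>K\<close> nonpositive. Hahn-Banach provides
  a subgradient whose value at \<open>h\<close> is \<open>qd h\<close>, so
  \<open>qd h \<le> 0\<close>, against the assumption on \<open>y\<close>. The functional is bounded
  because \<open>qd\<close> is at most the norm.\<close>

lemma clarke_normalI:
  fixes C :: "'e::real_normed_vector set"
  assumes xb: "xb \<in> C" and y: "\<And>h. clarke_dd (dist_set C) xb h \<le> 0 \<Longrightarrow> blinfun_apply y h \<le> 0"
  shows "y \<in> clarke_normal C xb"
proof -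
  interpret clarke_distance UNIV norm C xb by (rule clarke_distance_norm[OF xb])
  have sub: "clarke_subdiff (dist_set C) xb = {s. \<forall>h. blinfun_apply s h \<le> qd h}"
    unfolding clarke_subdiff_def dd_norm[OF xb, symmetric] by (simp add: dd_eq)
  define K where "K = {a *\<^sub>R s | a s. a > 0 \<and> s \<in> clarke_subdiff (dist_set C) xb}"
  have KI: "a *\<^sub>R s \<in> K" if "a > 0" "\<And>h. blinfun_apply s h \<le> qd h" for a s
    unfolding K_def sub using that by blast
  have KE: "\<exists>a s. k = a *\<^sub>R s \<and> a > 0 \<and> (\<forall>h. blinfun_apply s h \<le> qd h)" if "k \<in> K" for k
    using that unfolding K_def sub by blast
  have K_add: "k + l \<in> K" if kl: "k \<in> K" "l \<in> K" for k l
  proof -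
    obtain a s where 1: "k = a *\<^sub>R s" "a > 0" "\<forall>h. blinfun_apply s h \<le> qd h" using KE[OF kl(1)] by blast
    obtain b t where 2: "l = b *\<^sub>R t" "b > 0" "\<forall>h. blinfun_apply t h \<le> qd h" using KE[OF kl(2)] by blast
    have "(a + b) *\<^sub>R ((a / (a + b)) *\<^sub>R s + (b / (a + b)) *\<^sub>R t) \<in> K"
      using 1 2 combination_le_qd
      by (intro KI) (auto simp: blinfun.add_left blinfun.scaleR_left)
    moreover have "(a + b) *\<^sub>R ((a / (a + b)) *\<^sub>R s + (b / (a + b)) *\<^sub>R t) = k + l"
      using 1 2 by (simp add: scaleR_add_right)
    ultimately show ?thesis by simp
  qed
  have K_scale: "r *\<^sub>R k \<in> K" if r: "r > 0" and k: "k \<in> K" for r k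
  proof -
    obtain a s where "k = a *\<^sub>R s" "a > 0" "\<forall>h. blinfun_apply s h \<le> qd h" using KE[OF k] by blast
    then show ?thesis using KI[of "r * a" s] r by simp
  qed
  have K_0: "0 \<in> K" using KI[of 1 0] qd_nonneg by simp
  show ?thesis
    unfolding clarke_normal_def weak_star_closure_def K_def[symmetric]
  proof (intro CollectI allI impI, rule ccontr)
    fix F :: "'e set" and e :: real
    assume F: "finite F" and e: "e > 0"
      and no: "\<not> (\<exists>s\<in>K. \<forall>x\<in>F. \<bar>blinfun_apply s x - blinfun_apply y x\<bar> < e)"
    obtain c where c: "\<And>s. s \<in> blinfun_apply ` K \<Longrightarrow> (\<Sum>f\<in>F. c f * s f) \<le> 0"
      "(\<Sum>f\<in>F. c f * blinfun_apply y f) > 0"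
    proof (rule separation_on_finite[of "blinfun_apply ` K" F e "blinfun_apply y"])
      fix s t assume "s \<in> blinfun_apply ` K" "t \<in> blinfun_apply ` K"
      then obtain k l where "k \<in> K" "l \<in> K" "s = blinfun_apply k" "t = blinfun_apply l" by auto
      then show "s + t \<in> blinfun_apply ` K"
        using K_add by (intro image_eqI[of _ _ "k + l"]) (auto simp: fun_eq_iff blinfun.add_left)
    next
      fix r :: real and s assume "r > 0" "s \<in> blinfun_apply ` K"
      then obtain k where "k \<in> K" "s = blinfun_apply k" "r > 0" by auto
      then show "r *\<^sub>R s \<in> blinfun_apply ` K"
        using K_scale by (intro image_eqI[of _ _ "r *\<^sub>R k"]) (auto simp: fun_eq_iff blinfun.scaleR_left)
    next
      show "0 \<in> blinfun_apply ` K"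
        using K_0 by (intro image_eqI[of _ _ 0]) (auto simp: fun_eq_iff)
    next
      fix s assume "s \<in> blinfun_apply ` K"
      then show "\<exists>f\<in>F. e \<le> \<bar>s f - blinfun_apply y f\<bar>" using no by (auto simp: not_less)
    qed (use F e in auto)
    define h where "h = (\<Sum>f\<in>F. c f *\<^sub>R f)"
    have apply_h: "blinfun_apply s h = (\<Sum>f\<in>F. c f * blinfun_apply s f)" for s :: "'e \<Rightarrow>\<^sub>L real"
      by (simp add: h_def blinfun.sum_right blinfun.scaleR_right)
    have "\<not> qd h \<le> 0"
      using y[of h] c(2) apply_h[of y] dd_norm[OF xb] dd_eq[of h] by (auto simp: zero_ereal_def)
    obtain L where L: "linear_functional_on UNIV L" "\<And>x. L x \<le> qd x" "L h = qd h"
      using Hahn_Banach_sublinear[OF V qd_sublinear UNIV_I[of h]] by auto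
    have bl: "bounded_linear L"
    proof (rule bounded_linear_intro[of L 1])
      show "norm (L x) \<le> norm x * 1" for x
        using functional_le_N[OF L(1)] L(2) by simp
    qed (use L(1) in \<open>auto simp: linear_functional_on_def\<close>)
    have "1 *\<^sub>R Blinfun L \<in> K"
      using L(2) bounded_linear_Blinfun_apply[OF bl] by (intro KI) auto
    then have "blinfun_apply (Blinfun L) h \<le> 0" using c(1)[of "blinfun_apply (Blinfun L)"] apply_h by auto
    then show False using bounded_linear_Blinfun_apply[OF bl] L(3) \<open>\<not> qd h \<le> 0\<close> by simp
  qed
qed

section \<open>Convexity of \<open>Lq_wstar\<close>, the pairing, and the bipolar theorem in
  L^p\<close>

context Lp_space
begin

lemma Lq_bounded:
  fixes g :: "'a \<Rightarrow> 'e::{banach,second_countable_topology} \<Rightarrow>\<^sub>L real"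
  assumes m: "\<And>x. (\<lambda>w. blinfun_apply (g w) x) \<in> borel_measurable M" and c: "\<And>w. norm (g w) \<le> c"
  shows "g \<in> Lq_wstar M p"
proof -
  have n: "(\<lambda>w. norm (g w)) \<in> borel_measurable M" by (rule blinfun_norm_measurable[OF m])
  show ?thesis
  proof (cases "p = 1")
    case True
    then show ?thesis unfolding Lq_wstar_def using m n c by (auto intro!: exI[of _ c])
  next
    case False
    have "integrable M (\<lambda>w. norm (g w) powr (p / (p - 1)))"
    proof (rule integrable_const_bound)
      show "AE w in M. norm (norm (g w) powr (p / (p - 1))) \<le> c powr (p / (p - 1))"
        using c p False by (intro AE_I2) (auto intro!: powr_mono2)
    qed (use n in measurable)
    then show ?thesis unfolding Lq_wstar_def using m n False by auto
  qed
qed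

lemma LqD:
  fixes g :: "'a \<Rightarrow> 'e::{banach,second_countable_topology} \<Rightarrow>\<^sub>L real"
  assumes "g \<in> Lq_wstar M p"
  shows "(\<lambda>w. blinfun_apply (g w) x) \<in> borel_measurable M"
  using assms unfolding Lq_wstar_def by auto

lemma Lq_pairing_integrable:
  fixes g :: "'a \<Rightarrow> 'e::{banach,second_countable_topology} \<Rightarrow>\<^sub>L real"
  assumes "g \<in> Lq_wstar M p" "f \<in> Lp M p"
  shows "integrable M (\<lambda>w. blinfun_apply (g w) (f w))"
  by (rule pairing_integrable[OF assms blinfun_apply_measurable[OF LqD[OF assms(1)] LpD(1)[OF assms(2)]]])

lemma Lq_convex:
  fixes s t :: "'a \<Rightarrow> 'e::{banach,second_countable_topology} \<Rightarrow>\<^sub>L real"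
  assumes s: "s \<in> Lq_wstar M p" and t: "t \<in> Lq_wstar M p" and ab: "0 \<le> a" "0 \<le> b" "a + b = 1"
  shows "(\<lambda>w. a *\<^sub>R s w + b *\<^sub>R t w) \<in> Lq_wstar M p"
proof -
  let ?u = "\<lambda>w. a *\<^sub>R s w + b *\<^sub>R t w"
  have m: "(\<lambda>w. blinfun_apply (?u w) x) \<in> borel_measurable M" for x
    using LqD[OF s, of x] LqD[OF t, of x] by (simp add: blinfun.add_left blinfun.scaleR_left)
  have n: "(\<lambda>w. norm (?u w)) \<in> borel_measurable M" by (rule blinfun_norm_measurable[OF m])
  have le: "norm (?u w) \<le> a * norm (s w) + b * norm (t w)" for w
    using norm_triangle_ineq[of "a *\<^sub>R s w" "b *\<^sub>R t w"] ab by simp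
  show ?thesis
  proof (cases "p = 1")
    case True
    obtain C1 C2 where "AE w in M. norm (s w) \<le> C1" "AE w in M. norm (t w) \<le> C2"
      using s t True unfolding Lq_wstar_def by auto
    then have "AE w in M. norm (?u w) \<le> a * C1 + b * C2"
    proof eventually_elim
      case (elim w)
      show ?case using le[of w] mult_left_mono[OF elim(1) ab(1)] mult_left_mono[OF elim(2) ab(2)] by linarith
    qed
    then show ?thesis unfolding Lq_wstar_def using m n True by auto
  next
    case False
    define q where "q = p / (p - 1)"
    have q: "1 \<le> q" using p False by (simp add: q_def field_simps)
    have i: "integrable M (\<lambda>w. a * norm (s w) powr q + b * norm (t w) powr q)"
      using s t False unfolding Lq_wstar_def q_def by auto
    have "integrable M (\<lambda>w. norm (?u w) powr q)"
    proof (rule Bochner_Integration.integrable_bound[OF i])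
      show "(\<lambda>w. norm (?u w) powr q) \<in> borel_measurable M" using n by measurable
      have le_q: "norm (?u w) powr q \<le> a * norm (s w) powr q + b * norm (t w) powr q" for w
      proof -
        have "norm (?u w) powr q \<le> (a * norm (s w) + b * norm (t w)) powr q"
          using le q by (intro powr_mono2) auto
        also have "\<dots> \<le> a * norm (s w) powr q + b * norm (t w) powr q"
          using ab q by (intro convex_powr) auto
        finally show ?thesis .
      qed
      show "AE w in M. norm (norm (?u w) powr q) \<le> norm (a * norm (s w) powr q + b * norm (t w) powr q)"
        using order_trans[OF le_q abs_ge_self] by (intro AE_I2) simp
    qed
    then show ?thesis unfolding Lq_wstar_def using m n False by (auto simp: q_def)
  qed
qed

lemma pairing_scale_left: "pairing M (\<lambda>w. a *\<^sub>R s w) f = a * pairing M s f"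
  unfolding pairing_def by (simp add: blinfun.scaleR_left)

lemma pairing_combination:
  fixes s t :: "'a \<Rightarrow> 'e::{banach,second_countable_topology} \<Rightarrow>\<^sub>L real"
  assumes "s \<in> Lq_wstar M p" "t \<in> Lq_wstar M p" "f \<in> Lp M p"
  shows "pairing M (\<lambda>w. a *\<^sub>R s w + b *\<^sub>R t w) f = a * pairing M s f + b * pairing M t f"
  unfolding pairing_def
  using Lq_pairing_integrable[OF assms(1,3)] Lq_pairing_integrable[OF assms(2,3)]
  by (simp add: blinfun.scaleR_left blinfun.add_left)

lemma pairing_sum:
  fixes s :: "'a \<Rightarrow> 'e::{banach,second_countable_topology} \<Rightarrow>\<^sub>L real"
  assumes "s \<in> Lq_wstar M p" "finite F" "F \<subseteq> Lp M p"
  shows "pairing M s (\<Sum>f\<in>F. c f *\<^sub>R f) = (\<Sum>f\<in>F. c f * pairing M s f)"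
proof -
  have app: "(\<Sum>f\<in>F. c f *\<^sub>R f) w = (\<Sum>f\<in>F. c f *\<^sub>R f w)" for w
    by (induction F rule: infinite_finite_induct) auto
  have "integrable M (\<lambda>w. blinfun_apply (s w) (f w))" if "f \<in> F" for f
    using Lq_pairing_integrable assms that by blast
  then show ?thesis
    unfolding pairing_def app by (simp add: blinfun.sum_right blinfun.scaleR_right)
qed

end

locale decomposable = Lp_space M p for M :: "'a measure" and p :: real +
  fixes Gam :: "'a \<Rightarrow> 'e::{banach,second_countable_topology} set" and fb :: "'a \<Rightarrow> 'e"
  assumes graph: "{(w, x). w \<in> space M \<and> x \<in> Gam w} \<in> sets (M \<Otimes>\<^sub>M borel)"
    and fb: "fb \<in> Lp M p" and fb_in: "AE w in M. fb w \<in> Gam w"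
begin

definition sel :: "('a \<Rightarrow> 'e) set" where
  "sel = {f \<in> Lp M p. AE w in M. f w \<in> Gam w}"

sublocale D: clarke_distance "Lp M p" "Lp_norm M p" sel fb
proof
  show "subspace (Lp M p :: ('a \<Rightarrow> 'e) set)" by (rule Lp_subspace)
qed (use Minkowski(2) Lp_scale(2) fb fb_in in \<open>auto simp: sel_def\<close>)

lemma dC_Lp: "D.dC = Lp_dist_set M p sel"
  unfolding D.dC_def Lp_dist_set_def fun_eq_iff by (simp add: fun_diff_def)

lemma dd_Lp: "D.dd = Lp_clarke_dd M p (Lp_dist_set M p sel) fb"
  unfolding D.dd_def Lp_clarke_dd_def dC_Lp fun_eq_iff by (simp add: fun_diff_def plus_fun_def scaleR_fun_def)

lemma subdiff_iff:
  "s \<in> Lp_clarke_subdiff M p (Lp_dist_set M p sel) fb \<longleftrightarrow>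
     s \<in> Lq_wstar M p \<and> (\<forall>h\<in>Lp M p. pairing M s h \<le> D.qd h)"
  unfolding Lp_clarke_subdiff_def dd_Lp[symmetric] by (auto simp: D.dd_eq)

text \<open>Only the neighbourhood given by the single function \<open>h\<close> is needed: every
  subgradient is at most \<open>D.qd h\<close> there, and a positive factor or a weak-star limit
  preserves the sign.\<close>

lemma Lp_normalD:
  assumes g: "g \<in> Lp_clarke_normal M p sel fb" and h: "h \<in> Lp M p" "D.qd h \<le> 0"
  shows "pairing M g h \<le> 0"
proof (rule field_le_epsilon)
  fix e :: real assume e: "e > 0"
  have "\<exists>s\<in>{(\<lambda>w. a *\<^sub>R s w) | a s. a > 0 \<and> s \<in> Lp_clarke_subdiff M p (Lp_dist_set M p sel) fb}.
    \<forall>f\<in>{h}. \<bar>pairing M s f - pairing M g f\<bar> < e"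
  proof -
    have "\<forall>F. F \<subseteq> Lp M p \<and> finite F \<longrightarrow> (\<forall>e>0. \<exists>s\<in>{(\<lambda>w. a *\<^sub>R s w) | a s. a > 0 \<and>
        s \<in> Lp_clarke_subdiff M p (Lp_dist_set M p sel) fb}. \<forall>f\<in>F. \<bar>pairing M s f - pairing M g f\<bar> < e)"
      using g unfolding Lp_clarke_normal_def Lp_weak_star_closure_def mem_Collect_eq by (rule conjunct2)
    from this[rule_format, of "{h}" e] show ?thesis using h(1) e by simp
  qed
  then obtain a s where a: "a > 0" and s: "s \<in> Lp_clarke_subdiff M p (Lp_dist_set M p sel) fb"
    and lt: "\<bar>pairing M (\<lambda>w. a *\<^sub>R s w) h - pairing M g h\<bar> < e"
    by blast
  have "pairing M s h \<le> 0" using s h unfolding subdiff_iff by force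
  then have "a * pairing M s h \<le> 0" using a by (simp add: mult_nonneg_nonpos)
  then show "pairing M g h \<le> 0 + e" using lt by (simp add: pairing_scale_left)
qed

text \<open>The separation argument is the one used in E, but the polar is taken with respect to the
  subgradients in \<open>Lq_wstar\<close> and not through \<open>D.qd h \<le> 0\<close>: the
  functional that Hahn-Banach attaches to \<open>D.qd\<close> on L^p has no representing map at this
  point.\<close>

lemma Lp_normalI:
  assumes g: "g \<in> Lq_wstar M p"
    and polar: "\<And>h. h \<in> Lp M p \<Longrightarrow>
      (\<And>s. s \<in> Lp_clarke_subdiff M p (Lp_dist_set M p sel) fb \<Longrightarrow> pairing M s h \<le> 0) \<Longrightarrow> pairing M g h \<le> 0"
  shows "g \<in> Lp_clarke_normal M p sel fb"
proof -
  define sub where "sub = Lp_clarke_subdiff M p (Lp_dist_set M p sel) fb"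
  \<comment> \<open>The integral of a non-integrable function is 0 by convention, which could break
    additivity in \<open>s\<close>; the pairing is therefore set to 0 outside \<open>Lp\<close>, so
    that the functionals form a cone.\<close>
  define res where "res s f = (if f \<in> Lp M p then pairing M s f else 0)" for s :: "'a \<Rightarrow> 'e \<Rightarrow>\<^sub>L real" and f
  define S where "S = {r *\<^sub>R res s | r s. r > 0 \<and> s \<in> sub}"
  have sub: "s \<in> sub \<longleftrightarrow> s \<in> Lq_wstar M p \<and> (\<forall>h\<in>Lp M p. pairing M s h \<le> D.qd h)" for s
    unfolding sub_def by (rule subdiff_iff)
  have SI: "r *\<^sub>R res s \<in> S" if "r > 0" "s \<in> sub" for r s
    unfolding S_def using that by blast
  have SE: "\<exists>r s. k = r *\<^sub>R res s \<and> r > 0 \<and> s \<in> sub" if "k \<in> S" for k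
    using that unfolding S_def by blast
  show ?thesis
    unfolding Lp_clarke_normal_def Lp_weak_star_closure_def sub_def[symmetric]
  proof (intro CollectI conjI allI impI g, rule ccontr)
    fix F :: "('a \<Rightarrow> 'e) set" and e :: real
    assume F: "F \<subseteq> Lp M p \<and> finite F" and e: "e > 0"
      and no: "\<not> (\<exists>s\<in>{(\<lambda>w. a *\<^sub>R s w) | a s. a > 0 \<and> s \<in> sub}. \<forall>f\<in>F. \<bar>pairing M s f - pairing M g f\<bar> < e)"
    have no': "\<exists>f\<in>F. e \<le> \<bar>a * pairing M s f - pairing M g f\<bar>" if "a > 0" "s \<in> sub" for a s
    proof -
      have "\<not> (\<forall>f\<in>F. \<bar>pairing M (\<lambda>w. a *\<^sub>R s w) f - pairing M g f\<bar> < e)" using no that by blast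
      then show ?thesis by (auto simp: pairing_scale_left not_less)
    qed
    obtain c where c: "\<And>s. s \<in> S \<Longrightarrow> (\<Sum>f\<in>F. c f * s f) \<le> 0" "(\<Sum>f\<in>F. c f * pairing M g f) > 0"
    proof (rule separation_on_finite[of S F e "pairing M g"])
      fix k l assume "k \<in> S" "l \<in> S"
      then obtain a s b t where k: "k = a *\<^sub>R res s" "a > 0" "s \<in> sub" and l: "l = b *\<^sub>R res t" "b > 0" "t \<in> sub"
        using SE by meson
      define u where "u = (\<lambda>w. (a / (a + b)) *\<^sub>R s w + (b / (a + b)) *\<^sub>R t w)"
      have st: "s \<in> Lq_wstar M p" "t \<in> Lq_wstar M p" using k l sub by auto
      have pu: "pairing M u f = (a / (a + b)) * pairing M s f + (b / (a + b)) * pairing M t f" if "f \<in> Lp M p" for f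
        unfolding u_def by (rule pairing_combination[OF st that])
      have "u \<in> Lq_wstar M p"
        unfolding u_def using k(2) l(2) by (intro Lq_convex st) (auto simp: add_divide_distrib[symmetric])
      then have "u \<in> sub"
        using k l pu D.combination_le_qd unfolding sub by auto
      moreover have "k + l = (a + b) *\<^sub>R res u"
        using k(1,2) l(1,2) pu by (auto simp: fun_eq_iff res_def distrib_left)
      ultimately show "k + l \<in> S" using SI[of "a + b" u] k(2) l(2) by simp
    next
      fix r :: real and k assume r: "r > 0" and "k \<in> S"
      then obtain a s where "k = a *\<^sub>R res s" "a > 0" "s \<in> sub" using SE by meson
      then show "r *\<^sub>R k \<in> S" using SI[of "r * a" s] r by simp
    next
      have z: "(\<lambda>w. 0) \<in> sub"
        unfolding sub using Lq_bounded[of "\<lambda>w. 0" 0] D.qd_nonneg by (auto simp: pairing_def)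
      have "1 *\<^sub>R res (\<lambda>w. 0) = 0" by (auto simp: fun_eq_iff res_def pairing_def)
      then show "0 \<in> S" using SI[OF _ z, of 1] by simp
    next
      fix k assume "k \<in> S"
      then obtain a s where k: "k = a *\<^sub>R res s" "a > 0" "s \<in> sub" using SE by meson
      then obtain f where "f \<in> F" "e \<le> \<bar>a * pairing M s f - pairing M g f\<bar>" using no' by blast
      then show "\<exists>f\<in>F. e \<le> \<bar>k f - pairing M g f\<bar>" using k F by (intro bexI[of _ f]) (auto simp: res_def)
    qed (use F e in auto)
    define h where "h = (\<Sum>f\<in>F. c f *\<^sub>R f)"
    have h: "h \<in> Lp M p"
      unfolding h_def using F by (intro subspace_sum[OF Lp_subspace] subspace_scale[OF Lp_subspace]) auto
    have "pairing M s h \<le> 0" if s: "s \<in> sub" for s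
    proof -
      have "pairing M s h = (\<Sum>f\<in>F. c f * (1 *\<^sub>R res s) f)"
        unfolding h_def using s F by (subst pairing_sum) (auto simp: sub res_def intro!: sum.cong)
      also have "\<dots> \<le> 0" by (rule c(1)[OF SI[OF _ s]]) simp
      finally show ?thesis .
    qed
    then have "pairing M g h \<le> 0" using polar[OF h] unfolding sub_def by blast
    moreover have "pairing M g h > 0" unfolding h_def using c(2) F by (subst pairing_sum[OF g]) auto
    ultimately show False by simp
  qed
qed

end

section \<open>Directions in the polar are contingent\<close>

text \<open>The lower limit is nonnegative because distances are, so one sequence of steps along
  which the quotient tends to 0 suffices.\<close>

lemma contingentI:
  fixes C :: "'e::real_normed_vector set"
  assumes xb: "xb \<in> C" and t: "\<And>n. t n > 0" "t \<longlonglongrightarrow> 0"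
    and lim: "(\<lambda>n. dist_set C (xb + t n *\<^sub>R h) / t n) \<longlonglongrightarrow> 0"
  shows "h \<in> contingent_cone C xb"
proof -
  interpret clarke_distance UNIV norm C xb by (rule clarke_distance_norm[OF xb])
  let ?f = "\<lambda>t. ereal (dist_set C (xb + t *\<^sub>R h) / t)"
  have "0 \<le> Liminf (at_right 0) ?f"
    by (rule Liminf_bounded)
      (use dC_nonneg dC_norm[OF xb] in \<open>auto simp: eventually_at_filter zero_ereal_def\<close>)
  moreover have "Liminf (at_right 0) ?f \<le> 0"
  proof (rule ccontr)
    assume "\<not> ?thesis"
    then obtain y where y: "0 < y" "ereal y < Liminf (at_right 0) ?f"
      using ereal_dense2[of 0 "Liminf (at_right 0) ?f"] by (auto simp: not_le zero_ereal_def)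
    have ev: "\<forall>\<^sub>F t in at_right 0. ereal y < ?f t" by (rule less_LiminfD[OF y(2)])
    have "filterlim t (at_right 0) sequentially"
      unfolding filterlim_at using t(2) less_imp_neq[OF t(1)] t(1) by (auto intro!: always_eventually)
    then have "\<forall>\<^sub>F n in sequentially. ereal y < ?f (t n)" using ev by (rule eventually_compose_filterlim[rotated])
    moreover have "\<forall>\<^sub>F n in sequentially. dist_set C (xb + t n *\<^sub>R h) / t n < y"
      using order_tendstoD(2)[OF lim y(1)] .
    ultimately have "\<forall>\<^sub>F n in sequentially. False" by eventually_elim simp
    then show False by simp
  qed
  ultimately show ?thesis unfolding contingent_cone_def by (intro CollectI order.antisym)
qed

context decomposable
begin

lemma dist_set_le: "AE w in M. \<forall>x c. c \<in> Gam w \<longrightarrow> dist_set (Gam w) x \<le> norm (c - x)"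
  using fb_in
proof eventually_elim
  case (elim w)
  interpret P: clarke_distance UNIV norm "Gam w" "fb w" by (rule clarke_distance_norm[OF elim])
  show ?case using P.dC_le dC_norm[OF elim] by simp
qed

text \<open>Hahn-Banach at \<open>h\<close> gives a linear \<open>L\<close> below \<open>P\<close>
  with \<open>L h = P h\<close>. Since \<open>P \<le> nrm1\<close> it is represented by a bounded
  map \<open>s\<close>, and since \<open>P \<le> D.qd\<close> on \<open>Lp\<close> this
  \<open>s\<close> is a subgradient, so \<open>polar\<close> yields \<open>P h \<le> 0\<close>.
  Hence there are directions \<open>u\<close> close to \<open>h\<close> in L^1 with small Clarke
  derivative, and a small step from \<open>fb\<close> along \<open>u\<close> ends close to a
  selection.\<close>

lemma polar_subdiff_contingent:
  assumes h: "h \<in> Lp M p"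
    and polar: "\<And>s. s \<in> Lp_clarke_subdiff M p (Lp_dist_set M p sel) fb \<Longrightarrow> pairing M s h \<le> 0"
  shows "AE w in M. h w \<in> contingent_cone (Gam w) (fb w)"
proof -
  \<comment> \<open>The constant of \<open>L1_le_Lp\<close>: dividing by it makes
    \<open>nrm1\<close> at most the L^p norm, so an L^p estimate for a nearby selection carries over
    to \<open>nrm1\<close>. The added 1 keeps it positive when the space has measure 0.\<close>
  define K where "K = measure M (space M) + 1"
  have K: "K > 0" by (simp add: K_def add_nonneg_pos)
  define nrm1 where "nrm1 f = (\<integral>w. norm (f w) \<partial>M) / K" for f :: "'a \<Rightarrow> 'e"
  define L1 where "L1 = {f :: 'a \<Rightarrow> 'e. integrable M f}"
  have L1: "subspace L1"
    unfolding subspace_def L1_def by (auto simp: plus_fun_def scaleR_fun_def zero_fun_def)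
  have LpL1: "f \<in> L1" if "f \<in> Lp M p" for f using LpD(2)[OF that] by (simp add: L1_def)
  have nrm1_nonneg: "0 \<le> nrm1 f" for f unfolding nrm1_def using K by simp
  have nrm1_add: "nrm1 (f + g) \<le> nrm1 f + nrm1 g" if "f \<in> L1" "g \<in> L1" for f g
  proof -
    have "(\<integral>w. norm ((f + g) w) \<partial>M) \<le> (\<integral>w. norm (f w) + norm (g w) \<partial>M)"
      using that unfolding L1_def by (intro integral_mono) (auto simp: norm_triangle_ineq)
    then show ?thesis
      using that K unfolding L1_def nrm1_def by (simp add: add_divide_distrib[symmetric] divide_right_mono)
  qed
  have nrm1_scale: "nrm1 (r *\<^sub>R f) = \<bar>r\<bar> * nrm1 f" for r f by (simp add: nrm1_def)
  have nrm1_Lp: "nrm1 f \<le> Lp_norm M p f" if "f \<in> Lp M p" for f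
    using L1_le_Lp[OF that] K unfolding nrm1_def K_def[symmetric] by (simp add: divide_le_eq mult.commute)

  text \<open>The infimal convolution of the Clarke derivative with an \<open>L\<^sup>1\<close> norm is sublinear on
    all of \<open>L\<^sup>1\<close>, and every linear functional below it is bounded there.\<close>
  define P where "P k = (INF u\<in>Lp M p. D.qd u + nrm1 (k - u))" for k
  have Lp_ne: "(Lp M p :: ('a \<Rightarrow> 'e) set) \<noteq> {}" using fb by auto
  have P_bdd: "bdd_below ((\<lambda>u. D.qd u + nrm1 (k - u)) ` Lp M p)" for k
    using D.qd_nonneg nrm1_nonneg by (intro bdd_belowI[of _ 0]) (auto intro: add_nonneg_nonneg)
  have P_lower: "P k \<le> D.qd u + nrm1 (k - u)" if "u \<in> Lp M p" for k u
    unfolding P_def by (intro cINF_lower P_bdd that)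
  have P_greatest: "c \<le> P k" if "\<And>u. u \<in> Lp M p \<Longrightarrow> c \<le> D.qd u + nrm1 (k - u)" for c k
    unfolding P_def by (intro cINF_greatest Lp_ne that)
  have qd_add: "D.qd (u + v) \<le> D.qd u + D.qd v" and qd_scale: "r > 0 \<Longrightarrow> D.qd (r *\<^sub>R u) = r * D.qd u"
    if "u \<in> Lp M p" "v \<in> Lp M p" for u v r
    using D.qd_sublinear that unfolding sublinear_on_def by auto
  have P_hom: "P (r *\<^sub>R k) \<le> r * P k" if r: "r > 0" for r k
  proof -
    have "P (r *\<^sub>R k) / r \<le> P k"
    proof (rule P_greatest)
      fix u :: "'a \<Rightarrow> 'e" assume u: "u \<in> Lp M p"
      have "P (r *\<^sub>R k) \<le> D.qd (r *\<^sub>R u) + nrm1 (r *\<^sub>R k - r *\<^sub>R u)"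
        using u by (intro P_lower) (simp add: D.V_simps)
      also have "\<dots> = r * (D.qd u + nrm1 (k - u))"
        using r qd_scale[OF u u r] by (simp only: scaleR_diff_right[symmetric] nrm1_scale) (simp add: distrib_left)
      finally show "P (r *\<^sub>R k) / r \<le> D.qd u + nrm1 (k - u)" using r by (simp add: divide_le_eq mult.commute)
    qed
    then show ?thesis using r by (simp add: divide_le_eq mult.commute)
  qed
  have P_sub: "sublinear_on L1 P"
    unfolding sublinear_on_def
  proof (intro conjI ballI allI impI)
    fix k l assume k: "k \<in> L1" and l: "l \<in> L1"
    have *: "P (k + l) \<le> (D.qd u + nrm1 (k - u)) + (D.qd v + nrm1 (l - v))"
      if u: "u \<in> Lp M p" and v: "v \<in> Lp M p" for u v
    proof -
      have "P (k + l) \<le> D.qd (u + v) + nrm1 ((k + l) - (u + v))"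
        using u v by (intro P_lower) (simp add: D.V_simps)
      also have "(k + l) - (u + v) = (k - u) + (l - v)" by simp
      also have "nrm1 \<dots> \<le> nrm1 (k - u) + nrm1 (l - v)"
        using k l u v LpL1 by (intro nrm1_add subspace_diff[OF L1]) auto
      finally show ?thesis using qd_add[OF u v] by linarith
    qed
    have "P (k + l) - P l \<le> P k"
    proof (rule P_greatest)
      fix u :: "'a \<Rightarrow> 'e" assume u: "u \<in> Lp M p"
      have "P (k + l) - (D.qd u + nrm1 (k - u)) \<le> P l"
        using *[OF u] by (intro P_greatest) (simp add: algebra_simps)
      then show "P (k + l) - P l \<le> D.qd u + nrm1 (k - u)" by linarith
    qed
    then show "P (k + l) \<le> P k + P l" by linarith
  next
    fix k and r :: real assume "k \<in> L1" and r: "r > 0"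
    have "P ((1/r) *\<^sub>R (r *\<^sub>R k)) \<le> (1/r) * P (r *\<^sub>R k)" using r by (intro P_hom) auto
    then have "r * P k \<le> P (r *\<^sub>R k)" using r by (simp add: field_simps)
    with P_hom[OF r] show "P (r *\<^sub>R k) = r * P k" by (simp add: antisym)
  qed
  have qd_0: "D.qd 0 = 0" using sublinear_on_zero[OF D.V D.qd_sublinear] .
  have nrm1_0: "nrm1 0 = 0" by (simp add: nrm1_def)
  have P_qd: "P k \<le> D.qd k" if "k \<in> Lp M p" for k using P_lower[OF that, of k] nrm1_0 by simp
  have P_nrm1: "P k \<le> nrm1 k" for k using P_lower[of 0 k] D.V_simps(5) qd_0 by simp

  have "P h \<le> 0"
  proof -
    obtain L where L: "linear_functional_on L1 L" "\<And>k. k \<in> L1 \<Longrightarrow> L k \<le> P k" "L h = P h"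
      using Hahn_Banach_sublinear[OF L1 P_sub LpL1[OF h]] by blast
    have bound: "\<bar>L k\<bar> \<le> 1 / K * (\<integral>w. norm (k w) \<partial>M)" if k: "integrable M k" for k
    proof -
      have kL: "k \<in> L1" "- k \<in> L1" using k subspace_neg[OF L1] by (auto simp: L1_def)
      have "L (- k) = - L k" using L(1) kL unfolding linear_functional_on_def by (metis mult_minus1 scaleR_minus1_left)
      moreover have "nrm1 (- k) = nrm1 k" by (simp add: nrm1_def)
      ultimately show ?thesis
        using L(2)[OF kL(1)] L(2)[OF kL(2)] P_nrm1[of k] P_nrm1[of "- k"] unfolding nrm1_def by auto
    qed
    obtain s where s: "\<And>x. (\<lambda>w. blinfun_apply (s w) x) \<in> borel_measurable M"
      "\<And>w. norm (s w) \<le> 1 / K" "\<And>f. integrable M f \<Longrightarrow> L f = pairing M s f"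
      using L1_dual_representation[OF L(1)[unfolded L1_def] bound] K by (metis less_imp_le zero_le_divide_1_iff)
    have ps: "pairing M s k \<le> P k" if "k \<in> Lp M p" for k
      using L(2)[OF LpL1[OF that]] s(3)[OF LpD(2)[OF that]] by simp
    have "s \<in> Lp_clarke_subdiff M p (Lp_dist_set M p sel) fb"
      unfolding subdiff_iff using Lq_bounded[OF s(1,2)] ps P_qd by (auto intro: order_trans)
    from polar[OF this] show ?thesis using L(3) s(3)[OF LpD(2)[OF h]] by simp
  qed

  define near where "near n t c \<longleftrightarrow> 0 < t \<and> t < 1 / real (Suc n) \<and> c \<in> sel \<and>
      (\<integral>w. norm (c w - fb w - t *\<^sub>R h w) \<partial>M) \<le> K * t / real (Suc n)" for n t c
  have ex: "\<exists>t c. near n t c" for n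
  proof -
    have "P h < 1 / real (Suc n)" using \<open>P h \<le> 0\<close> by (rule order_le_less_trans) simp
    then obtain u where u: "u \<in> Lp M p" "D.qd u + nrm1 (h - u) < 1 / real (Suc n)"
      using P_greatest[of "1 / real (Suc n)" h] by (meson not_less)
    \<comment> \<open>\<open>r\<close> is what the L^1 cost of replacing \<open>h\<close> by
      \<open>u\<close> leaves of \<open>1 / Suc n\<close>. As \<open>D.qd u < r\<close>, a small
      step \<open>t\<close> along \<open>u\<close> ends within \<open>r * t\<close> of a selection,
      and the two errors add up to at most \<open>t / Suc n\<close>.\<close>
    define r where "r = 1 / real (Suc n) - nrm1 (h - u)"
    have r: "D.qd u < r" using u(2) by (simp add: r_def)
    obtain d where d: "d > 0" "D.step_le u (D.qd u + (r - D.qd u) / 2) d"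
      using D.qdD[OF u(1) order_refl, of "(r - D.qd u) / 2"] r by auto
    define t where "t = min d (1 / real (Suc n)) / 2"
    have t: "0 < t" "t < d" "t < 1 / real (Suc n)" using d(1) by (auto simp: t_def min_def field_simps)
    have "D.dC (fb + t *\<^sub>R u) - D.dC fb \<le> (D.qd u + (r - D.qd u) / 2) * t"
      using t d D.xbV D.N_0 by (intro D.step_leD[OF d(2)]) auto
    also have "\<dots> < r * t"
    proof (rule mult_strict_right_mono[OF _ t(1)])
      show "D.qd u + (r - D.qd u) / 2 < r" using r by (simp add: field_simps)
    qed
    finally obtain c where c: "c \<in> sel" "Lp_norm M p (c - (fb + t *\<^sub>R u)) < r * t"
      using D.dC_less[of "fb + t *\<^sub>R u" "r * t"] D.dC_xb by auto
    have cL: "c - (fb + t *\<^sub>R u) \<in> Lp M p" using c(1) D.CV u(1) fb by (intro D.V_simps) auto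
    have "c - fb - t *\<^sub>R h = (c - (fb + t *\<^sub>R u)) + (- t) *\<^sub>R (h - u)"
      by (simp add: scaleR_diff_right)
    then have tri: "nrm1 (c - fb - t *\<^sub>R h) \<le> nrm1 (c - (fb + t *\<^sub>R u)) + nrm1 ((- t) *\<^sub>R (h - u))"
      using nrm1_add[of "c - (fb + t *\<^sub>R u)" "(- t) *\<^sub>R (h - u)"] LpL1[OF cL]
        LpL1[OF D.V_simps(2)[OF D.V_simps(3)[OF h u(1)]], of "- t"] by (simp only:)
    have "nrm1 ((- t) *\<^sub>R (h - u)) = t * nrm1 (h - u)" using t by (simp only: nrm1_scale)
    moreover have "nrm1 (c - (fb + t *\<^sub>R u)) \<le> r * t" using nrm1_Lp[OF cL] c(2) by linarith
    moreover have "r * t + t * nrm1 (h - u) = t / real (Suc n)" unfolding r_def left_diff_distrib by simp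
    ultimately have "nrm1 (c - fb - t *\<^sub>R h) \<le> t / real (Suc n)" using tri by linarith
    then have "(\<integral>w. norm ((c - fb - t *\<^sub>R h) w) \<partial>M) \<le> t / real (Suc n) * K"
      unfolding nrm1_def pos_divide_le_eq[OF K] .
    then have "(\<integral>w. norm (c w - fb w - t *\<^sub>R h w) \<partial>M) \<le> K * t / real (Suc n)"
      by (simp add: mult.commute)
    then show ?thesis using t c(1) unfolding near_def by blast
  qed
  obtain t c where "\<And>n. near n (t n) (c n)" using ex by metis
  then have t: "\<And>n. 0 < t n" "\<And>n. t n < 1 / real (Suc n)" and c: "\<And>n. c n \<in> sel"
    and le: "\<And>n. (\<integral>w. norm (c n w - fb w - t n *\<^sub>R h w) \<partial>M) \<le> K * t n / real (Suc n)"
    unfolding near_def by blast+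
  \<comment> \<open>The error of the quotient \<open>(c n - fb) / t n\<close> against
    \<open>h\<close>; its norm bounds the distance quotient that defines the contingent
    cone.\<close>
  define z where "z n w = (1 / t n) *\<^sub>R (c n w - fb w - t n *\<^sub>R h w)" for n w
  have zi: "integrable M (z n)" for n
    unfolding z_def using c[of n] LpD(2)[OF fb] LpD(2)[OF h] LpD(2)[of "c n"] by (auto simp: sel_def)
  have zle: "(\<integral>w. norm (z n w) \<partial>M) \<le> K / real (Suc n)" for n
  proof -
    have "(\<integral>w. norm (z n w) \<partial>M) = (\<integral>w. norm (c n w - fb w - t n *\<^sub>R h w) \<partial>M) / t n"
      using t(1)[of n] by (simp add: z_def)
    also have "\<dots> \<le> K / real (Suc n)" using le[of n] t(1)[of n] by (simp add: divide_le_eq mult_ac)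
    finally show ?thesis .
  qed
  have "(\<lambda>n. \<integral>w. norm (z n w) \<partial>M) \<longlonglongrightarrow> 0"
  proof (rule tendsto_sandwich[OF _ _ tendsto_const])
    have "(\<lambda>n. K * (1 / real (Suc n))) \<longlonglongrightarrow> K * 0"
      by (intro tendsto_intros LIMSEQ_Suc[OF lim_1_over_n])
    then show "(\<lambda>n. K / real (Suc n)) \<longlonglongrightarrow> 0" by simp
  qed (use zle in auto)
  then obtain r where r: "strict_mono r" "AE w in M. (\<lambda>n. z (r n) w) \<longlonglongrightarrow> 0"
    using tendsto_L1_AE_subseq[of M z] zi by blast
  have t0: "(\<lambda>n. t (r n)) \<longlonglongrightarrow> 0"
  proof -
    have "t \<longlonglongrightarrow> 0"
      by (rule tendsto_sandwich[OF _ _ tendsto_const LIMSEQ_Suc[OF lim_1_over_n]])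
        (use t in \<open>auto intro!: always_eventually less_imp_le\<close>)
    then show ?thesis by (rule LIMSEQ_subseq_LIMSEQ[OF _ r(1), unfolded comp_def])
  qed
  have "AE w in M. \<forall>n. c n w \<in> Gam w" using c unfolding sel_def AE_all_countable by auto
  then show ?thesis
    using r(2) dist_set_le fb_in
  proof eventually_elim
    case (elim w)
    interpret P: clarke_distance UNIV norm "Gam w" "fb w" by (rule clarke_distance_norm[OF elim(4)])
    show ?case
    proof (rule contingentI[OF elim(4) t(1) t0])
      show "(\<lambda>n. dist_set (Gam w) (fb w + t (r n) *\<^sub>R h w) / t (r n)) \<longlonglongrightarrow> 0"
      proof (rule tendsto_sandwich[OF _ _ tendsto_const])
        show "(\<lambda>n. norm (z (r n) w)) \<longlonglongrightarrow> 0" using elim(2) by (rule tendsto_norm_zero)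
        show "\<forall>\<^sub>F n in sequentially. dist_set (Gam w) (fb w + t (r n) *\<^sub>R h w) / t (r n) \<le> norm (z (r n) w)"
        proof (intro always_eventually allI)
          fix n
          have "dist_set (Gam w) (fb w + t (r n) *\<^sub>R h w) \<le> norm (c (r n) w - (fb w + t (r n) *\<^sub>R h w))"
            using elim(1,3) by blast
          then show "dist_set (Gam w) (fb w + t (r n) *\<^sub>R h w) / t (r n) \<le> norm (z (r n) w)"
            using t(1)[of "r n"] by (simp add: z_def divide_right_mono diff_diff_eq)
        qed
        show "\<forall>\<^sub>F n in sequentially. 0 \<le> dist_set (Gam w) (fb w + t (r n) *\<^sub>R h w) / t (r n)"
          using P.dC_nonneg t(1) unfolding dC_norm[OF elim(4)] by (auto intro!: always_eventually divide_nonneg_pos)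
      qed
    qed
  qed
qed

end

section \<open>Pointwise tangent directions are tangent\<close>

text \<open>Off the null set of the selection, a point lies in the projection exactly when the
  selected pair lies in \<open>A\<close>, and that is a measurable condition.\<close>

lemma (in finite_measure) AE_measurable_projection:
  fixes A :: "('a \<times> 'e::{banach,second_countable_topology}) set"
  assumes A: "A \<in> sets (M \<Otimes>\<^sub>M borel)"
  obtains B N where "B \<in> sets M" "N \<in> null_sets M"
    "\<And>w. w \<in> space M - N \<Longrightarrow> w \<in> B \<longleftrightarrow> (\<exists>x. (w, x) \<in> A)"
proof -
  obtain s N where s: "s \<in> borel_measurable M" "N \<in> null_sets M"
    "\<And>w x. w \<in> space M - N \<Longrightarrow> (w, x) \<in> A \<Longrightarrow> (w, s w) \<in> A"
    by (rule Aumann_selection[OF A]) blast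
  have "(\<lambda>w. (w, s w)) \<in> measurable M (M \<Otimes>\<^sub>M borel)"
    using measurable_Pair[OF measurable_ident s(1)] by simp
  then have "(\<lambda>w. (w, s w)) -` A \<inter> space M \<in> sets M" using A by (rule measurable_sets)
  then show ?thesis using s(2,3) by (intro that) auto
qed

section \<open>From measurable pointwise distances to the Clarke derivative in L^p\<close>

context decomposable
begin

text \<open>For fixed \<open>x\<close> and \<open>r\<close>, the set of points where the distance
  from \<open>x\<close> is below \<open>r\<close> is a projection, measurable up to a null set
  depending on \<open>x\<close> and \<open>r\<close>. Countably many dense \<open>x\<close> and
  rational \<open>r\<close> leave one null set \<open>N\<close>; the value 0 on \<open>N\<close>
  makes the function measurable in \<open>w\<close> at each dense \<open>x\<close> and continuous in
  \<open>x\<close> for every \<open>w\<close>.\<close>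

lemma distance_measurable:
  obtains N where "N \<in> null_sets M" "\<And>w. w \<in> space M - N \<Longrightarrow> fb w \<in> Gam w"
    "(\<lambda>z. if fst z \<in> N then 0 else dist_set (Gam (fst z)) (snd z)) \<in> borel_measurable (M \<Otimes>\<^sub>M borel)"
proof -
  obtain N0 where N0: "N0 \<in> null_sets M" "\<And>w. w \<in> space M - N0 \<Longrightarrow> fb w \<in> Gam w"
    using fb_in by (rule AE_E3) blast
  obtain D :: "'e set" where D: "countable D" "\<And>X. open X \<Longrightarrow> X \<noteq> {} \<Longrightarrow> \<exists>d\<in>D. d \<in> X"
    using countable_dense_exists by blast
  define G where "G = {(w, x). w \<in> space M \<and> x \<in> Gam w}"
  have "\<exists>B N. B \<in> sets M \<and> N \<in> null_sets M \<and>
    (\<forall>w\<in>space M - N. w \<in> B \<longleftrightarrow> (\<exists>y\<in>Gam w. norm (y - x) < r))" for x :: 'e and r :: real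
  proof -
    have "(\<lambda>z. norm (snd z - x)) \<in> borel_measurable (M \<Otimes>\<^sub>M (borel :: 'e measure))" by measurable
    then have "{z \<in> space (M \<Otimes>\<^sub>M borel). norm (snd z - x) < r} \<in> sets (M \<Otimes>\<^sub>M borel)" by measurable
    then have "G \<inter> {z \<in> space (M \<Otimes>\<^sub>M borel). norm (snd z - x) < r} \<in> sets (M \<Otimes>\<^sub>M borel)"
      using graph unfolding G_def by (rule sets.Int[rotated])
    then show ?thesis
      by (rule AE_measurable_projection) (auto simp: G_def space_pair_measure intro!: exI)
  qed
  then obtain B N1 where B: "\<And>x r. B x r \<in> sets M" and N1: "\<And>x r. N1 x r \<in> null_sets M"
    and BN: "\<And>x r w. w \<in> space M - N1 x r \<Longrightarrow> w \<in> B x r \<longleftrightarrow> (\<exists>y\<in>Gam w. norm (y - x) < r)"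
    by metis
  define N where "N = N0 \<union> (\<Union>x\<in>D. \<Union>r\<in>\<rat>. N1 x r)"
  have N: "N \<in> null_sets M"
    unfolding N_def by (intro null_sets.Un N0 null_sets_UN' D(1) countable_rat N1)
  define F where "F w x = (if w \<in> N then 0 else dist_set (Gam w) x)" for w x
  have fbN: "fb w \<in> Gam w" if "w \<in> space M - N" for w using that N0(2) by (auto simp: N_def)
  have less: "dist_set (Gam w) x < r \<longleftrightarrow> (\<exists>y\<in>Gam w. norm (y - x) < r)" if "w \<in> space M - N" for w x r
  proof -
    interpret P: clarke_distance UNIV norm "Gam w" "fb w" by (rule clarke_distance_norm[OF fbN[OF that]])
    show ?thesis
      using P.dC_less[of x r] P.dC_le[of x] unfolding dC_norm[OF fbN[OF that]] by (meson UNIV_I order_le_less_trans)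
  qed
  have Fm: "(\<lambda>w. F w x) \<in> borel_measurable M" if x: "x \<in> D" for x
  proof -
    have rat: "{w\<in>space M. F w x < r} \<in> sets M" if r: "r \<in> \<rat>" for r
    proof -
      have "w \<in> B x r \<longleftrightarrow> F w x < r" if "w \<in> space M - N" for w
        using that x r BN[of w x r] less[OF that, of x r] by (auto simp: F_def N_def)
      then have "{w\<in>space M. F w x < r} = (B x r - N) \<union> (if 0 < r then N else {})"
        using sets.sets_into_space[OF B[of x r]] null_setsD2[OF N, THEN sets.sets_into_space]
        by (auto simp: F_def split: if_splits)
      then show ?thesis using B[of x r] null_setsD2[OF N] by auto
    qed
    show ?thesis
    proof (rule borel_measurableI_less)
      fix a :: real
      have "F w x < a \<longleftrightarrow> (\<exists>r\<in>\<rat> \<inter> {..<a}. F w x < r)" for w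
        using Rats_dense_in_real[of "F w x" a] by (auto intro: less_trans)
      then have "{w\<in>space M. F w x < a} = (\<Union>r\<in>\<rat> \<inter> {..<a}. {w\<in>space M. F w x < r})" by auto
      also have "\<dots> \<in> sets M" using rat by (intro sets.countable_UN'' countable_Int1 countable_rat) auto
      finally show "{w\<in>space M. F w x < a} \<in> sets M" .
    qed
  qed
  have "continuous_on UNIV (F w)" if w: "w \<in> space M" for w
  proof (cases "w \<in> N")
    case True
    then have "F w = (\<lambda>x. 0)" by (auto simp: F_def)
    then show ?thesis by simp
  next
    case False
    then have fbw: "fb w \<in> Gam w" using fbN w by auto
    interpret P: clarke_distance UNIV norm "Gam w" "fb w" by (rule clarke_distance_norm[OF fbw])
    have "1-lipschitz_on UNIV (F w)"
    proof (rule lipschitz_onI)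
      fix x y
      have "\<bar>dist_set (Gam w) x - dist_set (Gam w) y\<bar> \<le> norm (x - y)"
        using P.dC_lipschitz[of x y] P.dC_lipschitz[of y x] unfolding dC_norm[OF fbw]
        by (simp add: norm_minus_commute abs_le_iff)
      then show "dist (F w x) (F w y) \<le> 1 * dist x y"
        using False by (simp add: F_def dist_real_def dist_norm)
    qed simp
    then show ?thesis by (rule lipschitz_on_continuous_on)
  qed
  then have "(\<lambda>z. F (fst z) (snd z)) \<in> borel_measurable (M \<Otimes>\<^sub>M borel)"
    by (intro Caratheodory_measurable[OF D Fm])
  then show ?thesis using that[OF N fbN] unfolding F_def by blast
qed

text \<open>The tolerance \<open>e > 0\<close> makes the sections of \<open>A\<close> nonempty a.e.,
  as the infimum need not be attained.\<close>

lemma near_optimal_selection: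
  assumes u: "u \<in> borel_measurable M" and e: "e > 0"
  obtains c where "c \<in> borel_measurable M"
    "AE w in M. c w \<in> Gam w \<and> norm (c w - u w) \<le> dist_set (Gam w) (u w) + e"
proof -
  obtain N where N: "N \<in> null_sets M" and fbN: "\<And>w. w \<in> space M - N \<Longrightarrow> fb w \<in> Gam w"
    and m: "(\<lambda>z. if fst z \<in> N then 0 else dist_set (Gam (fst z)) (snd z)) \<in> borel_measurable (M \<Otimes>\<^sub>M borel)"
    by (rule distance_measurable) blast
  define \<delta> where "\<delta> w = (if w \<in> N then 0 else dist_set (Gam w) (u w))" for w
  have \<delta>: "\<delta> \<in> borel_measurable M"
    using measurable_compose[OF measurable_Pair[OF measurable_ident u] m] by (simp add: \<delta>_def[abs_def] cong: if_cong)
  define A where "A = {(w, x). w \<in> space M \<and> x \<in> Gam w} \<inter>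
    {z \<in> space (M \<Otimes>\<^sub>M borel). norm (snd z - u (fst z)) \<le> \<delta> (fst z) + e}"
  have "(\<lambda>z. norm (snd z - u (fst z))) \<in> borel_measurable (M \<Otimes>\<^sub>M (borel :: 'e measure))"
    "(\<lambda>z. \<delta> (fst z) + e) \<in> borel_measurable (M \<Otimes>\<^sub>M (borel :: 'e measure))"
    using u \<delta> by measurable
  then have "A \<in> sets (M \<Otimes>\<^sub>M borel)"
    unfolding A_def by (intro sets.Int graph borel_measurable_le)
  then obtain c N' where c: "c \<in> borel_measurable M" "N' \<in> null_sets M"
    "\<And>w x. w \<in> space M - N' \<Longrightarrow> (w, x) \<in> A \<Longrightarrow> (w, c w) \<in> A"
    by (rule Aumann_selection) blast
  have "AE w in M. c w \<in> Gam w \<and> norm (c w - u w) \<le> dist_set (Gam w) (u w) + e"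
    using AE_space AE_not_in[OF N] AE_not_in[OF c(2)]
  proof eventually_elim
    case (elim w)
    then have fbw: "fb w \<in> Gam w" using fbN by auto
    interpret P: clarke_distance UNIV norm "Gam w" "fb w" by (rule clarke_distance_norm[OF fbw])
    obtain y where "y \<in> Gam w" "norm (y - u w) < dist_set (Gam w) (u w) + e"
      using P.dC_less[of "u w" "dist_set (Gam w) (u w) + e"] e unfolding dC_norm[OF fbw] by auto
    then have "(w, y) \<in> A" using elim by (auto simp: A_def \<delta>_def space_pair_measure)
    then have "(w, c w) \<in> A" using c(3)[of w y] elim by auto
    then show ?case using elim by (auto simp: A_def \<delta>_def)
  qed
  then show ?thesis using that c(1) by blast
qed

lemma Lp_tendsto_AE_subseq:
  fixes f :: "nat \<Rightarrow> 'a \<Rightarrow> 'e"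
  assumes f: "\<And>n. f n \<in> Lp M p" and lim: "(\<lambda>n. Lp_norm M p (f n)) \<longlonglongrightarrow> 0"
  obtains r where "strict_mono r" "AE w in M. (\<lambda>n. f (r n) w) \<longlonglongrightarrow> 0"
proof -
  have "(\<lambda>n. \<integral>w. norm (f n w) \<partial>M) \<longlonglongrightarrow> 0"
  proof (rule tendsto_sandwich[OF _ _ tendsto_const])
    have "(\<lambda>n. (measure M (space M) + 1) * Lp_norm M p (f n)) \<longlonglongrightarrow> (measure M (space M) + 1) * 0"
      by (intro tendsto_intros lim)
    then show "(\<lambda>n. (measure M (space M) + 1) * Lp_norm M p (f n)) \<longlonglongrightarrow> 0" by simp
  qed (use L1_le_Lp[OF f] in auto)
  then show ?thesis
    using tendsto_L1_AE_subseq[of M f] LpD(2)[OF f] that by blast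
qed

text \<open>No formula for the L^p distance in terms of pointwise distances is used. Failure gives
  \<open>f n\<close> tending to \<open>fb\<close> in L^p and steps \<open>t n\<close> along which
  the distance grows by more than \<open>e * t n\<close>. A selection \<open>c n\<close> nearly
  optimal for \<open>f n\<close> in L^p is compared with a selection \<open>k n\<close> nearly
  optimal pointwise for \<open>f n + t n *\<^sub>R h\<close>. The excess \<open>b n\<close> is
  dominated and tends to 0 a.e. along a subsequence, so its L^p norm does too, which contradicts
  \<open>e > 0\<close>.\<close>

lemma qd_nonpos:
  assumes h: "h \<in> Lp M p" and ptw: "AE w in M. clarke_dd (dist_set (Gam w)) (fb w) (h w) \<le> 0"
  shows "D.qd h \<le> 0"
proof (rule D.qdI[OF h], rule ccontr)
  fix e :: real assume e: "e > 0" and no: "\<not> (\<exists>d>0. D.step_le h (0 + e) d)"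
  have "\<exists>f t. f \<in> Lp M p \<and> Lp_norm M p (f - fb) < 1 / real (Suc n) \<and> 0 < t \<and> t < 1 / real (Suc n) \<and>
     D.dC (f + t *\<^sub>R h) - D.dC f > e * t" for n
  proof -
    have "\<not> D.step_le h e (1 / real (Suc n))" using no by simp
    then show ?thesis unfolding D.step_le_def by (auto simp: not_le)
  qed
  then obtain f t where f: "\<And>n. f n \<in> Lp M p" "\<And>n. Lp_norm M p (f n - fb) < 1 / real (Suc n)"
    and t: "\<And>n. 0 < t n" "\<And>n. t n < 1 / real (Suc n)"
    and big: "\<And>n. D.dC (f n + t n *\<^sub>R h) - D.dC (f n) > e * t n"
    by metis
  have ffb: "f n - fb \<in> Lp M p" for n by (intro D.V_simps f fb)
  have "\<exists>c. c \<in> sel \<and> Lp_norm M p (c - f n) < D.dC (f n) + t n / real (Suc n)" for n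
    using D.dC_less[of "f n" "D.dC (f n) + t n / real (Suc n)"] t(1)[of n] by auto
  then obtain c where c: "\<And>n. c n \<in> sel" "\<And>n. Lp_norm M p (c n - f n) < D.dC (f n) + t n / real (Suc n)"
    by metis
  have cL: "c n \<in> Lp M p" for n using c(1) D.CV by auto
  define opt where "opt n k \<longleftrightarrow> k \<in> borel_measurable M \<and> (AE w in M. k w \<in> Gam w \<and>
      norm (k w - (f n + t n *\<^sub>R h) w) \<le> dist_set (Gam w) ((f n + t n *\<^sub>R h) w) + t n / real (Suc n))" for n k
  have "\<exists>k. opt n k" for n
  proof -
    have m: "f n + t n *\<^sub>R h \<in> borel_measurable M" by (intro LpD(1) D.V_simps f h)
    have "0 < t n / real (Suc n)" using t(1)[of n] by simp
    from near_optimal_selection[OF m this] show ?thesis unfolding opt_def by blast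
  qed
  then obtain k where "\<And>n. opt n (k n)" by metis
  then have km: "\<And>n. k n \<in> borel_measurable M" and k: "\<And>n. AE w in M. k n w \<in> Gam w \<and>
      norm (k n w - (f n + t n *\<^sub>R h) w) \<le> dist_set (Gam w) ((f n + t n *\<^sub>R h) w) + t n / real (Suc n)"
    unfolding opt_def by blast+
  \<comment> \<open>The positive part of the growth of the pointwise error per unit step: the error
    of \<open>k n\<close> is at most the error of \<open>c n\<close> plus \<open>t n * b n\<close>,
    a sum to which Minkowski's inequality applies.\<close>
  define b where "b n w = max 0 ((norm (k n w - (f n w + t n *\<^sub>R h w)) - norm (c n w - f n w)) / t n)" for n w
  have bm: "b n \<in> borel_measurable M" for n
    unfolding b_def[abs_def] using km[of n] LpD(1)[OF f(1)[of n]] LpD(1)[OF h] LpD(1)[OF cL[of n]] by measurable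
  define G where "G w = norm (h w) + 1" for w
  have G: "G \<in> Lp M p"
    using Minkowski(1)[OF Lp_norm_fun[OF h] Lp_const[of "1::real"]] by (simp add: G_def[abs_def] plus_fun_def)
  have cAE: "AE w in M. c n w \<in> Gam w" for n using c(1)[of n] by (simp add: sel_def)
  \<comment> \<open>\<open>c n w\<close> itself competes for the distance from
    \<open>f n w + t n *\<^sub>R h w\<close>, so the growth per unit step is at most
    \<open>norm (h w)\<close> plus the tolerance \<open>1 / Suc n \<le> 1\<close>.\<close>
  have bG: "AE w in M. norm (b n w) \<le> norm (G w)" for n
    using k[of n] cAE[of n] dist_set_le
  proof eventually_elim
    case (elim w)
    have "norm (k n w - (f n w + t n *\<^sub>R h w)) \<le> dist_set (Gam w) (f n w + t n *\<^sub>R h w) + t n / real (Suc n)"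
      using elim(1) by simp
    also have "dist_set (Gam w) (f n w + t n *\<^sub>R h w) \<le> norm (c n w - (f n w + t n *\<^sub>R h w))"
      using elim(2,3) by blast
    also have "\<dots> \<le> norm (c n w - f n w) + t n * norm (h w)"
      using norm_triangle_ineq4[of "c n w - f n w" "t n *\<^sub>R h w"] t(1)[of n] by (simp add: diff_diff_eq)
    finally have "norm (k n w - (f n w + t n *\<^sub>R h w)) - norm (c n w - f n w) \<le> t n * (norm (h w) + 1 / real (Suc n))"
      by (simp add: distrib_left)
    also have "\<dots> \<le> t n * G w" unfolding G_def using t(1)[of n] by (intro mult_left_mono add_left_mono) auto
    finally show ?case using t(1)[of n] by (simp add: b_def divide_le_eq mult.commute G_def)
  qed
  \<comment> \<open>The pointwise Clarke bound needs base points near \<open>fb w\<close>; L^p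
    convergence provides them a.e. along a subsequence.\<close>
  obtain r where r: "strict_mono r" "AE w in M. (\<lambda>n. (f (r n) - fb) w) \<longlonglongrightarrow> 0"
  proof (rule Lp_tendsto_AE_subseq[OF ffb])
    show "(\<lambda>n. Lp_norm M p (f n - fb)) \<longlonglongrightarrow> 0"
      by (rule tendsto_sandwich[OF _ _ tendsto_const LIMSEQ_Suc[OF lim_1_over_n]])
        (intro always_eventually allI Lp_norm_nonneg less_imp_le[OF f(2)])+
  qed blast
  have inv0: "(\<lambda>n. 1 / real (Suc (r n))) \<longlonglongrightarrow> 0"
    by (rule LIMSEQ_subseq_LIMSEQ[OF LIMSEQ_Suc[OF lim_1_over_n] r(1), unfolded comp_def])
  have t0: "(\<lambda>n. t (r n)) \<longlonglongrightarrow> 0"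
    by (rule tendsto_sandwich[OF _ _ tendsto_const inv0]) (use t in \<open>auto intro!: always_eventually less_imp_le\<close>)
  have kAE: "AE w in M. \<forall>n. k n w \<in> Gam w \<and>
      norm (k n w - (f n + t n *\<^sub>R h) w) \<le> dist_set (Gam w) ((f n + t n *\<^sub>R h) w) + t n / real (Suc n)"
    using k unfolding AE_all_countable by blast
  have cAE': "AE w in M. \<forall>n. c n w \<in> Gam w" using cAE unfolding AE_all_countable by blast
  have b0: "AE w in M. (\<lambda>n. b (r n) w) \<longlonglongrightarrow> 0"
    using kAE cAE' dist_set_le fb_in ptw r(2)
  proof eventually_elim
    case (elim w)
    interpret P: clarke_distance UNIV norm "Gam w" "fb w" by (rule clarke_distance_norm[OF elim(4)])
    note kw = elim(1)
    show ?case
    proof (rule LIMSEQ_I)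
      fix \<eta> :: real assume \<eta>: "\<eta> > 0"
      have dd: "P.dd (h w) \<le> ereal 0" using elim(5) dd_norm[OF elim(4)] by (simp add: zero_ereal_def)
      obtain d where d: "d > 0" "P.step_le (h w) (0 + \<eta> / 2) d"
        using P.dd_leD[OF UNIV_I dd, of "\<eta> / 2"] \<eta> by (metis half_gt_zero)
      have "\<forall>\<^sub>F n in sequentially. norm ((f (r n) - fb) w) < d"
        using order_tendstoD(2)[OF tendsto_norm_zero[OF elim(6)] d(1)] .
      moreover have "\<forall>\<^sub>F n in sequentially. t (r n) < d" by (rule order_tendstoD(2)[OF t0 d(1)])
      moreover have "\<forall>\<^sub>F n in sequentially. 1 / real (Suc (r n)) < \<eta> / 2"
        using \<eta> by (intro order_tendstoD(2)[OF inv0]) auto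
      ultimately have "\<forall>\<^sub>F n in sequentially. norm (b (r n) w - 0) < \<eta>"
      proof eventually_elim
        case (elim n)
        define m where "m = r n"
        have "dist_set (Gam w) (f m w + t m *\<^sub>R h w) - dist_set (Gam w) (f m w) \<le> (0 + \<eta> / 2) * t m"
          using P.step_leD[OF d(2), of "f m w" "t m"] elim t(1)[of m]
          unfolding dC_norm[OF \<open>fb w \<in> Gam w\<close>] by (simp add: m_def)
        moreover have "dist_set (Gam w) (f m w) \<le> norm (c m w - f m w)"
          using \<open>\<forall>n. c n w \<in> Gam w\<close> \<open>\<forall>x c. c \<in> Gam w \<longrightarrow> dist_set (Gam w) x \<le> norm (c - x)\<close> by blast
        moreover have "norm (k m w - (f m w + t m *\<^sub>R h w)) \<le> dist_set (Gam w) (f m w + t m *\<^sub>R h w) + t m / real (Suc m)"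
          using kw by simp
        ultimately have "norm (k m w - (f m w + t m *\<^sub>R h w)) - norm (c m w - f m w) \<le> (\<eta> / 2 + 1 / real (Suc m)) * t m"
          by (simp add: distrib_right)
        also have "\<dots> < \<eta> * t m" using elim(3) t(1)[of m] by (intro mult_strict_right_mono) (auto simp: m_def)
        finally have "(norm (k m w - (f m w + t m *\<^sub>R h w)) - norm (c m w - f m w)) / t m < \<eta>"
          using t(1)[of m] by (simp add: divide_less_eq)
        then show ?case using \<eta> by (simp add: b_def m_def[symmetric])
      qed
      then show "\<exists>n0. \<forall>n\<ge>n0. norm (b (r n) w - 0) < \<eta>" unfolding eventually_sequentially .
    qed
  qed
  have blim: "(\<lambda>n. Lp_norm M p (b (r n))) \<longlonglongrightarrow> 0"
    by (rule Lp_norm_dominated_tendsto_0[OF bm G bG b0])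
  have key: "e < 1 / real (Suc n) + Lp_norm M p (b n)" for n
  proof -
    have bL: "b n \<in> Lp M p" by (rule Lp_bound(1)[OF G bm bG])
    have cf: "c n - f n \<in> Lp M p" by (intro D.V_simps cL f)
    define v where "v = (\<lambda>w. norm ((c n - f n) w)) + t n *\<^sub>R b n"
    have vL: "v \<in> Lp M p" unfolding v_def by (intro Minkowski(1) Lp_norm_fun cf Lp_scale(1) bL)
    have "Lp_norm M p v \<le> Lp_norm M p (\<lambda>w. norm ((c n - f n) w)) + Lp_norm M p (t n *\<^sub>R b n)"
      unfolding v_def by (intro Minkowski(2) Lp_norm_fun cf Lp_scale(1) bL)
    also have "\<dots> = Lp_norm M p (c n - f n) + t n * Lp_norm M p (b n)"
      using Lp_scale(2)[OF bL, of "t n"] t(1)[of n] Lp_norm_cong[of "\<lambda>w. norm ((c n - f n) w)" "c n - f n"] by simp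
    finally have v: "Lp_norm M p v \<le> Lp_norm M p (c n - f n) + t n * Lp_norm M p (b n)" .
    have ft: "f n + t n *\<^sub>R h \<in> Lp M p" by (intro D.V_simps f h)
    have kft: "k n - (f n + t n *\<^sub>R h) \<in> borel_measurable M"
      using km[of n] LpD(1)[OF ft] unfolding fun_diff_def by (intro borel_measurable_diff)
    have "norm ((k n - (f n + t n *\<^sub>R h)) w) \<le> norm (v w)" for w
    proof -
      have "norm (k n w - (f n w + t n *\<^sub>R h w)) - norm (c n w - f n w) \<le> b n w * t n"
        using t(1)[of n] by (simp add: b_def pos_divide_le_eq[symmetric])
      moreover have "0 \<le> b n w" by (simp add: b_def)
      ultimately show ?thesis using t(1)[of n] by (simp add: v_def mult.commute)
    qed
    then have kv: "AE w in M. norm ((k n - (f n + t n *\<^sub>R h)) w) \<le> norm (v w)" by simp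
    \<comment> \<open>\<open>k n\<close> is so far only known to be measurable; domination by
      \<open>v\<close> puts its error, and hence \<open>k n\<close> itself, into \<open>Lp\<close>,
      so that it competes for the L^p distance.\<close>
    have kftL: "k n - (f n + t n *\<^sub>R h) \<in> Lp M p" by (rule Lp_bound(1)[OF vL kft kv])
    have "k n = (k n - (f n + t n *\<^sub>R h)) + (f n + t n *\<^sub>R h)" by simp
    then have "k n \<in> Lp M p" using Minkowski(1)[OF kftL ft] by simp
    then have "k n \<in> sel" using k[of n] by (auto simp: sel_def)
    then have "D.dC (f n + t n *\<^sub>R h) \<le> Lp_norm M p (k n - (f n + t n *\<^sub>R h))" by (rule D.dC_le[OF ft])
    also have "\<dots> \<le> Lp_norm M p v" by (rule Lp_bound(2)[OF vL kft kv])
    finally have "e * t n < t n / real (Suc n) + t n * Lp_norm M p (b n)"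
      using v c(2)[of n] big[of n] by linarith
    also have "\<dots> = (1 / real (Suc n) + Lp_norm M p (b n)) * t n" by (simp add: distrib_left mult.commute)
    finally show ?thesis using t(1)[of n] by (simp only: mult_less_cancel_right_pos)
  qed
  have "(\<lambda>n. 1 / real (Suc (r n)) + Lp_norm M p (b (r n))) \<longlonglongrightarrow> 0 + 0"
    by (intro tendsto_intros inv0 blim)
  then have "e \<le> 0 + 0" by (rule LIMSEQ_le_const) (use key less_imp_le in blast)
  then show False using e by simp
qed

end

section \<open>The normal cone of the set of selections\<close>

text \<open>Reduces tangency to countably many conditions, for the sake of measurability. The
  distance is continuous, so the inequality defines a closed set \<open>W\<close>; the admissible
  base points and steps form an open set \<open>U\<close>, in which the points of
  \<open>D \<times> \<rat>\<close> are dense.\<close>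

lemma clarke_dd_nonpos_iff:
  fixes C :: "'e::real_normed_vector set"
  assumes xb: "xb \<in> C" and D: "closure D = UNIV"
  shows "clarke_dd (dist_set C) xb x \<le> 0 \<longleftrightarrow>
    (\<forall>n. \<exists>m. \<forall>y\<in>D. \<forall>t\<in>\<rat>. norm (y - xb) < 1 / real (Suc m) \<and> 0 < t \<and> t < 1 / real (Suc m) \<longrightarrow>
      dist_set C (y + t *\<^sub>R x) - dist_set C y \<le> 1 / real (Suc n) * t)" (is "_ \<longleftrightarrow> ?R")
proof -
  interpret clarke_distance UNIV norm C xb by (rule clarke_distance_norm[OF xb])
  have "clarke_dd (dist_set C) xb x \<le> 0 \<longleftrightarrow> (\<forall>e>0. \<exists>d>0. step_le x (0 + e) d)"
    unfolding dd_norm[OF xb, symmetric] using dd_le_iff[of x 0] by (simp add: zero_ereal_def)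
  also have "\<dots> \<longleftrightarrow> ?R"
  proof
    assume L: "\<forall>e>0. \<exists>d>0. step_le x (0 + e) d"
    show ?R
    proof
      fix n
      have "1 / real (Suc n) > 0" by simp
      then obtain d where d: "d > 0" "step_le x (0 + 1 / real (Suc n)) d" using L by blast
      obtain m where m: "1 / real (Suc m) < d" using nat_approx_posE[OF d(1)] by blast
      have "dist_set C (y + t *\<^sub>R x) - dist_set C y \<le> 1 / real (Suc n) * t"
        if "norm (y - xb) < 1 / real (Suc m) \<and> 0 < t \<and> t < 1 / real (Suc m)" for y t
        using step_leD[OF d(2), of y t] that m unfolding dC_norm[OF xb] by simp
      then show "\<exists>m. \<forall>y\<in>D. \<forall>t\<in>\<rat>. norm (y - xb) < 1 / real (Suc m) \<and> 0 < t \<and> t < 1 / real (Suc m) \<longrightarrow>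
        dist_set C (y + t *\<^sub>R x) - dist_set C y \<le> 1 / real (Suc n) * t" by blast
    qed
  next
    assume R: ?R
    have "1-lipschitz_on UNIV (dist_set C)"
    proof (rule lipschitz_onI)
      fix x y show "dist (dist_set C x) (dist_set C y) \<le> 1 * dist x y"
        using dC_lipschitz[of x y] dC_lipschitz[of y x] unfolding dC_norm[OF xb]
        by (simp add: norm_minus_commute abs_le_iff dist_real_def dist_norm)
    qed simp
    then have dcont: "continuous_on UNIV (dist_set C)" by (rule lipschitz_on_continuous_on)
    have cont: "continuous_on UNIV (\<lambda>z. dist_set C (u z))" if "continuous_on UNIV u" for u :: "'e \<times> real \<Rightarrow> 'e"
      using continuous_on_compose2[OF dcont that] by simp
    show "\<forall>e>0. \<exists>d>0. step_le x (0 + e) d"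
    proof (intro allI impI)
      fix e :: real assume "e > 0"
      then obtain n where n: "1 / real (Suc n) < e" using nat_approx_posE by blast
      from R obtain m where m: "\<forall>y\<in>D. \<forall>t\<in>\<rat>. norm (y - xb) < 1 / real (Suc m) \<and> 0 < t \<and> t < 1 / real (Suc m) \<longrightarrow>
        dist_set C (y + t *\<^sub>R x) - dist_set C y \<le> 1 / real (Suc n) * t" by blast
      define U where "U = {z :: 'e \<times> real. norm (fst z - xb) < 1 / real (Suc m)} \<inter> {z. 0 < snd z} \<inter> {z. snd z < 1 / real (Suc m)}"
      define W where "W = {z :: 'e \<times> real. dist_set C (fst z + snd z *\<^sub>R x) - dist_set C (fst z) \<le> 1 / real (Suc n) * snd z}"
      have "open U" unfolding U_def by (intro open_Int open_Collect_less continuous_intros)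
      then have "U \<inter> closure (D \<times> \<rat>) \<subseteq> closure (U \<inter> (D \<times> \<rat>))" by (rule open_Int_closure_subset)
      then have "U \<subseteq> closure (U \<inter> (D \<times> \<rat>))" by (simp add: closure_Times D Rats_closure_real)
      also have "\<dots> \<subseteq> W"
      proof (rule closure_minimal)
        show "U \<inter> (D \<times> \<rat>) \<subseteq> W" using m unfolding U_def W_def by auto
        show "closed W" unfolding W_def by (intro closed_Collect_le cont continuous_intros)
      qed
      finally have UW: "U \<subseteq> W" .
      have "step_le x (0 + e) (1 / real (Suc m))"
      proof (rule step_leI)
        fix y and t :: real assume yt: "norm (y - xb) < 1 / real (Suc m)" "0 < t" "t < 1 / real (Suc m)"
        then have "(y, t) \<in> W" using UW unfolding U_def by auto
        then have "dist_set C (y + t *\<^sub>R x) - dist_set C y \<le> 1 / real (Suc n) * t" by (simp add: W_def)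
        also have "\<dots> \<le> (0 + e) * t" using n yt by (intro mult_right_mono) auto
        finally show "dC (y + t *\<^sub>R x) - dC y \<le> (0 + e) * t" unfolding dC_norm[OF xb] .
      qed
      then show "\<exists>d>0. step_le x (0 + e) d" by (intro exI[of _ "1 / real (Suc m)"]) simp
    qed
  qed
  finally show ?thesis .
qed

context decomposable
begin

lemma tangent_measurable:
  obtains N T where "N \<in> null_sets M" "\<And>w. w \<in> space M - N \<Longrightarrow> fb w \<in> Gam w"
    "T \<in> sets (M \<Otimes>\<^sub>M borel)"
    "\<And>w x. w \<in> space M - N \<Longrightarrow> (w, x) \<in> T \<longleftrightarrow> clarke_dd (dist_set (Gam w)) (fb w) x \<le> 0"
proof -
  obtain N where N: "N \<in> null_sets M" and fbN: "\<And>w. w \<in> space M - N \<Longrightarrow> fb w \<in> Gam w"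
    and m: "(\<lambda>z. if fst z \<in> N then 0 else dist_set (Gam (fst z)) (snd z)) \<in> borel_measurable (M \<Otimes>\<^sub>M borel)"
    by (rule distance_measurable) blast
  obtain D :: "'e set" where D: "countable D" "closure D = UNIV"
    by (rule countable_dense_rat_subspace) blast
  define F where "F w x = (if w \<in> N then 0 else dist_set (Gam w) x)" for w x
  have F: "(\<lambda>z. F (fst z) (y + t *\<^sub>R snd z)) \<in> borel_measurable (M \<Otimes>\<^sub>M borel)" for y :: 'e and t
  proof -
    have "(\<lambda>z. y + t *\<^sub>R snd z) \<in> borel_measurable (M \<Otimes>\<^sub>M (borel :: 'e measure))" by measurable
    from measurable_compose[OF measurable_Pair[OF measurable_fst this] m]
    show ?thesis by (simp add: F_def[abs_def] cong: if_cong)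
  qed
  define T where "T = {z \<in> space (M \<Otimes>\<^sub>M borel). \<forall>n. \<exists>m. \<forall>y\<in>D. \<forall>t\<in>\<rat>.
      norm (y - fb (fst z)) < 1 / real (Suc m) \<and> 0 < t \<and> t < 1 / real (Suc m) \<longrightarrow>
      F (fst z) (y + t *\<^sub>R snd z) - F (fst z) y \<le> 1 / real (Suc n) * t}"
  have "{z \<in> space (M \<Otimes>\<^sub>M (borel :: 'e measure)). norm (y - fb (fst z)) < 1 / real (Suc m) \<and> 0 < t \<and> t < 1 / real (Suc m) \<longrightarrow>
      F (fst z) (y + t *\<^sub>R snd z) - F (fst z) y \<le> 1 / real (Suc n) * t} \<in> sets (M \<Otimes>\<^sub>M borel)" for y t m n
  proof -
    have [measurable]: "(\<lambda>z. F (fst z) (y + t *\<^sub>R snd z)) \<in> borel_measurable (M \<Otimes>\<^sub>M borel)"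
      "(\<lambda>z. F (fst z) y) \<in> borel_measurable (M \<Otimes>\<^sub>M (borel :: 'e measure))"
      using F[of y t] F[of y 0] by simp_all
    have [measurable]: "fb \<in> borel_measurable M" by (rule LpD(1)[OF fb])
    show ?thesis by measurable
  qed
  then have "T \<in> sets (M \<Otimes>\<^sub>M borel)"
    unfolding T_def
    by (intro sets.sets_Collect_countable_All sets.sets_Collect_countable_Ex
        sets_Collect_Ball_countable D(1) countable_rat)
  moreover have "(w, x) \<in> T \<longleftrightarrow> clarke_dd (dist_set (Gam w)) (fb w) x \<le> 0" if w: "w \<in> space M - N" for w x
    unfolding clarke_dd_nonpos_iff[OF fbN[OF w] D(2)] T_def
    using w by (simp add: space_pair_measure F_def)
  ultimately show ?thesis using that[OF N fbN] by blast
qed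

text \<open>The selected vectors must be made p-integrable before they can be tested: tangency is
  invariant under positive scaling, so they are divided by \<open>1 + norm (s w)\<close> and
  replaced by 0 where no violation is selected. The pairing of \<open>g\<close> with this
  \<open>h\<close> is nonpositive although its integrand is nonnegative, hence violations occur only
  on a null set.\<close>

lemma normal_imp_AE:
  assumes g: "g \<in> Lp_clarke_normal M p sel fb"
  shows "AE w in M. g w \<in> clarke_normal (Gam w) (fb w)"
proof -
  have gq: "g \<in> Lq_wstar M p" using g unfolding Lp_clarke_normal_def Lp_weak_star_closure_def by simp
  obtain N T where N: "N \<in> null_sets M" and fbN: "\<And>w. w \<in> space M - N \<Longrightarrow> fb w \<in> Gam w"
    and T: "T \<in> sets (M \<Otimes>\<^sub>M borel)"
      "\<And>w x. w \<in> space M - N \<Longrightarrow> (w, x) \<in> T \<longleftrightarrow> clarke_dd (dist_set (Gam w)) (fb w) x \<le> 0"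
    by (rule tangent_measurable) blast
  define A where "A = T \<inter> {z \<in> space (M \<Otimes>\<^sub>M borel). 0 < blinfun_apply (g (fst z)) (snd z)}"
  have "(\<lambda>z. blinfun_apply (g (fst z)) (snd z)) \<in> borel_measurable (M \<Otimes>\<^sub>M borel)"
    by (rule blinfun_joint_measurable[OF LqD[OF gq]])
  then have A: "A \<in> sets (M \<Otimes>\<^sub>M borel)"
    unfolding A_def by (intro sets.Int T borel_measurable_less) auto
  obtain s N' where s: "s \<in> borel_measurable M" and N': "N' \<in> null_sets M"
    and sA: "\<And>w x. w \<in> space M - N' \<Longrightarrow> (w, x) \<in> A \<Longrightarrow> (w, s w) \<in> A"
    by (rule Aumann_selection[OF A]) blast
  have "(\<lambda>w. (w, s w)) \<in> measurable M (M \<Otimes>\<^sub>M borel)"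
    using measurable_Pair[OF measurable_ident s] by simp
  then have "(\<lambda>w. (w, s w)) -` A \<inter> space M \<in> sets M" using A by (rule measurable_sets)
  then have B: "{w \<in> space M. (w, s w) \<in> A} \<in> sets M" by (simp add: vimage_def Int_def conj_commute)
  define B where "B = {w \<in> space M. (w, s w) \<in> A}"
  define \<rho> where "\<rho> w = indicator B w / (1 + norm (s w))" for w
  define h where "h w = \<rho> w *\<^sub>R s w" for w
  have \<rho>m: "\<rho> \<in> borel_measurable M"
    unfolding \<rho>_def[abs_def] using s B unfolding B_def[symmetric] by measurable
  have \<rho>: "0 < \<rho> w" if "w \<in> B" for w using that by (simp add: \<rho>_def add_pos_nonneg)
  have h: "h \<in> Lp M p"
  proof (rule Lp_bound(1)[OF Lp_const[of "1::real"]])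
    show "h \<in> borel_measurable M" unfolding h_def[abs_def] using \<rho>m s by measurable
    have "norm (s w) / (1 + norm (s w)) \<le> 1" for w by (simp add: divide_le_eq add_pos_nonneg)
    then show "AE w in M. norm (h w) \<le> norm (1::real)"
      by (intro AE_I2) (auto simp: h_def \<rho>_def indicator_def)
  qed
  have "AE w in M. clarke_dd (dist_set (Gam w)) (fb w) (h w) \<le> 0"
    using AE_space AE_not_in[OF N]
  proof eventually_elim
    case (elim w)
    then have w: "w \<in> space M - N" by simp
    interpret P: clarke_distance UNIV norm "Gam w" "fb w" by (rule clarke_distance_norm[OF fbN[OF w]])
    have "P.qd (h w) \<le> 0"
    proof (cases "w \<in> B")
      case True
      then have "clarke_dd (dist_set (Gam w)) (fb w) (s w) \<le> 0" using T(2)[OF w] by (simp add: B_def A_def)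
      then have "P.qd (s w) \<le> 0" using P.dd_eq[of "s w"] dd_norm[OF fbN[OF w]] by (simp add: zero_ereal_def)
      moreover have "P.qd (h w) = \<rho> w * P.qd (s w)"
        using P.qd_sublinear \<rho>[OF True] unfolding sublinear_on_def h_def by blast
      ultimately show ?thesis using \<rho>[OF True] by (simp add: mult_nonneg_nonpos)
    next
      case False
      then have "h w = 0" by (simp add: h_def \<rho>_def)
      then show ?thesis using sublinear_on_zero[OF P.V P.qd_sublinear] by simp
    qed
    then show ?case using P.dd_eq[of "h w"] dd_norm[OF fbN[OF w]] by (simp add: zero_ereal_def)
  qed
  then have "pairing M g h \<le> 0" by (intro Lp_normalD[OF g h] qd_nonpos[OF h])
  moreover have nn: "AE w in M. 0 \<le> blinfun_apply (g w) (h w)"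
  proof (rule AE_I2)
    fix w show "0 \<le> blinfun_apply (g w) (h w)"
      using \<rho>[of w] by (cases "w \<in> B") (auto simp: h_def blinfun.scaleR_right B_def A_def \<rho>_def)
  qed
  ultimately have "(\<integral>w. blinfun_apply (g w) (h w) \<partial>M) = 0"
    using integral_nonneg_AE[OF nn] unfolding pairing_def by linarith
  then have "AE w in M. blinfun_apply (g w) (h w) = 0"
    using integral_nonneg_eq_0_iff_AE[OF Lq_pairing_integrable[OF gq h] nn] by simp
  then show ?thesis
    using AE_space AE_not_in[OF N] AE_not_in[OF N']
  proof eventually_elim
    case (elim w)
    then have w: "w \<in> space M - N" by simp
    have "w \<notin> B"
    proof
      assume wB: "w \<in> B"
      then have "0 < blinfun_apply (g w) (s w)" by (simp add: B_def A_def)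
      then show False using elim(1) \<rho>[OF wB] by (simp add: h_def blinfun.scaleR_right)
    qed
    show ?case
    proof (rule clarke_normalI[OF fbN[OF w]], rule ccontr)
      fix x assume x: "clarke_dd (dist_set (Gam w)) (fb w) x \<le> 0" and "\<not> blinfun_apply (g w) x \<le> 0"
      then have "(w, x) \<in> A" using T(2)[OF w] w by (simp add: A_def space_pair_measure)
      then have "(w, s w) \<in> A" using sA elim by auto
      then show False using \<open>w \<notin> B\<close> w by (simp add: B_def)
    qed
  qed
qed

lemma AE_imp_normal:
  assumes reg: "AE w in M. regular_at (Gam w) (fb w)"
    and g: "g \<in> Lq_wstar M p" "AE w in M. g w \<in> clarke_normal (Gam w) (fb w)"
  shows "g \<in> Lp_clarke_normal M p sel fb"
proof (rule Lp_normalI[OF g(1)])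
  fix h assume h: "h \<in> Lp M p"
    and polar: "\<And>s. s \<in> Lp_clarke_subdiff M p (Lp_dist_set M p sel) fb \<Longrightarrow> pairing M s h \<le> 0"
  have "AE w in M. h w \<in> contingent_cone (Gam w) (fb w)"
    by (rule polar_subdiff_contingent[OF h polar])
  then have "AE w in M. blinfun_apply (g w) (h w) \<le> 0"
    using reg g(2) by eventually_elim (auto simp: regular_at_def clarke_tangent_def)
  then have "(\<integral>w. blinfun_apply (g w) (h w) \<partial>M) \<le> (\<integral>w. 0 \<partial>M)"
    by (intro integral_mono_AE Lq_pairing_integrable[OF g(1) h]) auto
  then show "pairing M g h \<le> 0" by (simp add: pairing_def)
qed

end

theorem theorem4:
  fixes M :: "'a measure" and p :: real
    and Gam :: "'a \<Rightarrow> 'e::{banach,second_countable_topology} set"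
    and fb :: "'a \<Rightarrow> 'e"
  assumes "finite_measure M"
    and "1 \<le> p"
    and "\<forall>w\<in>space M. closed (Gam w)"
    and "{(w, x). w \<in> space M \<and> x \<in> Gam w} \<in> sets (M \<Otimes>\<^sub>M borel)"
    and "fb \<in> {f \<in> Lp M p. AE w in M. f w \<in> Gam w}"
    and "AE w in M. regular_at (Gam w) (fb w)"
  shows "Lp_clarke_normal M p {f \<in> Lp M p. AE w in M. f w \<in> Gam w} fb =
         {g \<in> Lq_wstar M p. AE w in M. g w \<in> clarke_normal (Gam w) (fb w)}"
proof -
  interpret decomposable M p Gam fb
    using assms unfolding decomposable_def decomposable_axioms_def Lp_space_def Lp_space_axioms_def by auto
  have "Lp_clarke_normal M p sel fb = {g \<in> Lq_wstar M p. AE w in M. g w \<in> clarke_normal (Gam w) (fb w)}"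
    using normal_imp_AE AE_imp_normal[OF assms(6)]
    unfolding Lp_clarke_normal_def Lp_weak_star_closure_def by blast
  then show ?thesis unfolding sel_def .
qed

end
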